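(* Let $k_1\geq k_2\geq t+2$ with $(k_1,k_2)\neq(3,3)$, and let $n\geq 2L(k_1,t)$. If $\mathcal{F}_1\subseteq\Pi(n,k_1)$ and $\mathcal{F}_2\subseteq\Pi(n,k_2)$ are non-trivial cross $t$-intersecting families maximizing $|\mathcal{F}_1||\mathcal{F}_2|$ (among all non-trivial cross $t$-intersecting pairs in $\Pi(n,k_1)\times\Pi(n,k_2)$), then $(\mathcal{F}_1,\mathcal{F}_2)$ is isomorphic to one of $(\mathcal{A}(k_1,k_2,t),\mathcal{B}(k_2,t))$, $(\mathcal{B}(k_1,t),\mathcal{A}(k_2,k_1,t))$, $(\mathcal{C}(k_1,t),\mathcal{D}(k_2,t))$, $(\mathcal{D}(k_1,t),\mathcal{C}(k_2,t))$.
   Context: All letters denote positive integers. $[n]=\{1,\ldots,n\}$. A partition is a set of pairwise disjoint nonempty sets (blocks); $|P|$ is its number of blocks and $\cup P$ the union of its blocks. $\Pi(n,k)$ is the set of all partitions of $[n]$ into $k$ blocks; $S(n,k)=|\Pi(n,k)|$ (Stirling number of the second kind). For partitions $F,G$, $F\cap G$ is the set of common blocks. For $s\geq1$, $[[s]]:=\{\{1\},\ldots,\{s\}\}$. $L(k,t):=(t+1)+(k-t+1)\log_2((t+1)(k-t+1))$. $\mathcal{F}\subseteq\Pi(n,k)$, $\mathcal{G}\subseteq\Pi(n,\ell)$ are cross $t$-intersecting if $|F\cap G|\geq t$ for all $F\in\mathcal{F},G\in\mathcal{G}$; they are non-trivial if the set of blocks belonging to every member of $\mathcal{F}\cup\mathcal{G}$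 has fewer than $t$ elements. Two pairs of families are isomorphic if one is obtained from the other by applying a single permutation of $[n]$ to all blocks. Constructions: for an $\ell$-partition $M$ (of a subset of $[n]$) and $X\subseteq M$ with $|X|=t$, put $\overline{\cup M}=[n]\setminus\cup M$ and $\mathcal{A}(k,X,M)=\{F\in\Pi(n,k):X\subseteq F,\ F\cap(M\setminus X)\neq\emptyset\}$, $\mathcal{B}(\ell,X,M)=\{F\in\Pi(n,\ell):X\subseteq F\}\cup\{(M\setminus\{B\})\cup\{B\cup\overline{\cup M}\}:B\in X\}$; $\mathcal{A}(k,\ell,t)=\mathcal{A}(k,[[t]],[[\ell]])$, $\mathcal{B}(\ell,t)=\mathcal{B}(\ell,[[t]],[[\ell]])$. For a $(t+1)$-partition $T$: $\mathcal{C}(k,T)=\{F\in\Pi(n,k):T\subseteq F\}$, $\mathcal{D}(\ell,T)=\{F\in\Pi(n,\ell):|T\cap F|\geq t\}$; $\mathcal{C}(k,t)=\mathcal{C}(k,[[t+1]])$, $\mathcal{D}(\ell,t)=\mathcal{D}(\ell,[[t+1]])$. *)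

theory Defs
  imports Complex_Main "HOL-Library.Disjoint_Sets"
begin

type_synonym block = "nat set"
type_synonym part = "nat set set"

definition Parts :: "nat \<Rightarrow> nat \<Rightarrow> part set" where
  "Parts n k = {P. partition_on {1..n} P \<and> card P = k}"

definition singl :: "nat \<Rightarrow> part" where
  "singl s = (\<lambda>i. {i}) ` {1..s}"

definition Lfun :: "nat \<Rightarrow> nat \<Rightarrow> real" where
  "Lfun k t = real (t + 1) + real (k - t + 1) * log 2 (real ((t + 1) * (k - t + 1)))"

definition cross_t_int :: "nat \<Rightarrow> part set \<Rightarrow> part set \<Rightarrow> bool" where
  "cross_t_int t F G \<longleftrightarrow> (\<forall>A\<in>F. \<forall>B\<in>G. card (A \<inter> B) \<ge> t)"

definition common_blocks :: "part set \<Rightarrow> part set \<Rightarrow> block set" where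
  "common_blocks F G = {B. \<forall>P\<in>F \<union> G. B \<in> P}"

definition nontrivial :: "nat \<Rightarrow> part set \<Rightarrow> part set \<Rightarrow> bool" where
  "nontrivial t F G \<longleftrightarrow> card (common_blocks F G) < t"

definition perm_fam :: "(nat \<Rightarrow> nat) \<Rightarrow> part set \<Rightarrow> part set" where
  "perm_fam \<sigma> F = (\<lambda>P. (\<lambda>B. \<sigma> ` B) ` P) ` F"

definition iso_pair :: "nat \<Rightarrow> part set \<times> part set \<Rightarrow> part set \<times> part set \<Rightarrow> bool" where
  "iso_pair n X Y \<longleftrightarrow> (\<exists>\<sigma>. bij_betw \<sigma> {1..n} {1..n} \<and>
      perm_fam \<sigma> (fst X) = fst Y \<and> perm_fam \<sigma> (snd X) = snd Y)"

definition famA :: "nat \<Rightarrow> nat \<Rightarrow> part \<Rightarrow> part \<Rightarrow> part set" where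
  "famA n k X M = {F \<in> Parts n k. X \<subseteq> F \<and> F \<inter> (M - X) \<noteq> {}}"

definition famB :: "nat \<Rightarrow> nat \<Rightarrow> part \<Rightarrow> part \<Rightarrow> part set" where
  "famB n l X M = {F \<in> Parts n l. X \<subseteq> F} \<union>
     {(M - {B}) \<union> {B \<union> ({1..n} - \<Union>M)} | B. B \<in> X}"

definition famC :: "nat \<Rightarrow> nat \<Rightarrow> part \<Rightarrow> part set" where
  "famC n k T = {F \<in> Parts n k. T \<subseteq> F}"

definition famD :: "nat \<Rightarrow> nat \<Rightarrow> nat \<Rightarrow> part \<Rightarrow> part set" where
  "famD n t l T = {F \<in> Parts n l. card (T \<inter> F) \<ge> t}"

definition A_std :: "nat \<Rightarrow> nat \<Rightarrow> nat \<Rightarrow> nat \<Rightarrow> part set" where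
  "A_std n k l t = famA n k (singl t) (singl l)"
definition B_std :: "nat \<Rightarrow> nat \<Rightarrow> nat \<Rightarrow> part set" where
  "B_std n l t = famB n l (singl t) (singl l)"
definition C_std :: "nat \<Rightarrow> nat \<Rightarrow> nat \<Rightarrow> part set" where
  "C_std n k t = famC n k (singl (t + 1))"
definition D_std :: "nat \<Rightarrow> nat \<Rightarrow> nat \<Rightarrow> part set" where
  "D_std n l t = famD n t l (singl (t + 1))"

end

theory Submission
  imports Defs "HOL-Combinatorics.Stirling"
begin

text \<open>
  Write \<open>a s = S(n - s, k - s)\<close> and \<open>b s = S(n - s, l - s)\<close>; these bound the number of members of the
  two families containing \<open>s\<close> prescribed blocks. The hypothesis on \<open>n\<close> makes \<open>a s / a (s + 1)\<close> and
  \<open>b s / b (s + 1)\<close> exceed \<open>q\<^sup>2\<close> with \<open>q = (t + 1)(max k l - t + 1)\<close>. Call a set of blocks a \<open>t\<close>-cover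
  of a family if it shares at least \<open>t\<close> blocks with every member. If the smallest \<open>t\<close>-covers of both
  families have more than \<open>t\<close> blocks, branching over the blocks of members of the other family
  shows that the product of the sizes is below that of the construction \<open>(C, D)\<close>. Hence, up to exchanging the
  families, all members of \<open>F\<close> contain a fixed \<open>X\<close> with \<open>t\<close> blocks. Let \<open>CC\<close> be the set of blocks \<open>C\<close> for which
  \<open>X \<union> {C}\<close> is a \<open>t\<close>-cover of \<open>G\<close>. Counting leaves only \<open>|CC| = 1\<close>, which gives \<open>(C, D)\<close>, and
  \<open>|CC| = l - t\<close>, which gives \<open>(A, B)\<close>; non-singleton blocks lose a factor \<open>2\<close>. When \<open>k = t + 2\<close> we have
  \<open>a (t + 1) = 1\<close> and this counting degenerates, so that case is treated separately; only there does
  \<open>(k, l) \<noteq> (3, 3)\<close> matter.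
\<close>


section \<open>Stirling numbers and counting partitions\<close>

text \<open>Up to lower-order terms the benchmarks are \<open>T * a (t + 1) * b t\<close> for (C,
  D), D having one leading term \<open>b t\<close> for each of the \<open>T = t + 1\<close> blocks
  that may be omitted, and \<open>L * a (t + 1) * b t\<close> for (A, B), with
  \<open>L = l - t\<close>. If CC has c elements, branching over a member of G that misses part of X
  gives F about c terms \<open>a (t + 1)\<close>, all other branches having one more block
  prescribed, while two elements of CC push G down to about \<open>b t\<close>. So 2 <= c < L loses
  to (A, B); for c = 1, a member of F avoiding the element of CC also pushes G down to
  \<open>b t\<close> and loses to (C, D). In the surviving cases the pair lies inside a
  construction, and maximality forces equality. The constant q is a price: each further block of a
  cover multiplies the number of its t-subsets by at most T, and each branching has at most
  \<open>Q = max k l - t + 1\<close> cases. Since one more prescribed block gains more than q^2, a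
  branching pays for itself with a factor q to spare.\<close>

lemma Stirling_Suc_eq:
  "Stirling (Suc m) i = i * Stirling m i + (if i = 0 then 0 else Stirling m (i - 1))"
  by (cases i) (cases m; simp)+

lemma Suc_times_choose_Suc: "i \<le> x \<Longrightarrow> Suc i * (x choose Suc i) = (x - i) * (x choose i)"
  by (metis binomial_absorb_comp binomial_absorption)

text \<open>Maps from an m-set to an x-set, sorted by image: choose the image, then a surjection
  onto it. The proof is algebraic: the falling factorials satisfy w (i + 1) + i * w i = x * w i,
  which matches the Stirling recurrence.\<close>

lemma power_eq_sum_Stirling:
  "x ^ m = (\<Sum>i\<le>x. (x choose i) * fact i * Stirling m i)" for x :: nat
proof (induction m)
  case 0
  have "(\<Sum>i\<le>x. (x choose i) * fact i * Stirling 0 i) = (\<Sum>i\<le>x. if i = 0 then 1 else 0)"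
    by (rule sum.cong) (auto elim: less_natE simp: gr0_conv_Suc)
  then show ?case by simp
next
  case (Suc m)
  let ?w = "\<lambda>i. (x choose i) * fact i :: nat"
  have w: "?w (Suc i) + ?w i * i = x * ?w i" if "i \<le> x" for i
  proof -
    have "?w (Suc i) = (x - i) * ?w i"
      using arg_cong[OF Suc_times_choose_Suc[OF that], of "\<lambda>z. z * fact i"] by (simp add: algebra_simps)
    then have "?w (Suc i) + ?w i * i = ((x - i) + i) * ?w i"
      by (simp only: add_mult_distrib mult.commute[of _ i])
    then show ?thesis using that by simp
  qed
  have shift: "(\<Sum>i\<le>x. if i = 0 then 0 else ?w i * Stirling m (i - 1))
      = (\<Sum>i\<le>x. ?w (Suc i) * Stirling m i)"
  proof -
    have "(\<Sum>i\<le>x. if i = 0 then 0 else ?w i * Stirling m (i - 1))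
      = (\<Sum>i\<le>Suc x. if i = 0 then 0 else ?w i * Stirling m (i - 1))" by simp
    also have "\<dots> = (\<Sum>i\<le>x. ?w (Suc i) * Stirling m i)"
      by (subst sum.atMost_Suc_shift) simp
    finally show ?thesis .
  qed
  have "(\<Sum>i\<le>x. ?w i * Stirling (Suc m) i)
     = (\<Sum>i\<le>x. ?w i * i * Stirling m i + (if i = 0 then 0 else ?w i * Stirling m (i - 1)))"
    by (rule sum.cong) (auto simp: Stirling_Suc_eq algebra_simps)
  also have "\<dots> = (\<Sum>i\<le>x. (?w (Suc i) + ?w i * i) * Stirling m i)"
    unfolding sum.distrib shift by (simp add: sum.distrib algebra_simps)
  also have "\<dots> = (\<Sum>i\<le>x. (x * ?w i) * Stirling m i)"
    by (rule sum.cong) (simp_all only: w atMost_iff)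
  also have "\<dots> = x ^ Suc m" by (simp only: Suc sum_distrib_left power_Suc mult.assoc)
  finally show ?case by simp
qed

lemma fact_Stirling_le_power: "fact j * Stirling m j \<le> j ^ m"
proof -
  have "(j choose j) * fact j * Stirling m j \<le> (\<Sum>i\<le>j. (j choose i) * fact i * Stirling m i)"
    by (rule member_le_sum) auto
  then show ?thesis by (simp add: power_eq_sum_Stirling[symmetric])
qed

text \<open>Union bound: a map into j + 1 points that is not onto avoids one of them.\<close>

lemma power_Suc_le_fact_Stirling:
  "Suc j ^ m \<le> fact (Suc j) * Stirling m (Suc j) + Suc j * j ^ m"
proof -
  have w: "(Suc j choose i) \<le> Suc j * (j choose i)" if "i \<le> j" for i
  proof -
    have "(Suc j - i) * (Suc j choose i) = Suc j * (j choose i)"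
      using binomial_absorb_comp[of "Suc j" i] by simp
    moreover have "1 * (Suc j choose i) \<le> (Suc j - i) * (Suc j choose i)"
      using that by (intro mult_right_mono) auto
    ultimately show ?thesis by simp
  qed
  have "Suc j ^ m = (\<Sum>i\<le>j. (Suc j choose i) * fact i * Stirling m i) + fact (Suc j) * Stirling m (Suc j)"
    by (subst power_eq_sum_Stirling) simp
  also have "(\<Sum>i\<le>j. (Suc j choose i) * fact i * Stirling m i)
     \<le> (\<Sum>i\<le>j. (Suc j * (j choose i)) * fact i * Stirling m i)"
    by (intro sum_mono mult_right_mono w) auto
  also have "\<dots> = Suc j * j ^ m"
    by (simp only: power_eq_sum_Stirling[of j m] sum_distrib_left mult.assoc)
  finally show ?thesis by simp
qed

text \<open>Counting surjections bounds S(m, j + 1) from below by (j + 1)^m - (j + 1) j^m and S(m,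
  j) from above by j^m, up to factorials; the quotient of the powers is the growth factor (1 +
  1/j)^m.\<close>

lemma Stirling_ratio_ge:
  assumes "j \<ge> 1"
  shows "((1 + 1 / real j) ^ m - real j) * real (Stirling m j) \<le> real (Stirling (Suc m) (Suc j))"
proof -
  let ?x = "(1 + 1 / real j) ^ m"
  have xj: "?x * real j ^ m = real (Suc j) ^ m"
    using assms by (simp add: field_simps flip: power_mult_distrib)
  \<comment> \<open>The claim follows from this by the recurrence for S(m + 1, j + 1), whose second
    summand is one more S(m, j).\<close>
  have "(?x - real (Suc j)) * real (Stirling m j) \<le> real (Suc j) * real (Stirling m (Suc j))"
  proof (cases "?x \<ge> real (Suc j)")
    case True
    have "real (Suc j ^ m) \<le> real (fact (Suc j) * Stirling m (Suc j) + Suc j * j ^ m)"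
      by (rule of_nat_mono[OF power_Suc_le_fact_Stirling])
    then have 1: "real (Suc j) ^ m \<le> fact j * (real (Suc j) * real (Stirling m (Suc j))) + real (Suc j) * real j ^ m"
      by (simp add: algebra_simps)
    have "real (fact j * Stirling m j) \<le> real (j ^ m)"
      by (rule of_nat_mono[OF fact_Stirling_le_power])
    then have 2: "fact j * real (Stirling m j) \<le> real j ^ m" by simp
    have "(?x - real (Suc j)) * (fact j * real (Stirling m j)) \<le> (?x - real (Suc j)) * real j ^ m"
      using 2 True by (intro mult_left_mono) auto
    also have "\<dots> = real (Suc j) ^ m - real (Suc j) * real j ^ m"
      using xj by (simp add: left_diff_distrib)
    also have "\<dots> \<le> fact j * (real (Suc j) * real (Stirling m (Suc j)))" using 1 by simp
    finally have "fact j * ((?x - real (Suc j)) * real (Stirling m j)) \<le> fact j * (real (Suc j) * real (Stirling m (Suc j)))"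
      by (simp only: mult.left_commute)
    then show ?thesis
      by (rule mult_left_le_imp_le) simp
  next
    case False
    then have "(?x - real (Suc j)) * real (Stirling m j) \<le> 0" 
      by (intro mult_nonpos_nonneg) auto
    also have "0 \<le> real (Suc j) * real (Stirling m (Suc j))" by simp
    finally show ?thesis .
  qed
  then show ?thesis by (simp add: algebra_simps)
qed

lemma mult_Stirling_le_Suc: "j * Stirling m j \<le> Stirling (Suc m) j"
  by (simp add: Stirling_Suc_eq)

lemma Stirling_mono:
  assumes "1 \<le> j" "m \<le> m'"
  shows "Stirling m j \<le> Stirling m' j"
  using assms(2)
proof (induction m' rule: dec_induct)
  case (step m')
  have "1 * Stirling m' j \<le> j * Stirling m' j" using assms by (intro mult_right_mono) auto
  then show ?case using step.IH mult_Stirling_le_Suc[of j m'] by linarith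
qed simp

text \<open>Each added point can join any of the j >= 2 existing blocks.\<close>

lemma two_power_Stirling_le: "2 \<le> j \<Longrightarrow> 2 ^ e * Stirling m j \<le> Stirling (m + e) j"
proof (induction e)
  case (Suc e)
  have "2 * (2 ^ e * Stirling m j) \<le> j * Stirling (m + e) j"
    using Suc by (intro mult_mono) auto
  then show ?case using mult_Stirling_le_Suc[of j "m + e"] by simp
qed simp

lemma Stirling_pos: "1 \<le> j \<Longrightarrow> j \<le> m \<Longrightarrow> 0 < Stirling m j"
  using Stirling_mono[of j j m] by simp

text \<open>The sum U m = S(m, j + 1) + S(m, j) is used because it obeys U (m + 1) = (j + 1) U m +
  S(m, j - 1), parallel to the recurrence of S(m, j); the bound on their ratio then picks up a
  factor (j + 1) / j per step.\<close>

lemma Stirling_ratio_le: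
  assumes "j \<ge> 1" "j \<le> m"
  shows "(Stirling m (Suc j) + Stirling m j) * j ^ m \<le> Suc j ^ m * Stirling m j"
  using assms(2)
proof (induction m rule: dec_induct)
  case base
  show ?case by (simp add: power_mono)
next
  case (step m)
  have "(Stirling (Suc m) (Suc j) + Stirling (Suc m) j) * j ^ Suc m
      = (Suc j * (Stirling m (Suc j) + Stirling m j) + (if j = 0 then 0 else Stirling m (j - 1))) * j ^ Suc m"
    by (subst (2) Stirling_Suc_eq) (simp add: algebra_simps)
  also have "\<dots> = Suc j * j * ((Stirling m (Suc j) + Stirling m j) * j ^ m) + (if j = 0 then 0 else Stirling m (j - 1)) * j ^ Suc m"
    by (simp only: add_mult_distrib add_mult_distrib2 power_Suc mult.assoc mult.left_commute[of j])
  also have "\<dots> \<le> Suc j * j * (Suc j ^ m * Stirling m j) + (if j = 0 then 0 else Stirling m (j - 1)) * Suc j ^ Suc m"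
    using step by (intro add_mono mult_left_mono power_mono) auto
  also have "\<dots> = Suc j ^ Suc m * Stirling (Suc m) j"
    by (subst Stirling_Suc_eq) (simp add: algebra_simps)
  finally show ?case .
qed

section \<open>Stirling numbers count the partitions of an arbitrary finite set\<close>

definition kparts :: "'a set \<Rightarrow> nat \<Rightarrow> 'a set set set" where
  "kparts V k = {P. partition_on V P \<and> card P = k}"

lemma finite_kparts: "finite V \<Longrightarrow> finite (kparts V k)"
  unfolding kparts_def by (rule finite_subset[of _ "{P. partition_on V P}"]) (auto simp: finitely_many_partition_on)

lemma kparts_insert_singleton:
  assumes "x \<notin> V" "finite V"
  shows "{P \<in> kparts (insert x V) (Suc k). {x} \<in> P} = insert {x} ` kparts V k"
proof (intro equalityI subsetI)
  fix P assume "P \<in> {P \<in> kparts (insert x V) (Suc k). {x} \<in> P}"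
  then have P: "partition_on (insert x V) P" "card P = Suc k" "{x} \<in> P" by (auto simp: kparts_def)
  have "insert {x} (P - {{x}}) = P" using P by auto
  moreover have "disjnt {x} (\<Union> (P - {{x}}))"
  proof -
    have "x \<notin> C" if "C \<in> P - {{x}}" for C
      using that P(3) disjointD[OF partition_onD2[OF P(1)], of C "{x}"] by auto
    then show ?thesis by (simp add: disjnt_def)
  qed
  ultimately have "partition_on (insert x V - {x}) (P - {{x}})"
    using P partition_on_insert[of "{x}" "P - {{x}}" "insert x V"] by simp
  moreover have "insert x V - {x} = V" using assms by auto
  moreover have "card (P - {{x}}) = k" using P by simp
  ultimately have "P - {{x}} \<in> kparts V k" by (simp add: kparts_def)
  then show "P \<in> insert {x} ` kparts V k" using \<open>insert {x} (P - {{x}}) = P\<close> by (metis imageI)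
next
  fix P assume "P \<in> insert {x} ` kparts V k"
  then obtain P' where P': "partition_on V P'" "card P' = k" "P = insert {x} P'"
    by (auto simp: kparts_def)
  have d: "disjnt {x} (\<Union> P')" using P' assms by (auto simp: partition_on_def)
  have "insert x V - {x} = V" using assms by auto
  then have "partition_on (insert x V) P"
    using P' partition_on_insert[OF d, of "insert x V"] by auto
  moreover have "finite P'" using P' assms finite_elements by blast
  moreover have "{x} \<notin> P'" using d by auto
  ultimately show "P \<in> {P \<in> kparts (insert x V) (Suc k). {x} \<in> P}"
    using P' by (auto simp: kparts_def)
qed

text \<open>Deleting x from its block leaves a partition of V with one marked block, from which x
  can be restored. This yields the summand k * S(m, k) of the Stirling recurrence.\<close>

lemma kparts_insert_no_singleton:
  assumes "x \<notin> V" "finite V"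
  shows "bij_betw (\<lambda>(P, B). insert (insert x B) (P - {B})) (SIGMA P:kparts V k. P)
     {P \<in> kparts (insert x V) k. {x} \<notin> P}"
proof (rule bij_betw_byWitness[where f' = "\<lambda>P. ((\<lambda>B. B - {x}) ` P, (THE B. B \<in> P \<and> x \<in> B) - {x})"])
  have fin: "finite P" if "P \<in> kparts W j" "finite W" for P j and W :: "'a set"
    using that finite_elements by (auto simp: kparts_def)
  let ?f = "\<lambda>(P, B). insert (insert x B) (P - {B})"
  let ?g = "\<lambda>P. ((\<lambda>B. B - {x}) ` P, (THE B. B \<in> P \<and> x \<in> B) - {x})"
  show "\<forall>a\<in>(SIGMA P:kparts V k. P). ?g (?f a) = a"
  proof
    fix z assume "z \<in> (SIGMA P:kparts V k. P)"
    then obtain P B where z: "z = (P, B)" and P: "P \<in> kparts V k" "B \<in> P" by blast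
    have x: "x \<notin> C" if "C \<in> P" for C using P that assms by (auto simp: kparts_def partition_on_def)
    then have "(\<lambda>B. B - {x}) ` (insert (insert x B) (P - {B})) = insert B (P - {B})"
      using P by (auto simp: image_iff) 
    moreover have "(THE C. C \<in> insert (insert x B) (P - {B}) \<and> x \<in> C) = insert x B"
      by (rule the_equality) (use x in auto)
    ultimately show "?g (?f z) = z" using P x z by (simp add: insert_absorb)
  qed
  \<comment> \<open>\<open>root P B\<close> gathers all facts about the block B containing x; they
    serve both inverse directions and the image inclusion.\<close>
  define root where "root P B \<longleftrightarrow> B \<in> P \<and> x \<in> B \<and> (THE B. B \<in> P \<and> x \<in> B) = B \<and> B - {x} \<noteq> {} \<and>
      (\<forall>C\<in>P. C \<noteq> B \<longrightarrow> C - {x} = C \<and> C \<inter> B = {}) \<and>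
      (\<lambda>B. B - {x}) ` P = insert (B - {x}) (P - {B}) \<and> B - {x} \<notin> P" for P B
  have ex_root: "\<exists>B. root P B"
    if P: "P \<in> {P \<in> kparts (insert x V) k. {x} \<notin> P}" for P
  proof -
    from P have po: "partition_on (insert x V) P" and nx: "{x} \<notin> P" by (auto simp: kparts_def)
    then obtain B where B: "B \<in> P" "x \<in> B" by (auto simp: partition_on_def)
    have dj: "C \<inter> D = {}" if "C \<in> P" "D \<in> P" "C \<noteq> D" for C D
      using po that by (auto simp: partition_on_def disjoint_def)
    have the: "(THE B. B \<in> P \<and> x \<in> B) = B" by (rule the_equality) (use B dj in auto)
    have ne: "B - {x} \<noteq> {}" using nx B by (metis insert_Diff)
    have oth: "C - {x} = C \<and> C \<inter> B = {}" if "C \<in> P" "C \<noteq> B" for C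
      using dj[OF that(1) B(1) that(2)] B by auto
    have "(\<lambda>B. B - {x}) ` P = insert (B - {x}) (P - {B})"
      using B oth by (auto simp: image_iff) (metis DiffI Diff_insert_absorb insert_iff singletonD)+
    moreover have "B - {x} \<notin> P" using oth[of "B - {x}"] ne B by auto
    ultimately show ?thesis using B the ne oth by (intro exI[of _ B]) (simp add: root_def)
  qed
  show "\<forall>P\<in>{P \<in> kparts (insert x V) k. {x} \<notin> P}. ?f (?g P) = P"
  proof
    fix P assume P: "P \<in> {P \<in> kparts (insert x V) k. {x} \<notin> P}"
    from ex_root[OF P] obtain B where "root P B" ..
    then have B: "B \<in> P" "x \<in> B" "(THE B. B \<in> P \<and> x \<in> B) = B"
      "(\<lambda>B. B - {x}) ` P = insert (B - {x}) (P - {B})" "B - {x} \<notin> P" by (simp_all add: root_def)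
    have "insert x (B - {x}) = B" using B by auto
    then show "?f (?g P) = P" using B by (simp add: insert_absorb)
  qed
  show "?f ` (SIGMA P:kparts V k. P) \<subseteq> {P \<in> kparts (insert x V) k. {x} \<notin> P}"
  proof (rule image_subsetI)
    fix z assume "z \<in> (SIGMA P:kparts V k. P)"
    then obtain P B where z: "z = (P, B)" and P: "P \<in> kparts V k" "B \<in> P" by blast
    then have po: "partition_on V P" and c: "card P = k" and f: "finite P"
      using fin[OF P(1) assms(2)] by (auto simp: kparts_def)
    have x: "x \<notin> C" if "C \<in> P" for C using po that assms by (auto simp: partition_on_def)
    have ne: "B \<noteq> {}" using po P by (auto simp: partition_on_def)
    have dj: "C \<inter> D = {}" if "C \<in> P" "D \<in> P" "C \<noteq> D" for C D
      using po that by (auto simp: partition_on_def disjoint_def)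
    have "partition_on (insert x V) (insert (insert x B) (P - {B}))"
    proof (rule partition_onI)
      show "\<Union> (insert (insert x B) (P - {B})) = insert x V"
        using po P by (auto simp: partition_on_def)
      show "{} \<notin> insert (insert x B) (P - {B})" using po by (auto simp: partition_on_def)
    next
      fix p q assume "p \<in> insert (insert x B) (P - {B})" "q \<in> insert (insert x B) (P - {B})" "p \<noteq> q"
      then show "disjnt p q" using dj x P unfolding disjnt_def by (elim insertE) auto
    qed
    moreover have "card (insert (insert x B) (P - {B})) = k"
      using f c P x by (metis card.insert_remove card_Suc_Diff1 Diff_iff Diff_insert_absorb finite_Diff insertI1 card_insert_disjoint)
    moreover have "{x} \<notin> insert (insert x B) (P - {B})" using x[OF P(2)] ne x by (metis Diff_iff all_not_in_conv insertCI insertE singletonD)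
    ultimately show "?f z \<in> {P \<in> kparts (insert x V) k. {x} \<notin> P}"
      by (simp add: kparts_def z)
  qed
  show "?g ` {P \<in> kparts (insert x V) k. {x} \<notin> P} \<subseteq> (SIGMA P:kparts V k. P)"
  proof (rule image_subsetI)
    fix P assume P: "P \<in> {P \<in> kparts (insert x V) k. {x} \<notin> P}"
    from ex_root[OF P] obtain B where "root P B" ..
    then have B: "B \<in> P" "x \<in> B" "(THE B. B \<in> P \<and> x \<in> B) = B" "B - {x} \<noteq> {}"
      "\<forall>C\<in>P. C \<noteq> B \<longrightarrow> C - {x} = C \<and> C \<inter> B = {}"
      "(\<lambda>B. B - {x}) ` P = insert (B - {x}) (P - {B})" "B - {x} \<notin> P" by (simp_all add: root_def)
    have po: "partition_on (insert x V) P" and c: "card P = k" using P by (auto simp: kparts_def)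
    have f: "finite P" using P assms by (intro fin[of P "insert x V" k]) auto
    have dj: "C \<inter> D = {}" if "C \<in> P" "D \<in> P" "C \<noteq> D" for C D
      using po that by (auto simp: partition_on_def disjoint_def)
    have "partition_on V (insert (B - {x}) (P - {B}))"
    proof (rule partition_onI)
      have "\<Union> (insert (B - {x}) (P - {B})) = \<Union> P - {x}" unfolding B(6)[symmetric] by auto
      then show "\<Union> (insert (B - {x}) (P - {B})) = V"
        using po assms by (auto simp: partition_on_def)
      show "{} \<notin> insert (B - {x}) (P - {B})" using po B by (auto simp: partition_on_def)
    next
      fix p q assume "p \<in> insert (B - {x}) (P - {B})" "q \<in> insert (B - {x}) (P - {B})" "p \<noteq> q"
      then show "disjnt p q" using dj \<open>B \<in> P\<close> unfolding disjnt_def by (elim insertE) auto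
    qed
    moreover have "card (insert (B - {x}) (P - {B})) = k"
      using f c B(1,7) by (metis card_Suc_Diff1 Diff_iff finite_Diff card_insert_disjoint)
    ultimately show "?g P \<in> (SIGMA P:kparts V k. P)"
      using B by (auto simp: kparts_def)
  qed
qed

lemma card_kparts: "finite V \<Longrightarrow> card (kparts V k) = Stirling (card V) k"
proof (induction V arbitrary: k rule: finite_induct)
  case empty
  have "kparts ({} :: 'a set) k = (if k = 0 then {{}} else {})" by (auto simp: kparts_def partition_on_empty)
  then show ?case by (cases k) simp_all
next
  case (insert x V)
  show ?case
  proof (cases k)
    case 0
    have "kparts (insert x V) 0 = {}"
    proof -
      have "P = {} \<and> \<Union> P = insert x V" if "P \<in> kparts (insert x V) 0" for P
        using that finite_elements[of "insert x V" P] insert.hyps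
        by (auto simp: kparts_def partition_on_def)
      then show ?thesis by force
    qed
    then show ?thesis using 0 insert by simp
  next
    case (Suc j)
    let ?K = "kparts (insert x V) k"
    have "?K = {P \<in> ?K. {x} \<in> P} \<union> {P \<in> ?K. {x} \<notin> P}" by auto
    then have "card ?K = card ({P \<in> ?K. {x} \<in> P} \<union> {P \<in> ?K. {x} \<notin> P})" by simp
    also have "\<dots> = card {P \<in> ?K. {x} \<in> P} + card {P \<in> ?K. {x} \<notin> P}"
      using insert by (intro card_Un_disjoint) (auto simp: finite_kparts)
    also have "card {P \<in> ?K. {x} \<in> P} = card (kparts V j)"
    proof -
      have "{x} \<notin> P" if "P \<in> kparts V j" for P
        using that insert by (auto simp: kparts_def partition_on_def)
      then have "inj_on (insert {x}) (kparts V j)"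
        by (intro inj_onI) (metis insert_ident)
      then show ?thesis
        using kparts_insert_singleton[of x V j] insert Suc by (simp add: card_image)
    qed
    also have "card {P \<in> ?K. {x} \<notin> P} = card (SIGMA P:kparts V k. P)"
      using bij_betw_same_card[OF kparts_insert_no_singleton[of x V k]] insert by simp
    also have "\<dots> = (\<Sum>P\<in>kparts V k. card P)"
      using insert finite_elements by (intro card_SigmaI) (auto simp: finite_kparts, auto simp: kparts_def)
    also have "\<dots> = (\<Sum>P\<in>kparts V k. k)" by (rule sum.cong) (auto simp: kparts_def)
    finally show ?thesis using insert Suc by simp
  qed
qed


section \<open>Partitions with prescribed blocks\<close>

lemma Parts_eq_kparts: "Parts n k = kparts {1..n} k"
  by (simp add: Parts_def kparts_def)

lemma finite_Parts [simp]: "finite (Parts n k)"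
  by (simp add: Parts_eq_kparts finite_kparts)

lemma finite_famC [simp]: "finite (famC n k X)"
  by (simp add: famC_def)

lemma PartsD:
  assumes "P \<in> Parts n k"
  shows "partition_on {1..n} P" "card P = k" "finite P" "\<Union> P = {1..n}" "{} \<notin> P"
    "\<And>B C. B \<in> P \<Longrightarrow> C \<in> P \<Longrightarrow> B \<noteq> C \<Longrightarrow> B \<inter> C = {}" "\<And>B. B \<in> P \<Longrightarrow> finite B"
proof -
  show po: "partition_on {1..n} P" and "card P = k" using assms by (auto simp: Parts_def)
  show "finite P" using po by (meson finite_atLeastAtMost finite_elements)
  show U: "\<Union> P = {1..n}" and "{} \<notin> P" using po by (auto simp: partition_on_def)
  show "B \<inter> C = {}" if "B \<in> P" "C \<in> P" "B \<noteq> C" for B C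
    using disjointD[OF partition_onD2[OF po]] that by blast
  show "finite B" if "B \<in> P" for B
    using that U by (metis Union_upper finite_atLeastAtMost finite_subset)
qed

lemma card_Union_Parts:
  assumes "P \<in> Parts n k" "X \<subseteq> P"
  shows "card (\<Union> X) = (\<Sum>B\<in>X. card B)"
proof (rule card_Union_disjoint)
  show "disjoint X" using PartsD(6)[OF assms(1)] assms(2) by (auto simp: disjoint_def)
  show "finite B" if "B \<in> X" for B using PartsD(7)[OF assms(1)] assms(2) that by auto
qed

lemma card_block_ge_1:
  assumes "P \<in> Parts n k" "B \<in> P"
  shows "1 \<le> card B"
  using PartsD(5,7)[OF assms(1)] assms(2) by (metis One_nat_def Suc_leI card_gt_0_iff)

lemma card_le_card_Union_Parts:
  assumes "P \<in> Parts n k" "X \<subseteq> P"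
  shows "card X \<le> card (\<Union> X)"
  unfolding card_Union_Parts[OF assms]
  using sum_mono[of X "\<lambda>_. 1" card] card_block_ge_1[OF assms(1)] assms(2) by auto

lemma card_less_card_Union_Parts:
  assumes "P \<in> Parts n k" "X \<subseteq> P" "B \<in> X" "card B \<noteq> 1"
  shows "card X < card (\<Union> X)"
proof -
  have "finite X" using assms PartsD(3) finite_subset by blast
  moreover have "1 < card B" using card_block_ge_1[OF assms(1)] assms by force
  ultimately have "(\<Sum>B\<in>X. 1) < (\<Sum>B\<in>X. card B)"
    using card_block_ge_1[OF assms(1)] assms by (intro sum_strict_mono_ex1) auto
  then show ?thesis unfolding card_Union_Parts[OF assms(1,2)] by simp
qed

text \<open>Deleting X from a member leaves an arbitrary partition of the uncovered points.\<close>

lemma card_famC: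
  assumes X: "partition_on (\<Union> X) X" "\<Union> X \<subseteq> {1..n}" "card X \<le> k"
  shows "card (famC n k X) = Stirling (n - card (\<Union> X)) (k - card X)"
proof -
  have finU: "finite (\<Union> X)" using X(2) finite_subset by blast
  then have finX: "finite X" by (simp add: finite_UnionD)
  let ?V = "{1..n} - \<Union> X"
  have "bij_betw (\<lambda>P. P - X) (famC n k X) (kparts ?V (k - card X))"
  proof (rule bij_betw_byWitness[where f' = "\<lambda>P. P \<union> X"])
    have disj: "P \<inter> X = {}" if "P \<in> kparts ?V (k - card X)" for P
    proof -
      have "\<Union> P \<inter> \<Union> X = {}" "{} \<notin> P" using that by (auto simp: kparts_def partition_on_def)
      moreover have "B \<subseteq> \<Union> P \<inter> \<Union> X" if "B \<in> P \<inter> X" for B using that by blast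
      ultimately show ?thesis by (metis all_not_in_conv Int_iff subset_empty)
    qed
    show "\<forall>P\<in>famC n k X. P - X \<union> X = P" by (auto simp: famC_def)
    show "\<forall>P\<in>kparts ?V (k - card X). P \<union> X - X = P" using disj by blast
    show "(\<lambda>P. P - X) ` famC n k X \<subseteq> kparts ?V (k - card X)"
    proof (rule image_subsetI)
      fix P assume "P \<in> famC n k X"
      then have P: "P \<in> Parts n k" "X \<subseteq> P" by (auto simp: famC_def)
      have "partition_on ?V (P - X)"
      proof (rule partition_onI)
        have "\<Union> (P - X) \<inter> \<Union> X = {}" using PartsD(6)[OF P(1)] P(2) by blast
        moreover have "\<Union> P = \<Union> (P - X) \<union> \<Union> X" using P(2) by blast
        ultimately show "\<Union> (P - X) = ?V" using PartsD(4)[OF P(1)] by auto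
        show "{} \<notin> P - X" using PartsD(5)[OF P(1)] by auto
        show "disjnt p q" if "p \<in> P - X" "q \<in> P - X" "p \<noteq> q" for p q
          using PartsD(6)[OF P(1)] that by (auto simp: disjnt_def)
      qed
      moreover have "card (P - X) = k - card X"
        using P PartsD(2)[OF P(1)] finX by (simp add: card_Diff_subset)
      ultimately show "P - X \<in> kparts ?V (k - card X)" by (simp add: kparts_def)
    qed
    show "(\<lambda>P. P \<union> X) ` kparts ?V (k - card X) \<subseteq> famC n k X"
    proof (rule image_subsetI)
      fix P assume P: "P \<in> kparts ?V (k - card X)"
      then have po: "partition_on ?V P" and c: "card P = k - card X" by (auto simp: kparts_def)
      have fP: "finite P" using po finite_elements by (metis finite_Diff finite_atLeastAtMost)
      have d: "p \<inter> q = {}" if "p \<in> P" "q \<in> X" for p q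
        using po that by (auto simp: partition_on_def)
      have "partition_on {1..n} (P \<union> X)"
      proof (rule partition_onI)
        show "\<Union> (P \<union> X) = {1..n}" using po X(2) by (auto simp: partition_on_def)
        show "{} \<notin> P \<union> X" using po X(1) by (auto simp: partition_on_def)
        show "disjnt p q" if "p \<in> P \<union> X" "q \<in> P \<union> X" "p \<noteq> q" for p q
          using that d[of p q] d[of q p] disjointD[OF partition_onD2[OF po], of p q]
            disjointD[OF partition_onD2[OF X(1)], of p q] by (auto simp: disjnt_def)
      qed
      moreover have "card (P \<union> X) = k"
        using fP finX disj[OF P] c X(3) by (subst card_Un_disjoint) auto
      ultimately show "P \<union> X \<in> famC n k X" by (simp add: famC_def Parts_def)
    qed
  qed
  then have "card (famC n k X) = card (kparts ?V (k - card X))" by (rule bij_betw_same_card)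
  also have "\<dots> = Stirling (card ?V) (k - card X)" by (rule card_kparts) simp
  also have "card ?V = n - card (\<Union> X)" using X(2) finU by (simp add: card_Diff_subset)
  finally show ?thesis .
qed

text \<open>X may be any set of sets. If no partition contains it, the family is empty; hence the
  size of its union has to be estimated only when a member witnesses that X consists of disjoint
  blocks.\<close>

lemma card_famC_le_general:
  assumes "card X < k" and m: "\<And>P. P \<in> famC n k X \<Longrightarrow> m \<le> card (\<Union> X)"
  shows "card (famC n k X) \<le> Stirling (n - m) (k - card X)"
proof (cases "famC n k X = {}")
  case False
  then obtain P where P: "P \<in> famC n k X" by blast
  then have "P \<in> Parts n k" "X \<subseteq> P" by (auto simp: famC_def)
  then have PX: "P \<in> Parts n k" "X \<subseteq> P" by simp_all
  have "partition_on (\<Union> X) X"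
  proof (rule partition_onI)
    show "{} \<notin> X" using PartsD(5)[OF PX(1)] PX(2) by auto
    show "disjnt p r" if "p \<in> X" "r \<in> X" "p \<noteq> r" for p r
      using PartsD(6)[OF PX(1), of p r] PX(2) that by (auto simp: disjnt_def)
  qed simp
  moreover have "\<Union> X \<subseteq> {1..n}" using PartsD(4)[OF PX(1)] PX(2) by blast
  ultimately have "card (famC n k X) = Stirling (n - card (\<Union> X)) (k - card X)"
    using assms(1) by (intro card_famC) auto
  also have "\<dots> \<le> Stirling (n - m) (k - card X)"
    using assms(1) m[OF P] by (intro Stirling_mono) auto
  finally show ?thesis .
qed simp

lemma card_famC_le:
  assumes "card X = s" "s < k"
  shows "card (famC n k X) \<le> Stirling (n - s) (k - s)"
proof -
  have "card (famC n k X) \<le> Stirling (n - s) (k - card X)"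
    using assms by (intro card_famC_le_general) (auto simp: famC_def intro: card_le_card_Union_Parts)
  then show ?thesis using assms by simp
qed

text \<open>A block with several points uses up at least one additional point.\<close>

lemma card_famC_nonsingle_le:
  assumes "card X = s" "s < k" "B \<in> X" "card B \<noteq> 1"
  shows "card (famC n k X) \<le> Stirling (n - s - 1) (k - s)"
proof -
  have "card (famC n k X) \<le> Stirling (n - Suc s) (k - card X)"
    using assms by (intro card_famC_le_general) (auto simp: famC_def Suc_le_eq intro: card_less_card_Union_Parts)
  then show ?thesis using assms by simp
qed

abbreviation sing :: "nat set \<Rightarrow> part" where
  "sing I \<equiv> (\<lambda>i. {i}) ` I"

lemma card_sing [simp]: "card (sing I) = card I"
  by (simp add: card_image)

lemma card_famC_sing:
  assumes "I \<subseteq> {1..n}" "card I \<le> k"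
  shows "card (famC n k (sing I)) = Stirling (n - card I) (k - card I)"
proof -
  have "\<Union> (sing I) = I" by auto
  then show ?thesis
    using card_famC[of "sing I" n k] partition_on_singletons[of I] assms by simp
qed

lemma all_card_1_eq_sing:
  assumes "\<And>B. B \<in> X \<Longrightarrow> card B = 1"
  shows "X = sing (\<Union> X)"
proof (intro equalityI subsetI)
  fix B assume B: "B \<in> X"
  then obtain x where "B = {x}" using assms card_1_singletonE by blast
  then show "B \<in> sing (\<Union> X)" using B by blast
next
  fix B assume "B \<in> sing (\<Union> X)"
  then obtain x C where "B = {x}" "x \<in> C" "C \<in> X" by blast
  moreover then obtain y where "C = {y}" using assms card_1_singletonE by blast
  ultimately show "B \<in> X" by auto
qed

section \<open>Growth of Stirling numbers under the hypothesis on n\<close>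

lemma two_powr_le_one_plus_inverse_power:
  assumes "j \<ge> 1"
  shows "2 powr (real m / real j) \<le> (1 + 1 / real j) ^ m"
proof -
  have "1 + real j * (1 / real j) \<le> (1 + 1 / real j) ^ j"
    by (rule Bernoulli_inequality) (use assms in \<open>auto simp: order.trans[of "-1" 0]\<close>)
  then have "2 \<le> (1 + 1 / real j) ^ j" using assms by simp
  then have "2 powr (real m / real j) \<le> ((1 + 1 / real j) ^ j) powr (real m / real j)"
    by (intro powr_mono2) auto
  also have "\<dots> = ((1 + 1 / real j) powr real j) powr (real m / real j)"
    using assms by (subst powr_realpow) (auto simp: add_pos_nonneg)
  also have "\<dots> = (1 + 1 / real j) powr (real m)" using assms by (simp add: powr_powr)
  also have "\<dots> = (1 + 1 / real j) ^ m" by (simp add: powr_realpow add_pos_nonneg)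
  finally show ?thesis .
qed

locale large_n =
  fixes n kk t :: nat
  assumes t1: "1 \<le> t" and kk: "t + 2 \<le> kk" and n_large: "2 * Lfun kk t \<le> real n"
begin

definition "T = t + 1"
definition "Q = kk - t + 1"
definition "q = T * Q"

lemma T_ge: "2 \<le> T" and Q_ge: "3 \<le> Q" using t1 kk by (auto simp: T_def Q_def)

lemma q_ge: "6 \<le> q"
  unfolding q_def using mult_le_mono[OF T_ge Q_ge] by simp

abbreviation "lq \<equiv> log 2 (real q)"

lemma n_ge: "2 * real T + 2 * real Q * lq \<le> real n"
  using n_large kk by (simp add: Lfun_def T_def Q_def q_def algebra_simps)

lemma lq_ge: "2 \<le> lq"
proof -
  have "log 2 (2 ^ 2) \<le> lq" using q_ge by (subst log_le_cancel_iff) auto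
  then show ?thesis by (subst (asm) log_nat_power) auto
qed

lemma n_ge_nat: "2 * T + 4 * Q \<le> n"
proof -
  have "real (2 * T + 4 * Q) \<le> 2 * real T + 2 * real Q * lq"
    using mult_left_mono[OF lq_ge, of "2 * real Q"] by simp
  also note n_ge
  finally show ?thesis by (simp only: of_nat_le_iff)
qed

lemma n_gt: "kk + T + 2 < n" using n_ge_nat t1 kk by (simp add: T_def Q_def)

lemma q_powr: "2 powr (x * lq) = real q powr x"
  using q_ge by (simp add: powr_def log_def)

text \<open>By (1 + 1/j)^m >= 2^(m/j) it suffices to bound m/j. Its worst case is about 2 * Q * lq /
  (Q - 2) = (2 + 4 / (Q - 2)) * lq, which gives q^2 times a surplus q^(4 / (Q - 2)); the surplus
  pays for the additive 1 + j.\<close>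

lemma ratio_real:
  assumes "t \<le> s" "s + 2 \<le> k" "k \<le> kk"
  shows "real (q\<^sup>2 + 1) + real (k - s - 1) \<le> (1 + 1 / real (k - s - 1)) ^ (n - s - 1)"
proof -
  define j m where "j = k - s - 1" and "m = n - s - 1"
  define i where "i = real s - real t"
  have j1: "1 \<le> j" using assms by (simp add: j_def)
  have i0: "0 \<le> i" using assms by (simp add: i_def)
  have ji: "real j \<le> real Q - 2 - i" using assms by (auto simp: j_def Q_def i_def)
  then have Q2: "0 < real Q - 2" using j1 i0 by simp
  have m: "real m = real n - real T - i" using assms n_gt by (auto simp: m_def i_def T_def)
  then have m': "real T + 2 * real Q * lq - i \<le> real m" using n_ge by simp
  \<comment> \<open>Raising s by i lowers both m and j by i. This inequality ensures that the
    quotient does not get smaller.\<close>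
  have QL: "1 * (real Q - 2) \<le> 2 * real Q * lq"
    using lq_ge Q_ge mult_mono[of 1 lq "real Q - 2" "2 * real Q"] by (simp add: mult_ac)
  have "(2 * real Q * lq) * real j \<le> (2 * real Q * lq) * (real Q - 2 - i)"
    using ji lq_ge by (intro mult_left_mono) auto
  also have "\<dots> = (2 * real Q * lq) * (real Q - 2) - (2 * real Q * lq) * i" by (simp add: algebra_simps)
  also have "\<dots> \<le> (2 * real Q * lq) * (real Q - 2) - (1 * (real Q - 2)) * i"
    using mult_right_mono[OF QL i0] by simp
  also have "\<dots> \<le> (real T + 2 * real Q * lq - i) * (real Q - 2)"
    using mult_nonneg_nonneg[of "real T" "real Q - 2"] Q2 by (simp add: algebra_simps)
  also have "\<dots> \<le> real m * (real Q - 2)" using m' Q2 by (intro mult_right_mono) auto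
  finally have "(2 + 4 / (real Q - 2)) * lq \<le> real m / real j"
    using j1 Q2 by (simp add: field_simps)
  then have "2 powr ((2 + 4 / (real Q - 2)) * lq) \<le> 2 powr (real m / real j)"
    by (intro powr_mono) auto
  also note two_powr_le_one_plus_inverse_power[OF j1, of m]
  finally have A: "real q powr (2 + 4 / (real Q - 2)) \<le> (1 + 1 / real j) ^ m"
    by (simp only: q_powr)
  have "1 \<le> ln (real q)"
  proof -
    have "exp 1 \<le> real q" using q_ge exp_le by linarith
    then show ?thesis using q_ge by (simp add: ln_ge_iff)
  qed
  then have "4 / (real Q - 2) * 1 \<le> 4 / (real Q - 2) * ln (real q)"
    using Q2 by (intro mult_left_mono) auto
  then have "1 + 4 / (real Q - 2) \<le> 1 + 4 / (real Q - 2) * ln (real q)" by simp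
  also have "\<dots> \<le> exp (4 / (real Q - 2) * ln (real q))" by (rule exp_ge_add_one_self)
  also have "\<dots> = real q powr (4 / (real Q - 2))" using q_ge by (simp add: powr_def)
  finally have B: "1 + 4 / (real Q - 2) \<le> real q powr (4 / (real Q - 2))" .
  have "real Q * (real Q - 2) \<le> 4 * (real q)\<^sup>2"
  proof -
    have "real Q \<le> real q" using T_ge by (simp add: q_def flip: of_nat_mult)
    then have "real Q * (real Q - 2) \<le> real q * real q" using Q2 by (intro mult_mono) auto
    then show ?thesis using zero_le_square[of "real q"] unfolding power2_eq_square by linarith
  qed
  then have "real Q \<le> (real q)\<^sup>2 * (4 / (real Q - 2))" using Q2 by (simp add: field_simps)
  then have "(real q)\<^sup>2 + 1 + real j \<le> (real q)\<^sup>2 * (1 + 4 / (real Q - 2))"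
    using ji i0 by (simp add: algebra_simps)
  also have "\<dots> \<le> (real q)\<^sup>2 * real q powr (4 / (real Q - 2))"
    using B by (intro mult_left_mono) auto
  also have "\<dots> = real q powr (2 + 4 / (real Q - 2))"
    using q_ge by (simp add: powr_add)
  also note A
  finally show ?thesis by (simp add: j_def m_def)
qed

lemma Stirling_ratio:
  assumes "t \<le> s" "s < k" "k \<le> kk"
  shows "(q\<^sup>2 + 1) * Stirling (n - (s + 1)) (k - (s + 1)) \<le> Stirling (n - s) (k - s)"
proof (cases "s + 1 = k")
  case True
  \<comment> \<open>All blocks are prescribed while points are left over, so the left side is a
    multiple of S(positive, 0) = 0.\<close>
  have "0 < n - (s + 1)" using n_gt assms by simp
  then have "Stirling (n - (s + 1)) 0 = 0" by (cases "n - (s + 1)") auto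
  then show ?thesis using True by simp
next
  case False
  define j m where "j = k - s - 1" and "m = n - s - 1"
  have e: "n - s = Suc m" "k - s = Suc j" "j \<ge> 1" using False assms n_gt by (auto simp: j_def m_def)
  have "real (q\<^sup>2 + 1) \<le> (1 + 1 / real j) ^ m - real j"
    using ratio_real[of s k] False assms by (simp add: j_def m_def)
  then have "real (q\<^sup>2 + 1) * real (Stirling m j) \<le> ((1 + 1 / real j) ^ m - real j) * real (Stirling m j)"
    by (intro mult_right_mono) auto
  also have "\<dots> \<le> real (Stirling (Suc m) (Suc j))" by (rule Stirling_ratio_ge[OF e(3)])
  finally have "(q\<^sup>2 + 1) * Stirling m j \<le> Stirling (Suc m) (Suc j)"
    by (simp only: of_nat_le_iff flip: of_nat_mult)
  then show ?thesis unfolding e(1,2) by (simp add: j_def m_def)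
qed

text \<open>The 6 comes from \<open>2 * Q * lq\<close> with \<open>Q >= 3\<close>. It is also what
  is needed later, where one third of the exponent n - t - 2 must reach q^2.\<close>

lemma q_power_6_le: "q ^ 6 \<le> 2 ^ (n - t - 2)"
proof -
  have r: "real (n - t - 2) = real n - real t - 2" using n_gt by (simp add: T_def)
  have "6 * lq \<le> 2 * real Q * lq" using Q_ge lq_ge by (intro mult_right_mono) auto
  then have "6 * lq \<le> real (n - t - 2)" unfolding r using n_ge t1 by (simp add: T_def)
  then have "2 powr (6 * lq) \<le> 2 powr real (n - t - 2)" by (intro powr_mono) auto
  then have "real q powr 6 \<le> 2 ^ (n - t - 2)" by (simp only: q_powr) (simp add: powr_realpow)
  then have "real (q ^ 6) \<le> real (2 ^ (n - t - 2))" using q_ge by simp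
  then show ?thesis by (simp only: of_nat_le_iff)
qed

text \<open>For \<open>Q >= 4\<close> the exponent is at least \<open>8 * lq\<close>, and (4/3)^8 >=
  4 = 2^2. The purpose is to separate a growth factor (1 + 1/j)^m <= (3/2)^m, where j >= 2, from 2^m
  by q^2.\<close>

lemma q2_three_halves_le:
  assumes "4 \<le> Q"
  shows "q\<^sup>2 * 3 ^ (n - t - 1) \<le> 4 ^ (n - t - 1)"
proof -
  let ?M = "n - t - 1"
  have r: "real ?M = real n - real T" using n_gt by (simp add: T_def)
  have 8: "8 * lq \<le> 2 * real Q * lq" using assms lq_ge by (intro mult_right_mono) auto
  have "(4::real) \<le> (4 / 3) ^ 8" by (simp add: power_divide)
  then have "4 powr lq \<le> ((4 / 3) ^ 8) powr lq" using lq_ge by (intro powr_mono2) auto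
  also have "\<dots> = (4 / 3) powr (8 * lq)" by (simp add: powr_powr flip: powr_numeral)
  also have "\<dots> \<le> (4 / 3) powr (real ?M)" using 8 n_ge unfolding r by (intro powr_mono) auto
  also have "\<dots> = (4 / 3) ^ ?M" by (simp add: powr_realpow)
  finally have "4 powr lq \<le> (4 / 3) ^ ?M" .
  moreover have "4 powr lq = (real q)\<^sup>2"
  proof -
    have "4 powr lq = (2 powr 2) powr lq" by simp
    also have "\<dots> = 2 powr (2 * lq)" by (simp only: powr_powr)
    also have "\<dots> = (real q)\<^sup>2" using q_ge by (simp only: q_powr) simp
    finally show ?thesis .
  qed
  ultimately have "real (q\<^sup>2 * 3 ^ ?M) \<le> real (4 ^ ?M)" by (simp add: power_divide field_simps)
  then show ?thesis by (simp only: of_nat_le_iff)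
qed

end


section \<open>Lower bounds from the extremal constructions\<close>

text \<open>Passing from x to x + 1 multiplies the binomial by (t + x + 1) / (x + 1) <= t +
  1.\<close>

lemma choose_le_power: "(t + x choose t) \<le> (t + 1) ^ x"
proof (induction x)
  case (Suc x)
  have "Suc x * (t + Suc x choose t) = (t + Suc x) * (t + x choose t)"
    using binomial_absorb_comp[of "t + Suc x" t] by simp
  also have "\<dots> \<le> (Suc x * (t + 1)) * (t + 1) ^ x"
    using Suc by (intro mult_mono) auto
  finally have "Suc x * (t + Suc x choose t) \<le> Suc x * (t + 1) ^ Suc x" by (simp only: power_Suc mult.assoc)
  then show ?case by (metis Suc_mult_le_cancel1)
qed simp

text \<open>Second-order inclusion-exclusion, with the number of pairs generously replaced by the
  square of \<open>card W\<close>.\<close>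

lemma bonferroni:
  assumes "finite W" "\<And>i. i \<in> W \<Longrightarrow> finite (S i)" "\<And>i. i \<in> W \<Longrightarrow> \<alpha> \<le> card (S i)"
    "\<And>i j. i \<in> W \<Longrightarrow> j \<in> W \<Longrightarrow> i \<noteq> j \<Longrightarrow> card (S i \<inter> S j) \<le> \<beta>"
  shows "card W * \<alpha> \<le> card (\<Union>i\<in>W. S i) + card W * card W * (\<beta>::nat)"
  using assms
proof (induction W rule: finite_induct)
  case (insert x W)
  let ?U = "\<Union>i\<in>W. S i"
  have f: "finite ?U" using insert by auto
  have "card (S x \<inter> ?U) \<le> (\<Sum>i\<in>W. card (S x \<inter> S i))"
    using card_UN_le[OF insert(1), of "\<lambda>i. S x \<inter> S i"] by simp
  also have "\<dots> \<le> (\<Sum>i\<in>W. \<beta>)" using insert by (intro sum_mono insert.prems(3)) auto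
  finally have "card (S x \<inter> ?U) \<le> card W * \<beta>" by simp
  moreover have "card (S x \<union> ?U) + card (S x \<inter> ?U) = card (S x) + card ?U"
    using insert f by (subst card_Un_Int[of "S x" ?U]) auto
  moreover have "card W * \<alpha> \<le> card ?U + card W * card W * \<beta>"
    by (rule insert.IH) (use insert.prems in auto)
  moreover have "\<alpha> \<le> card (S x)" using insert by auto
  ultimately have "card W * \<alpha> + \<alpha> \<le> card (S x \<union> ?U) + (card W * card W * \<beta> + card W * \<beta>)" by linarith
  also have "\<dots> \<le> card (S x \<union> ?U) + Suc (card W) * Suc (card W) * \<beta>" by (simp add: algebra_simps)
  finally show ?case using insert by simp
qed simp

text \<open>The order of k and l enters only through \<open>kk = max k l\<close>. This keeps the
  locale symmetric in the two families, so that every fact has a mirrored version by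
  \<open>swapped\<close>.\<close>

locale crossfam = large_n n kk t for n kk t +
  fixes k l :: nat and F G :: "part set"
  assumes kk_eq: "kk = max k l" and k_ge: "t + 2 \<le> k" and l_ge: "t + 2 \<le> l"
    and not33: "(k, l) \<noteq> (3, 3)"
    and F_sub: "F \<subseteq> Parts n k" and G_sub: "G \<subseteq> Parts n l"
    and cross: "cross_t_int t F G" and nontriv: "nontrivial t F G"
    and maximal: "\<And>G1 G2. G1 \<subseteq> Parts n k \<Longrightarrow> G2 \<subseteq> Parts n l \<Longrightarrow>
               cross_t_int t G1 G2 \<Longrightarrow> nontrivial t G1 G2 \<Longrightarrow>
               card G1 * card G2 \<le> card F * card G"
begin

abbreviation "a s \<equiv> Stirling (n - s) (k - s)"
abbreviation "b s \<equiv> Stirling (n - s) (l - s)"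
abbreviation "K \<equiv> k - t"
abbreviation "L \<equiv> l - t"
text \<open>The summand 1 gives \<open>T * R = T * q^2 + t + 1\<close>; the excess t + 1 outweighs
  the coefficient t of the error term in \<open>CD_lower\<close>.\<close>

definition "R = q\<^sup>2 + 1"
abbreviation "FX X \<equiv> {A \<in> F. X \<subseteq> A}"

lemma swapped: "crossfam n kk t l k G F"
proof
  show "kk = max l k" by (simp add: kk_eq)
  show "t + 2 \<le> l" "t + 2 \<le> k" by (rule l_ge, rule k_ge)
  show "(l, k) \<noteq> (3, 3)" using not33 by auto
  show "G \<subseteq> Parts n l" "F \<subseteq> Parts n k" by (rule G_sub, rule F_sub)
  show "cross_t_int t G F" using cross unfolding cross_t_int_def by (metis Int_commute)
  show "nontrivial t G F" using nontriv by (simp add: nontrivial_def common_blocks_def Un_commute)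
  show "card G1 * card G2 \<le> card G * card F" if "G1 \<subseteq> Parts n l" "G2 \<subseteq> Parts n k"
    "cross_t_int t G1 G2" "nontrivial t G1 G2" for G1 G2
  proof -
    have "cross_t_int t G2 G1" using that(3) unfolding cross_t_int_def by (metis Int_commute)
    moreover have "nontrivial t G2 G1"
      using that(4) by (simp add: nontrivial_def common_blocks_def Un_commute)
    ultimately show ?thesis using maximal[OF that(2,1)] by (simp add: mult.commute)
  qed
qed

lemma k_le: "k \<le> kk" and l_le: "l \<le> kk" by (auto simp: kk_eq)

lemma KQ: "K + 1 \<le> Q" and LQ: "L + 1 \<le> Q" using k_le l_le by (auto simp: Q_def)

lemma KL_ge: "2 \<le> K" "2 \<le> L" using k_ge l_ge by auto

lemma finite_F [simp]: "finite F" and finite_G [simp]: "finite G"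
  using F_sub G_sub by (meson finite_subset finite_Parts)+

lemma a_ratio: "t \<le> s \<Longrightarrow> s < k \<Longrightarrow> R * a (s + 1) \<le> a s"
  and b_ratio: "t \<le> s \<Longrightarrow> s < l \<Longrightarrow> R * b (s + 1) \<le> b s"
  using Stirling_ratio[of s k] Stirling_ratio[of s l] k_le l_le by (auto simp: R_def)

lemma a_pos: "s < k \<Longrightarrow> 0 < a s" and b_pos: "s < l \<Longrightarrow> 0 < b s"
  using n_gt k_le l_le by (auto intro!: Stirling_pos)

lemma crossD: "A \<in> F \<Longrightarrow> B \<in> G \<Longrightarrow> t \<le> card (A \<inter> B)"
  using cross by (auto simp: cross_t_int_def)

lemma R_gt: "36 < R"
  using power_mono[OF q_ge, of 2] by (simp add: R_def)

lemma b_less: "b (t + 1) < b t"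
proof -
  have "2 * b (t + 1) \<le> R * b (t + 1)" using R_gt by (intro mult_right_mono) auto
  also have "\<dots> \<le> b t" using b_ratio[of t] l_ge by simp
  finally show ?thesis using b_pos[of "t + 1"] l_ge by simp
qed

text \<open>If D were forced, all these partitions would contain t + 1 fixed blocks, and there are
  at most \<open>b (t + 1) < b t\<close> of those.\<close>

lemma no_forced_block:
  assumes "I \<subseteq> {1..n}" "card I = t" "D \<notin> sing I"
  shows "\<exists>P \<in> famC n l (sing I). D \<notin> P"
proof (rule ccontr)
  assume "\<not> ?thesis"
  then have "famC n l (sing I) \<subseteq> famC n l (insert D (sing I))" by (auto simp: famC_def)
  then have "card (famC n l (sing I)) \<le> card (famC n l (insert D (sing I)))"
    by (intro card_mono) auto
  moreover have "finite I" using assms finite_subset by blast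
  then have "card (insert D (sing I)) = t + 1" using assms by simp
  then have "card (famC n l (insert D (sing I))) \<le> b (t + 1)" using l_ge by (intro card_famC_le) auto
  moreover have "card (famC n l (sing I)) = b t" using card_famC_sing[OF assms(1), of l] assms l_ge by simp
  ultimately show False using b_less by simp
qed

lemma CD_valid:
  assumes I: "I \<subseteq> {1..n}" "card I = t + 1"
  shows "cross_t_int t (famC n k (sing I)) (famD n t l (sing I))"
    "nontrivial t (famC n k (sing I)) (famD n t l (sing I))"
proof -
  have fI: "finite I" using I(1) by (meson finite_atLeastAtMost finite_subset)
  show "cross_t_int t (famC n k (sing I)) (famD n t l (sing I))"
    unfolding cross_t_int_def
  proof (intro ballI)
    fix A B assume AB: "A \<in> famC n k (sing I)" "B \<in> famD n t l (sing I)"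
    then have "t \<le> card (sing I \<inter> B)" by (auto simp: famD_def)
    also have "\<dots> \<le> card (A \<inter> B)"
      using AB PartsD(3)[of A n k] by (intro card_mono) (auto simp: famC_def)
    finally show "t \<le> card (A \<inter> B)" .
  qed
  have "common_blocks (famC n k (sing I)) (famD n t l (sing I)) = {}"
  proof (rule ccontr)
    assume "\<not> ?thesis"
    then obtain D where D: "\<And>P. P \<in> famD n t l (sing I) \<Longrightarrow> D \<in> P"
      by (auto simp: common_blocks_def)
    \<comment> \<open>Omitting i removes D if D is one of the singletons; otherwise any i will do.
      Members of the second family alone thus exclude a common block.\<close>
    obtain i where i: "i \<in> I" "D \<notin> sing (I - {i})"
    proof (cases "D \<in> sing I")
      case True then show ?thesis using that by auto
    next
      case False
      moreover obtain i where "i \<in> I" using I by (metis card.empty all_not_in_conv Suc_eq_plus1 nat.distinct(1))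
      ultimately show ?thesis using that by auto
    qed
    have "card (I - {i}) = t" using i I fI by simp
    then obtain P where P: "P \<in> famC n l (sing (I - {i}))" "D \<notin> P"
      using no_forced_block[of "I - {i}" D] i I by auto
    have "t = card (sing (I - {i}))" using \<open>card (I - {i}) = t\<close> by simp
    also have "\<dots> \<le> card (sing I \<inter> P)" using P fI by (intro card_mono) (auto simp: famC_def)
    finally have "P \<in> famD n t l (sing I)" using P by (auto simp: famC_def famD_def)
    then show False using D P by auto
  qed
  then show "nontrivial t (famC n k (sing I)) (famD n t l (sing I))"
    using t1 by (simp add: nontrivial_def)
qed

text \<open>Members are sorted by the one singleton of I that they miss, if any. The classes are
  disjoint, and each class missing a singleton has \<open>b t - b (t + 1)\<close> elements.\<close>

lemma card_famD_ge:
  assumes I: "I \<subseteq> {1..n}" "card I = t + 1"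
  shows "(t + 1) * b t \<le> card (famD n t l (sing I)) + t * b (t + 1)"
proof -
  have fI: "finite I" using I(1) by (meson finite_atLeastAtMost finite_subset)
  let ?S = "famC n l (sing I)"
  let ?E = "\<lambda>i. famC n l (sing (I - {i})) - ?S"
  have cS: "card ?S = b (t + 1)" using card_famC_sing[OF I(1), of l] I(2) l_ge by simp
  have cE: "card (?E i) = b t - b (t + 1)" if "i \<in> I" for i
  proof -
    have "card (famC n l (sing (I - {i}))) = b t"
      using card_famC_sing[of "I - {i}" n l] I l_ge that fI by auto
    moreover have "?S \<subseteq> famC n l (sing (I - {i}))" by (auto simp: famC_def)
    ultimately show ?thesis using cS by (simp add: card_Diff_subset)
  qed
  have "card (\<Union>i\<in>I. ?E i) = (\<Sum>i\<in>I. card (?E i))"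
  proof (rule card_UN_disjoint)
    show "\<forall>i\<in>I. \<forall>j\<in>I. i \<noteq> j \<longrightarrow> ?E i \<inter> ?E j = {}"
    proof (intro ballI impI equals0I)
      fix i j P assume "i \<in> I" "j \<in> I" "i \<noteq> j" and P: "P \<in> ?E i \<inter> ?E j"
      then have "{x} \<in> P" if "x \<in> I" for x
        using that by (cases "x = i") (auto simp: famC_def)
      then have "P \<in> ?S" using P by (auto simp: famC_def)
      then show False using P by blast
    qed
  qed (use fI in auto)
  also have "\<dots> = (t + 1) * (b t - b (t + 1))" using cE I by simp
  finally have "card (\<Union>i\<in>I. ?E i) = (t + 1) * (b t - b (t + 1))" .
  then have "card (?S \<union> (\<Union>i\<in>I. ?E i)) = b (t + 1) + (t + 1) * (b t - b (t + 1))"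
    using cS fI by (subst card_Un_disjoint) auto
  moreover have "?S \<union> (\<Union>i\<in>I. ?E i) \<subseteq> famD n t l (sing I)"
  proof
    fix P assume "P \<in> ?S \<union> (\<Union>i\<in>I. ?E i)"
    then obtain i where i: "P \<in> Parts n l" "sing (I - {i}) \<subseteq> P" "i \<in> I"
    proof (elim UnE)
      assume "P \<in> ?S"
      moreover obtain i where "i \<in> I" using I by (metis card.empty all_not_in_conv Suc_eq_plus1 nat.distinct(1))
      ultimately show ?thesis using that[of i] by (auto simp: famC_def)
    qed (auto simp: famC_def)
    have "t = card (sing (I - {i}))" using i I fI by simp
    also have "\<dots> \<le> card (sing I \<inter> P)" using i fI by (intro card_mono) auto
    finally show "P \<in> famD n t l (sing I)" using i by (auto simp: famD_def)
  qed
  then have "card (?S \<union> (\<Union>i\<in>I. ?E i)) \<le> card (famD n t l (sing I))"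
    by (rule card_mono[rotated]) (simp add: famD_def)
  ultimately have "b (t + 1) + (t + 1) * (b t - b (t + 1)) \<le> card (famD n t l (sing I))" by simp
  moreover have "(t + 1) * (b t - b (t + 1)) + (t + 1) * b (t + 1) = (t + 1) * b t"
    using b_less by (simp flip: distrib_left del: add_is_0)
  ultimately show ?thesis unfolding add_mult_distrib by linarith
qed

text \<open>Maximality against (C, D). The error term stands on the right to avoid natural
  subtraction.\<close>

lemma CD_lower: "T * (a (t + 1) * b t) \<le> card F * card G + t * (a (t + 1) * b (t + 1))"
proof -
  define I where "I = {1..t + 1}"
  have I: "I \<subseteq> {1..n}" "card I = t + 1" using n_gt by (auto simp: I_def T_def)
  have c: "card (famC n k (sing I)) = a (t + 1)"
    using card_famC_sing[OF I(1), of k] I(2) k_ge by simp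
  have "a (t + 1) * ((t + 1) * b t) \<le> a (t + 1) * (card (famD n t l (sing I)) + t * b (t + 1))"
    using card_famD_ge[OF I] by (rule mult_left_mono) simp
  also have "\<dots> = card (famC n k (sing I)) * card (famD n t l (sing I)) + t * (a (t + 1) * b (t + 1))"
    by (simp only: c distrib_left mult.left_commute)
  also have "\<dots> \<le> card F * card G + t * (a (t + 1) * b (t + 1))"
    using CD_valid[OF I] by (intro add_right_mono maximal) (auto simp: famC_def famD_def)
  finally show ?thesis by (simp only: T_def mult.left_commute)
qed

text \<open>Since n > l, some point lies outside J, so the enlarged block is no singleton. This
  gives both the number of blocks and the loss of {i}.\<close>

lemma famB_extra_Parts:
  assumes I: "I \<subseteq> J" "J \<subseteq> {1..n}" "card J = l" "i \<in> I"
  shows "(sing J - {{i}}) \<union> {{i} \<union> ({1..n} - J)} \<in> Parts n l" 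
    "{i} \<notin> (sing J - {{i}}) \<union> {{i} \<union> ({1..n} - J)}"
proof -
  let ?P = "(sing J - {{i}}) \<union> {{i} \<union> ({1..n} - J)}"
  have fJ: "finite J" using I(2) by (meson finite_atLeastAtMost finite_subset)
  have e: "sing J - {{i}} = sing (J - {i})" by auto
  have "card ({1..n} - J) = n - l" using I fJ by (simp add: card_Diff_subset)
  then have "{1..n} - J \<noteq> {}" using n_gt l_le by (intro notI) (simp only: card.empty)
  then obtain z where z: "z \<in> {1..n}" "z \<notin> J" by blast
  then have ne: "{i} \<union> ({1..n} - J) \<noteq> {j}" if "j \<in> J" for j using that I by (metis Diff_iff UnCI singletonD)
  show "{i} \<notin> ?P"
  proof
    assume "{i} \<in> ?P"
    then have "{i} = {i} \<union> ({1..n} - J)" by simp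
    then show False using ne[of i] I(1,4) by (metis subsetD)
  qed
  have "partition_on {1..n} ?P"
  proof (rule partition_onI)
    show "\<Union> ?P = {1..n}" using I by auto
    show "disjnt p r" if "p \<in> ?P" "r \<in> ?P" "p \<noteq> r" for p r
      using that I by (auto simp: disjnt_def)
  qed auto
  moreover have "card ?P = l"
  proof -
    have "card ?P = card (sing (J - {i})) + 1"
      unfolding e using fJ ne by (subst card_Un_disjoint) auto
    then show ?thesis using I fJ l_ge by auto
  qed
  ultimately show "?P \<in> Parts n l" by (simp add: Parts_def)
qed

lemma AB_valid:
  assumes I: "I \<subseteq> J" "J \<subseteq> {1..n}" "card J = l" "card I = t"
  shows "famB n l (sing I) (sing J) \<subseteq> Parts n l"
    "cross_t_int t (famA n k (sing I) (sing J)) (famB n l (sing I) (sing J))"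
    "nontrivial t (famA n k (sing I) (sing J)) (famB n l (sing I) (sing J))"
proof -
  have fJ: "finite J" "finite I" using I(1,2) by (meson finite_atLeastAtMost finite_subset)+
  have UJ: "\<Union> (sing J) = J" by auto
  show "famB n l (sing I) (sing J) \<subseteq> Parts n l"
    unfolding famB_def UJ using famB_extra_Parts(1)[OF I(1-3)] by blast
  show "cross_t_int t (famA n k (sing I) (sing J)) (famB n l (sing I) (sing J))"
    unfolding cross_t_int_def
  proof (intro ballI)
    fix A B assume AB: "A \<in> famA n k (sing I) (sing J)" "B \<in> famB n l (sing I) (sing J)"
    have A: "A \<in> Parts n k" "sing I \<subseteq> A" "A \<inter> (sing J - sing I) \<noteq> {}" using AB by (auto simp: famA_def)
    have fA: "finite A" using PartsD(3)[OF A(1)] .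
    from AB(2) consider "sing I \<subseteq> B" | i where "i \<in> I" "B = (sing J - {{i}}) \<union> {{i} \<union> ({1..n} - J)}"
      unfolding famB_def UJ by blast
    then show "t \<le> card (A \<inter> B)"
    proof cases
      case 1
      have "card (sing I) \<le> card (A \<inter> B)" using 1 A fA by (intro card_mono) auto
      then show ?thesis using I by simp
    next
      case 2
      obtain j where j: "j \<in> J" "j \<notin> I" "{j} \<in> A" using A by auto
      \<comment> \<open>An extra member of B lost {i} from the fixed blocks; the block {j} that A
        has in M - X makes up for it.\<close>
      have "sing (insert j (I - {i})) \<subseteq> A \<inter> B" using 2 A j I by auto
      then have "card (insert j (I - {i})) \<le> card (A \<inter> B)"
        using card_mono[of "A \<inter> B" "sing (insert j (I - {i}))"] fA unfolding card_sing by blast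
      moreover have "card (insert j (I - {i})) = t" using j 2 I fJ t1 by (simp add: card_Diff_singleton)
      ultimately show ?thesis by simp
    qed
  qed
  have "common_blocks (famA n k (sing I) (sing J)) (famB n l (sing I) (sing J)) = {}"
  proof (rule ccontr)
    assume "\<not> ?thesis"
    then obtain D where D: "\<And>P. P \<in> famB n l (sing I) (sing J) \<Longrightarrow> D \<in> P"
      by (auto simp: common_blocks_def)
    show False
    proof (cases "D \<in> sing I")
      case True
      then obtain i where i: "i \<in> I" "D = {i}" by auto
      then show False using famB_extra_Parts(2)[OF I(1-3) i(1)] D[of "(sing J - {{i}}) \<union> {{i} \<union> ({1..n} - J)}"]
        unfolding famB_def UJ by blast
    next
      case False
      then obtain P where "P \<in> famC n l (sing I)" "D \<notin> P" using no_forced_block[of I D] I by auto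
      then show False using D[of P] by (auto simp: famB_def famC_def)
    qed
  qed
  then show "nontrivial t (famA n k (sing I) (sing J)) (famB n l (sing I) (sing J))"
    using t1 by (simp add: nontrivial_def)
qed

text \<open>A is the union of the L families through X and one further singleton of M, whose
  pairwise intersections have t + 2 prescribed blocks; \<open>K >= 3\<close> makes
  \<open>a (t + 2)\<close> a bound for these. From B only the members containing X are
  counted.\<close>

lemma AB_lower:
  assumes "3 \<le> K"
  shows "L * (a (t + 1) * b t) \<le> card F * card G + L * L * (a (t + 2) * b t)"
proof -
  define I J where "I = {1..t}" and "J = {1..l}"
  have I: "I \<subseteq> J" "J \<subseteq> {1..n}" "card J = l" "card I = t"
    using l_ge n_gt l_le by (auto simp: I_def J_def)
  have fJ: "finite J" "finite I" using I(1,2) by (meson finite_atLeastAtMost finite_subset)+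
  let ?A = "famA n k (sing I) (sing J)" and ?B = "famB n l (sing I) (sing J)"
  let ?S = "\<lambda>j. famC n k (sing (insert j I))"
  have cW: "card (J - I) = L" using I fJ by (simp add: card_Diff_subset)
  have "card (J - I) * a (t + 1) \<le> card (\<Union>j\<in>J - I. ?S j) + card (J - I) * card (J - I) * a (t + 2)"
  proof (rule bonferroni)
    show "a (t + 1) \<le> card (?S j)" if "j \<in> J - I" for j
    proof -
      have "insert j I \<subseteq> {1..n}" "card (insert j I) = t + 1" using that I fJ by auto
      then show ?thesis using card_famC_sing[of "insert j I" n k] k_ge by simp
    qed
    show "card (?S i \<inter> ?S j) \<le> a (t + 2)" if "i \<in> J - I" "j \<in> J - I" "i \<noteq> j" for i j
    proof -
      have "?S i \<inter> ?S j = famC n k (sing (insert i (insert j I)))" by (auto simp: famC_def)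
      moreover have "card (sing (insert i (insert j I))) = t + 2"
        unfolding card_sing using that I fJ by simp
      ultimately show ?thesis using assms by (auto intro!: card_famC_le)
    qed
  qed (use fJ in auto)
  moreover have "card (\<Union>j\<in>J - I. ?S j) \<le> card ?A"
    by (intro card_mono) (auto simp: famA_def famC_def)
  ultimately have A: "L * a (t + 1) \<le> card ?A + L * L * a (t + 2)" unfolding cW by simp
  have "card (famC n l (sing I)) \<le> card ?B"
    using AB_valid(1)[OF I] finite_subset[OF _ finite_Parts] by (intro card_mono) (auto simp: famB_def famC_def)
  then have B: "b t \<le> card ?B" using card_famC_sing[of I n l] I l_ge by auto
  have "L * (a (t + 1) * b t) = (L * a (t + 1)) * b t" by (simp only: mult.assoc)
  also have "\<dots> \<le> (card ?A + L * L * a (t + 2)) * b t" using A by (rule mult_right_mono) simp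
  also have "\<dots> = card ?A * b t + L * L * (a (t + 2) * b t)" by (simp only: add_mult_distrib mult.assoc)
  also have "\<dots> \<le> card ?A * card ?B + L * L * (a (t + 2) * b t)"
    using B by (intro add_right_mono mult_left_mono) auto
  also have "\<dots> \<le> card F * card G + L * L * (a (t + 2) * b t)"
    using AB_valid[OF I] by (intro add_right_mono maximal) (auto simp: famA_def)
  finally show ?thesis .
qed

lemma prod_pos: "0 < card F * card G"
proof -
  have "t * (a (t + 1) * b (t + 1)) \<le> t * (a (t + 1) * b t)" using b_less by (intro mult_left_mono) auto
  then have "a (t + 1) * b t \<le> card F * card G" using CD_lower unfolding T_def add_mult_distrib by linarith
  moreover have "0 < a (t + 1) * b t" using a_pos[of "t + 1"] b_pos[of t] k_ge l_ge by simp
  ultimately show ?thesis by linarith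
qed

lemma F_ne: "F \<noteq> {}" and G_ne: "G \<noteq> {}" using prod_pos by auto

text \<open>Both sizes are positive, so enlarging either family would increase the product.\<close>

lemma eq_if_sub_valid:
  assumes "F \<subseteq> F'" "G \<subseteq> G'" "F' \<subseteq> Parts n k" "G' \<subseteq> Parts n l"
    "cross_t_int t F' G'" "nontrivial t F' G'"
  shows "F = F' \<and> G = G'"
proof -
  have fin: "finite F'" "finite G'" using assms(3,4) by (meson finite_subset finite_Parts)+
  have le: "card F \<le> card F'" "card G \<le> card G'" using assms fin by (auto intro: card_mono)
  have m: "card F' * card G' \<le> card F * card G" using assms by (intro maximal)
  have pos: "0 < card F" "0 < card G" using prod_pos by auto
  have "card F = card F'"
  proof (rule ccontr)
    assume "card F \<noteq> card F'"
    then have "card F * card G < card F' * card G'" using le pos by (intro mult_less_le_imp_less) auto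
    then show False using m by simp
  qed
  moreover have "card G = card G'"
  proof (rule ccontr)
    assume "card G \<noteq> card G'"
    then have "card F * card G < card F' * card G'" using le pos by (intro mult_le_less_imp_less) auto
    then show False using m by simp
  qed
  ultimately show ?thesis using assms fin by (simp add: card_subset_eq)
qed

end


section \<open>Covers and branching\<close>

context crossfam
begin

abbreviation "\<alpha> \<equiv> a (t + 1)"
abbreviation "\<beta> \<equiv> b t"
abbreviation "\<beta>1 \<equiv> b (t + 1)"

lemma \<alpha>_pos: "0 < \<alpha>" and \<beta>_pos: "0 < \<beta>" and \<beta>1_pos: "0 < \<beta>1"
  using a_pos[of "t + 1"] b_pos[of t] b_pos[of "t + 1"] k_ge l_ge by auto

lemma R_\<beta>1: "R * \<beta>1 \<le> \<beta>" using b_ratio[of t] l_ge by simp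

lemma q_le_R: "q \<le> R" using q_ge mult_le_mono1[of 1 q q] unfolding R_def power2_eq_square by linarith

lemma TR: "T * R = T * q\<^sup>2 + t + 1" by (simp add: R_def T_def)

text \<open>By \<open>CD_lower\<close> and \<open>R_\<beta>1\<close> the product is at least T * R -
  t = T * q^2 + 1 in units of \<open>\<alpha> * \<beta>1\<close>.\<close>

lemma contra_low:
  assumes "card F * card G \<le> T * q\<^sup>2 * (\<alpha> * \<beta>1)"
  shows False
proof -
  have "T * R * (\<alpha> * \<beta>1) = T * (\<alpha> * (R * \<beta>1))" by (simp only: mult_ac)
  also have "\<dots> \<le> T * (\<alpha> * \<beta>)" using R_\<beta>1 by (intro mult_left_mono) auto
  also note CD_lower
  finally have "(T * q\<^sup>2 + t + 1) * (\<alpha> * \<beta>1) \<le> T * q\<^sup>2 * (\<alpha> * \<beta>1) + t * (\<alpha> * \<beta>1)"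
    using assms unfolding TR by linarith
  then have "\<alpha> * \<beta>1 \<le> 0" unfolding add_mult_distrib by linarith
  then show False using \<alpha>_pos \<beta>1_pos by simp
qed

text \<open>The same comparison in units of \<open>\<alpha> * \<beta>\<close> divided by R.\<close>

lemma contra_high:
  assumes "R * (card F * card G) \<le> T * q\<^sup>2 * (\<alpha> * \<beta>)"
  shows False
proof -
  have "T * R * (\<alpha> * \<beta>) = R * (T * (\<alpha> * \<beta>))" by (simp only: mult_ac)
  also have "\<dots> \<le> R * (card F * card G + t * (\<alpha> * \<beta>1))" using CD_lower by (rule mult_left_mono) simp
  also have "\<dots> = R * (card F * card G) + t * (\<alpha> * (R * \<beta>1))" by (simp only: distrib_left mult_ac)
  also have "\<dots> \<le> T * q\<^sup>2 * (\<alpha> * \<beta>) + t * (\<alpha> * \<beta>)"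
    using assms R_\<beta>1 by (intro add_mono mult_left_mono) auto
  finally have "\<alpha> * \<beta> \<le> 0" unfolding TR add_mult_distrib by linarith
  then show False using \<alpha>_pos \<beta>_pos by simp
qed

lemma FX_le: "card X = s \<Longrightarrow> s < k \<Longrightarrow> card (FX X) \<le> a s"
proof -
  assume s: "card X = s" "s < k"
  have "FX X \<subseteq> famC n k X" using F_sub by (auto simp: famC_def)
  then have "card (FX X) \<le> card (famC n k X)" by (intro card_mono) auto
  also have "\<dots> \<le> a s" using s by (rule card_famC_le)
  finally show ?thesis .
qed

lemma GX_le: "card X = s \<Longrightarrow> s < l \<Longrightarrow> card {B \<in> G. X \<subseteq> B} \<le> b s"
  using crossfam.FX_le[OF swapped] .

text \<open>If \<open>X\<close> meets \<open>B\<close> in fewer than \<open>t\<close> blocks, then any \<open>l - t + 1\<close> blocks of \<open>B\<close> outside \<open>X\<close>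
  are hit by every member of \<open>F\<close>, since the rest of \<open>B\<close> has only \<open>t - 1\<close> blocks.\<close>

lemma branch:
  assumes "B \<in> G" "card (B \<inter> X) < t"
  obtains W where "W \<subseteq> B - X" "card W = L + 1" "finite W" "\<And>A. A \<in> F \<Longrightarrow> A \<inter> W \<noteq> {}"
proof -
  have B: "card B = l" "finite B" using assms(1) G_sub PartsD(2,3) by blast+
  have "card (B - X) = l - card (B \<inter> X)" using B card_Diff_subset_Int[of B X] by simp
  then have "L + 1 \<le> card (B - X)" using assms(2) l_ge by simp
  then obtain W where W: "W \<subseteq> B - X" "card W = L + 1" by (meson obtain_subset_with_card_n)
  have fW: "finite W" using W(1) B(2) by (meson finite_Diff finite_subset)
  have "A \<inter> W \<noteq> {}" if "A \<in> F" for A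
  proof
    assume "A \<inter> W = {}"
    then have "card (A \<inter> B) \<le> card (B - W)" using B by (intro card_mono) auto
    also have "\<dots> = l - (L + 1)" using W B fW by (subst card_Diff_subset) auto
    also have "\<dots> < t" using l_ge t1 by simp
    finally show False using crossD[OF that assms(1)] by simp
  qed
  then show ?thesis using that W fW by blast
qed

lemma card_FX_branch:
  assumes "finite W" "\<And>A. A \<in> FX X \<Longrightarrow> A \<inter> W \<noteq> {}"
    "\<And>C. C \<in> W \<Longrightarrow> card (FX (insert C X)) \<le> m C"
  shows "card (FX X) \<le> (\<Sum>C\<in>W. m C)"
proof -
  have "FX X \<subseteq> (\<Union>C\<in>W. FX (insert C X))" using assms(2) by auto
  then have "card (FX X) \<le> card (\<Union>C\<in>W. FX (insert C X))" using assms(1) by (intro card_mono) auto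
  also have "\<dots> \<le> (\<Sum>C\<in>W. card (FX (insert C X)))" using assms(1) by (rule card_UN_le)
  also have "\<dots> \<le> (\<Sum>C\<in>W. m C)" by (intro sum_mono assms(3))
  finally show ?thesis .
qed

lemma branch_step:
  assumes "B \<in> G" "card (B \<inter> X) < t" "finite X"
    "\<And>C. C \<notin> X \<Longrightarrow> card (FX (insert C X)) \<le> m"
  shows "card (FX X) \<le> (L + 1) * m"
proof -
  obtain W where W: "W \<subseteq> B - X" "card W = L + 1" "finite W" "\<And>A. A \<in> F \<Longrightarrow> A \<inter> W \<noteq> {}"
    using branch[OF assms(1,2)] by metis
  have "card (FX X) \<le> (\<Sum>C\<in>W. m)"
    by (rule card_FX_branch) (use W assms(4) in auto)
  then show ?thesis using W by simp
qed

lemma branch_bound: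
  assumes "B \<in> G" "card (B \<inter> X) < t" "finite X" "card X = s" "s + 1 < k"
  shows "card (FX X) \<le> (L + 1) * a (s + 1)"
proof (rule branch_step[OF assms(1-3)])
  show "card (FX (insert C X)) \<le> a (s + 1)" if "C \<notin> X" for C
    using that assms by (intro FX_le) auto
qed

text \<open>Every t-cover of H has at least m blocks, put in the form that supplies a member to
  branch over.\<close>

definition noncover :: "nat \<Rightarrow> part set \<Rightarrow> bool" where
  "noncover m H \<longleftrightarrow> (\<forall>X. finite X \<and> card X < m \<longrightarrow> (\<exists>B\<in>H. card (B \<inter> X) < t))"

text \<open>As long as fewer than t + y blocks are prescribed they form no t-cover of G, so some
  member of G allows another branching into L + 1 cases.\<close>

lemma extend_bound:
  assumes "noncover (t + y) G" "t + y < k" "finite X" "card X + d = t + y"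
  shows "card (FX X) \<le> (L + 1) ^ d * a (t + y)"
  using assms(3,4)
proof (induction d arbitrary: X)
  case 0
  then show ?case using FX_le[of X "t + y"] assms(2) by simp
next
  case (Suc d)
  then have "card X < t + y" by simp
  then obtain B where B: "B \<in> G" "card (B \<inter> X) < t" using assms(1) Suc.prems by (auto simp: noncover_def)
  have "card (FX X) \<le> (L + 1) * ((L + 1) ^ d * a (t + y))"
  proof (rule branch_step[OF B Suc.prems(1)])
    show "card (FX (insert C X)) \<le> (L + 1) ^ d * a (t + y)" if "C \<notin> X" for C
      using Suc.prems that by (intro Suc.IH) auto
  qed
  then show ?case by (simp only: power_Suc mult.assoc)
qed

text \<open>Each member contains t of the t + x blocks of the cover.\<close>

lemma cover_bound:
  assumes "finite C" "card C = t + x" "\<And>A. A \<in> F \<Longrightarrow> t \<le> card (A \<inter> C)"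
    "\<And>H. finite H \<Longrightarrow> card H = t \<Longrightarrow> card (FX H) \<le> m"
  shows "card F \<le> (t + x choose t) * m"
proof -
  let ?S = "{H. H \<subseteq> C \<and> card H = t}"
  have fS: "finite ?S" using assms(1) by simp
  have "F \<subseteq> (\<Union>H\<in>?S. FX H)"
  proof
    fix A assume A: "A \<in> F"
    obtain H where "H \<subseteq> A \<inter> C" "card H = t" using assms(3)[OF A] by (meson obtain_subset_with_card_n)
    then show "A \<in> (\<Union>H\<in>?S. FX H)" using A by auto
  qed
  then have "card F \<le> card (\<Union>H\<in>?S. FX H)" using fS by (intro card_mono) auto
  also have "\<dots> \<le> (\<Sum>H\<in>?S. card (FX H))" using fS by (rule card_UN_le)
  also have "\<dots> \<le> (\<Sum>H\<in>?S. m)"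
    using assms(1) by (intro sum_mono assms(4)) (auto intro: finite_subset)
  also have "\<dots> = (t + x choose t) * m" using n_subsets[OF assms(1), of t] assms(2) by simp
  finally show ?thesis .
qed

text \<open>Any member of G is a t-cover of F with l blocks, so a smallest one exceeds t by at most
  L.\<close>

lemma min_cover:
  obtains C x where "finite C" "card C = t + x" "\<And>A. A \<in> F \<Longrightarrow> t \<le> card (A \<inter> C)" "x \<le> L" "noncover (t + x) F"
proof -
  define P where "P m \<longleftrightarrow> (\<exists>C. finite C \<and> card C = m \<and> (\<forall>A\<in>F. t \<le> card (A \<inter> C)))" for m
  obtain B where B: "B \<in> G" using G_ne by blast
  then have B': "card B = l" "finite B" using G_sub PartsD(2,3) by blast+
  then have Pl: "P l" using crossD[OF _ B] unfolding P_def by blast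
  define m where "m = (LEAST m. P m)"
  have "P m" unfolding m_def by (rule LeastI[of P, OF Pl])
  then obtain C where C: "finite C" "card C = m" "\<forall>A\<in>F. t \<le> card (A \<inter> C)" unfolding P_def by blast
  have ml: "m \<le> l" unfolding m_def by (rule Least_le[of P, OF Pl])
  obtain A where A: "A \<in> F" using F_ne by blast
  have "t \<le> card (A \<inter> C)" using C A by blast
  also have "\<dots> \<le> card C" using C by (intro card_mono) auto
  finally have tm: "t \<le> m" using C by simp
  have "noncover m F"
    unfolding noncover_def
  proof (intro allI impI)
    fix X :: "nat set set" assume X: "finite X \<and> card X < m"
    then have "\<not> P (card X)" unfolding m_def by (intro not_less_Least) auto
    then show "\<exists>B\<in>F. card (B \<inter> X) < t" using X unfolding P_def not_le[symmetric] by blast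
  qed
  then show ?thesis using that[of C "m - t"] C tm ml by auto
qed

lemma power_a: "t + Suc y < k \<Longrightarrow> R ^ y * a (t + Suc y) \<le> \<alpha>"
proof (induction y)
  case (Suc y)
  have "R * a (t + Suc y + 1) \<le> a (t + Suc y)" using Suc.prems by (intro a_ratio) auto
  then have "R ^ y * (R * a (t + Suc (Suc y))) \<le> R ^ y * a (t + Suc y)" by simp
  also have "\<dots> \<le> \<alpha>" using Suc by simp
  finally show ?case by (simp add: mult_ac)
qed simp

text \<open>The bound for F has the binomial of its own cover but branches up to the cover size of
  G, and conversely. Exchanging the binomials in the product makes each factor depend on a single
  excess. The exponent stops at K - 1 because \<open>card_famC_le\<close> needs fewer than k
  prescribed blocks.\<close>

definition weight :: "nat \<Rightarrow> nat" where
  "weight y = (t + y choose t) * ((L + 1) ^ min y (K - 1) * a (t + min y (K - 1)))"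

text \<open>Each block beyond t + 1 gains R, which pays for one factor q. For y >= 2 one R can be
  kept at the price of one more q.\<close>

lemma power_q_a:
  assumes "1 \<le> y" "t + y < k"
  shows "q ^ y * a (t + y) \<le> q * \<alpha>" "2 \<le> y \<Longrightarrow> R * (q ^ y * a (t + y)) \<le> q\<^sup>2 * \<alpha>"
proof -
  obtain z where z: "y = Suc z" using assms by (cases y) auto
  have "q ^ z * a (t + y) \<le> R ^ z * a (t + y)"
    using q_le_R by (intro mult_right_mono power_mono) auto
  also have "\<dots> \<le> \<alpha>" using power_a[of z] assms z by simp
  finally have "q * (q ^ z * a (t + y)) \<le> q * \<alpha>" by simp
  then show "q ^ y * a (t + y) \<le> q * \<alpha>" by (simp add: z mult_ac)
  assume "2 \<le> y"
  then obtain w where w: "z = Suc w" using z by (cases z) auto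
  have "R * (q ^ w * a (t + y)) \<le> R * (R ^ w * a (t + y))"
    using q_le_R by (intro mult_left_mono mult_right_mono power_mono) auto
  also have "\<dots> = R ^ z * a (t + y)" by (simp add: w)
  also have "\<dots> \<le> \<alpha>" using power_a[of z] assms z by simp
  finally have "q\<^sup>2 * (R * (q ^ w * a (t + y))) \<le> q\<^sup>2 * \<alpha>" by simp
  then show "R * (q ^ y * a (t + y)) \<le> q\<^sup>2 * \<alpha>"
    by (simp add: z w power2_eq_square mult_ac)
qed

text \<open>Only for y = K does the binomial bound T ^ y have a larger exponent than the branching
  factor; hence the additional T.\<close>

lemma weight_le:
  assumes "y \<le> K"
  shows "weight y \<le> (if y = K then T else 1) * (q ^ min y (K - 1) * a (t + min y (K - 1)))"
proof -
  define y' where "y' = min y (K - 1)"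
  have "(t + y choose t) \<le> T ^ y" using choose_le_power[of t y] by (simp add: T_def)
  also have "T ^ y = (if y = K then T else 1) * T ^ y'"
  proof (cases "y = K")
    case True
    then have "y = Suc y'" using KL_ge by (simp add: y'_def)
    then show ?thesis using True by simp
  next
    case False
    then have "y' = y" using assms by (simp add: y'_def)
    then show ?thesis using False by simp
  qed
  finally have "weight y \<le> ((if y = K then T else 1) * T ^ y') * (Q ^ y' * a (t + y'))"
    unfolding weight_def y'_def[symmetric]
    using LQ by (intro mult_mono mult_right_mono power_mono) auto
  then show ?thesis by (simp only: y'_def q_def power_mult_distrib mult.assoc)
qed

lemma weight_large:
  assumes "3 \<le> K" "1 \<le> y" "y \<le> K"
  shows "2 \<le> y \<Longrightarrow> R * weight y \<le> T * q\<^sup>2 * \<alpha>" and "weight y \<le> q * \<alpha>"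
proof -
  define y' where "y' = min y (K - 1)"
  define c where "c = (if y = K then T else 1)"
  have y': "1 \<le> y'" "t + y' < k" using assms by (auto simp: y'_def)
  have w: "weight y \<le> c * (q ^ y' * a (t + y'))"
    using weight_le[OF assms(3)] by (simp only: c_def y'_def)
  show *: "R * weight y \<le> T * q\<^sup>2 * \<alpha>" if "2 \<le> y"
  proof -
    have "R * weight y \<le> R * (c * (q ^ y' * a (t + y')))" using w by simp
    also have "\<dots> = c * (R * (q ^ y' * a (t + y')))" by (simp only: mult_ac)
    also have "\<dots> \<le> T * (q\<^sup>2 * \<alpha>)"
      using that assms T_ge by (intro mult_mono power_q_a(2)[OF y']) (auto simp: c_def y'_def)
    finally show ?thesis by (simp only: mult.assoc)
  qed
  show "weight y \<le> q * \<alpha>"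
  proof (cases "y = K")
    case False
    then show ?thesis using w power_q_a(1)[OF y'] by (simp add: c_def)
  next
    case True
    then have "R * weight y \<le> T * q\<^sup>2 * \<alpha>" using * assms by simp
    \<comment> \<open>For y = K the bound containing R is the sharper one: q^2 < R cancels and only
      T remains.\<close>
    also have "\<dots> \<le> R * (T * \<alpha>)" by (simp add: R_def algebra_simps)
    finally have "weight y \<le> T * \<alpha>" using R_gt by simp
    also have "\<dots> \<le> q * \<alpha>" using Q_ge by (simp add: q_def)
    finally show ?thesis .
  qed
qed

text \<open>This includes K = 2, where y = 2 has its exponent cut to 1 and the additional T cannot
  be absorbed.\<close>

lemma weight_any:
  assumes "1 \<le> y" "y \<le> K"
  shows "weight y \<le> T * q * \<alpha>"
proof -
  have "weight y \<le> (if y = K then T else 1) * (q ^ min y (K - 1) * a (t + min y (K - 1)))"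
    by (rule weight_le[OF assms(2)])
  also have "\<dots> \<le> T * (q * \<alpha>)"
    using assms KL_ge T_ge by (intro mult_mono power_q_a(1)) auto
  finally show ?thesis by (simp only: mult.assoc)
qed

lemma noncover_mono: "noncover m H \<Longrightarrow> m' \<le> m \<Longrightarrow> noncover m' H"
  unfolding noncover_def by (meson less_le_trans)

lemma card_F_le:
  assumes "finite C" "card C = t + x" "\<And>A. A \<in> F \<Longrightarrow> t \<le> card (A \<inter> C)"
    "noncover (t + y) G"
  shows "card F \<le> (t + x choose t) * ((L + 1) ^ min y (K - 1) * a (t + min y (K - 1)))"
proof (rule cover_bound[OF assms(1-3)])
  fix H :: "nat set set" assume "finite H" "card H = t"
  then show "card (FX H) \<le> (L + 1) ^ min y (K - 1) * a (t + min y (K - 1))"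
    using KL_ge by (intro extend_bound noncover_mono[OF assms(4)]) auto
qed

end

context crossfam
begin

interpretation sw: crossfam n kk t l k G F by (rule swapped)

lemma both_covers_large:
  assumes "finite C" "card C = t + x" "\<And>A. A \<in> F \<Longrightarrow> t \<le> card (A \<inter> C)" "noncover (t + x) F"
    and "finite D" "card D = t + y" "\<And>B. B \<in> G \<Longrightarrow> t \<le> card (B \<inter> D)" "noncover (t + y) G"
    and xy: "1 \<le> x" "x \<le> L" "1 \<le> y" "y \<le> K"
  shows False
proof -
  have F: "card F \<le> (t + x choose t) * ((L + 1) ^ min y (K - 1) * a (t + min y (K - 1)))"
    by (rule card_F_le[OF assms(1-3,8)])
  have G: "card G \<le> (t + y choose t) * ((K + 1) ^ min x (L - 1) * b (t + min x (L - 1)))"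
    by (rule sw.card_F_le[OF assms(5-7,4)])
  have "card F * card G \<le> ((t + x choose t) * ((L + 1) ^ min y (K - 1) * a (t + min y (K - 1)))) *
      ((t + y choose t) * ((K + 1) ^ min x (L - 1) * b (t + min x (L - 1))))"
    using F G by (rule mult_mono) auto
  also have "\<dots> = weight y * sw.weight x"
    unfolding weight_def sw.weight_def by (simp only: mult_ac)
  finally have P: "card F * card G \<le> weight y * sw.weight x" .
  show False
  proof (cases "3 \<le> K \<or> 3 \<le> L")
    case True
    \<comment> \<open>One factor may carry the additional T while the other has the sharp bound;
      \<open>T * q^2\<close> is exactly what \<open>contra_low\<close> excludes.\<close>
    have "weight y * sw.weight x \<le> T * q\<^sup>2 * (\<alpha> * \<beta>1)"
    proof (cases "3 \<le> K")
      case True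
      have "weight y * sw.weight x \<le> (q * \<alpha>) * (T * q * \<beta>1)"
        using weight_large(2)[OF True] sw.weight_any xy by (intro mult_mono) auto
      then show ?thesis by (simp only: power2_eq_square mult_ac)
    next
      case False
      then have "weight y * sw.weight x \<le> (T * q * \<alpha>) * (q * \<beta>1)"
        using weight_any sw.weight_large(2) xy True by (intro mult_mono) auto
      then show ?thesis by (simp only: power2_eq_square mult_ac)
    qed
    then show False using P by (intro contra_low) linarith
  next
    case False
    \<comment> \<open>Now both factors may carry the additional T, too much for
      \<open>contra_low\<close>. But \<open>\<alpha> = \<beta>1 = 1\<close> and
      \<open>\<beta>\<close> is exponential in n, so the crude bound (T * q)^2 suffices.\<close>
    then have KL: "K = 2" "L = 2" using KL_ge by auto
    have kl: "k - (t + 1) = 1" "l - (t + 1) = 1" using KL by auto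
    define m where "m = n - (t + 1)"
    have m: "n - t = Suc m" "n - (t + 1) = m" "m = Suc (m - 1)" "n - t - 2 \<le> m"
      using n_gt by (auto simp: m_def T_def)
    have "Stirling m 1 = 1" by (subst m(3)) (simp only: One_nat_def Stirling_1)
    then have one: "\<alpha> = 1" "\<beta>1 = 1" by (simp_all only: kl m(2))
    have \<beta>: "\<beta> = 2 ^ m - 1" using KL m Stirling_2[of m] by (simp add: numeral_2_eq_2)
    have "card F * card G \<le> (T * q * \<alpha>) * (T * q * \<beta>1)"
      using P mult_mono[OF weight_any[OF xy(3,4)] sw.weight_any[OF xy(1,2)]] by linarith
    then have "T * \<beta> \<le> (T * q) * (T * q) + t" using CD_lower one by simp
    also have "\<dots> \<le> T * (T * q * q + 1)" by (simp add: T_def algebra_simps)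
    finally have b1: "\<beta> \<le> T * q * q + 1" unfolding mult_le_cancel1 using T_ge by simp
    have "T * q * q + 2 < q ^ 6"
    proof -
      have Tq: "T \<le> q" using Q_ge by (simp add: q_def)
      have "T * q * q + 2 \<le> q * q * q + q * q * q"
        using Tq q_ge mult_mono[of 2 q 1 "q * q"] by (intro add_mono mult_mono) auto
      also have "\<dots> \<le> 6 * (q * q * q)" by simp
      also have "\<dots> \<le> q * (q * q * q)" using q_ge by (rule mult_right_mono) simp
      also have "\<dots> = q ^ 4" by (simp add: numeral_eq_Suc)
      also have "\<dots> < q ^ 6" using q_ge by (intro power_strict_increasing) auto
      finally show ?thesis .
    qed
    also have "\<dots> \<le> 2 ^ (n - t - 2)" by (rule q_power_6_le)
    also have "\<dots> \<le> 2 ^ m" using m by (intro power_increasing) auto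
    finally show False using b1 \<beta> by simp
  qed
qed

end


section \<open>A fixed set of blocks in one family\<close>

lemma two_elements:
  assumes "2 \<le> card S"
  obtains x y where "x \<in> S" "y \<in> S" "x \<noteq> y"
proof -
  obtain S' where "S' \<subseteq> S" "card S' = 2" using assms by (meson obtain_subset_with_card_n)
  then show ?thesis using that unfolding card_2_iff by blast
qed

context crossfam
begin

definition isCD where
  "isCD \<longleftrightarrow> (\<exists>I. I \<subseteq> {1..n} \<and> card I = t + 1 \<and> F = famC n k (sing I) \<and> G = famD n t l (sing I))"

definition isAB where
  "isAB \<longleftrightarrow> (\<exists>I J. I \<subseteq> J \<and> J \<subseteq> {1..n} \<and> card J = l \<and> card I = t \<and>
     F = famA n k (sing I) (sing J) \<and> G = famB n l (sing I) (sing J))"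

lemma not_common:
  assumes "finite Y" "card Y = t" "\<And>A. A \<in> F \<Longrightarrow> Y \<subseteq> A"
  shows "\<exists>B\<in>G. \<not> Y \<subseteq> B"
proof (rule ccontr)
  assume "\<not> ?thesis"
  then have sub: "Y \<subseteq> common_blocks F G" using assms(3) unfolding common_blocks_def by blast
  \<comment> \<open>\<open>card\<close> is 0 on infinite sets, so \<open>nontrivial\<close> can be
    contradicted only once the common blocks are confined to a member of F.\<close>
  obtain A where A: "A \<in> F" using F_ne by blast
  then have "finite A" using F_sub PartsD(3) by blast
  moreover have "common_blocks F G \<subseteq> A" using A by (auto simp: common_blocks_def)
  ultimately have "finite (common_blocks F G)" by (rule finite_subset[rotated])
  then have "t \<le> card (common_blocks F G)" using card_mono[OF _ sub] assms(2) by simp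
  then show False using nontriv by (simp add: nontrivial_def)
qed

lemma card_inter_less:
  assumes "finite Y" "card Y = t" "\<not> Y \<subseteq> B"
  shows "card (B \<inter> Y) < t"
proof -
  have "B \<inter> Y \<subset> Y" using assms(3) by blast
  then show ?thesis using psubset_card_mono[OF assms(1)] assms(2) by simp
qed

text \<open>The hypotheses place the pair inside (C, D) for the set of points of T0, and maximality
  gives equality.\<close>

lemma CD_if_contained:
  assumes "finite T0" "card T0 = t + 1" "\<And>A. A \<in> F \<Longrightarrow> T0 \<subseteq> A" "\<And>B. B \<in> G \<Longrightarrow> t \<le> card (B \<inter> T0)"
    "\<And>Z. Z \<in> T0 \<Longrightarrow> card Z = 1"
  shows isCD
proof -
  define I where "I = \<Union> T0"
  have T0: "T0 = sing I" unfolding I_def by (rule all_card_1_eq_sing[OF assms(5)])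
  obtain A where A: "A \<in> F" using F_ne by blast
  have A': "A \<in> Parts n k" using A F_sub by blast
  have "\<Union> T0 \<subseteq> \<Union> A" using assms(3)[OF A] by (rule Union_mono)
  then have I: "I \<subseteq> {1..n}" using PartsD(4)[OF A'] by (simp add: I_def)
  have cI: "card I = t + 1" using assms(2) T0 by (metis card_sing)
  have "F \<subseteq> famC n k (sing I)" using assms(3) F_sub T0 by (auto simp: famC_def)
  moreover have "G \<subseteq> famD n t l (sing I)"
    using assms(4) G_sub unfolding T0 famD_def by (auto simp: Int_commute)
  ultimately have "F = famC n k (sing I) \<and> G = famD n t l (sing I)"
    using CD_valid[OF I cI] by (intro eq_if_sub_valid) (auto simp: famC_def famD_def)
  then show ?thesis using I cI unfolding isCD_def by blast
qed

end

section \<open>Stars: all members of F contain the t blocks of X\<close>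

locale star = crossfam +
  fixes X :: part
  assumes finX: "finite X" and cardX: "card X = t" and X_sub: "\<And>A. A \<in> F \<Longrightarrow> X \<subseteq> A"
begin

abbreviation "G0 \<equiv> {B \<in> G. \<not> X \<subseteq> B}"

lemma F_eq_FX: "F = FX X" using X_sub by blast

lemma G0_ne: "G0 \<noteq> {}" using not_common[OF finX cardX X_sub] by blast

lemma G0_card: "B \<in> G0 \<Longrightarrow> card (B \<inter> X) < t"
  using card_inter_less[OF finX cardX] by simp

text \<open>If both families were stars, non-triviality would supply on each side a member missing
  part of the other star, hence one branching for each family; the product would be at most
  \<open>Q^2 * \<alpha> * \<beta>1\<close>.\<close>

lemma no_star_G:
  assumes "finite Y" "card Y = t" "\<And>B. B \<in> G \<Longrightarrow> Y \<subseteq> B"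
  shows False
proof -
  interpret sw: crossfam n kk t l k G F by (rule swapped)
  obtain B where B: "B \<in> G" "\<not> X \<subseteq> B" using not_common[OF finX cardX X_sub] by blast
  have 1: "card F \<le> (L + 1) * \<alpha>"
    using branch_bound[OF B(1) _ finX cardX] G0_card B k_ge F_eq_FX by simp
  obtain A where A: "A \<in> F" "\<not> Y \<subseteq> A" using sw.not_common[OF assms] by blast
  have "G = {B \<in> G. Y \<subseteq> B}" using assms(3) by blast
  then have 2: "card G \<le> (K + 1) * \<beta>1"
    using sw.branch_bound[OF A(1) card_inter_less[OF assms(1,2) A(2)] assms(1,2)] l_ge by simp
  have "card F * card G \<le> (Q * \<alpha>) * (Q * \<beta>1)"
    using 1 2 KQ LQ by (meson le_trans mult_le_mono mult_le_mono1)
  also have "\<dots> = Q\<^sup>2 * (\<alpha> * \<beta>1)" by (simp add: power2_eq_square mult_ac)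
  also have "\<dots> \<le> T * q\<^sup>2 * (\<alpha> * \<beta>1)"
  proof -
    have "Q \<le> T * Q" using T_ge by simp
    then have "1 * Q\<^sup>2 \<le> T * (T * Q)\<^sup>2" using T_ge by (intro mult_le_mono power_mono) auto
    then show ?thesis unfolding q_def by (intro mult_le_mono1) simp
  qed
  finally show False by (rule contra_low)
qed

text \<open>No partition containing X has a further block meeting a block of X, so disjointness
  discards only blocks that never occur in F. It excludes the block of a member of G that meets a
  missing block of X, which is what gives \<open>card CC <= L\<close>.\<close>

definition CC :: part where
  "CC = {C. C \<notin> X \<and> (\<forall>Y\<in>X. C \<inter> Y = {}) \<and> (\<forall>B\<in>G. t \<le> card (B \<inter> insert C X))}"

lemma CC_D: "C \<in> CC \<Longrightarrow> C \<notin> X" "C \<in> CC \<Longrightarrow> Y \<in> X \<Longrightarrow> C \<inter> Y = {}"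
  "C \<in> CC \<Longrightarrow> B \<in> G \<Longrightarrow> t \<le> card (B \<inter> insert C X)"
  unfolding CC_def by simp_all

text \<open>A member of G0 has at most t - 1 blocks in X, so t blocks in X and C are reached only
  with C and all of X but one block.\<close>

lemma CC_G0:
  assumes "C \<in> CC" "B \<in> G0"
  shows "C \<in> B" "card (B \<inter> X) + 1 = t"
proof -
  have c: "t \<le> card (B \<inter> insert C X)" using CC_D(3)[OF assms(1)] assms(2) by simp
  have lt: "card (B \<inter> X) < t" by (rule G0_card[OF assms(2)])
  show C: "C \<in> B"
  proof (rule ccontr)
    assume "C \<notin> B"
    then have "B \<inter> insert C X = B \<inter> X" by blast
    then show False using c lt by simp
  qed
  then have "B \<inter> insert C X = insert C (B \<inter> X)" by blast
  then have "card (B \<inter> insert C X) \<le> card (B \<inter> X) + 1" by (simp add: card_insert_if finX)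
  then show "card (B \<inter> X) + 1 = t" using c lt by simp
qed

lemma missing_block:
  assumes "B \<in> G0" "card (B \<inter> X) + 1 = t"
  obtains Y where "Y \<in> X" "Y \<notin> B" "X - {Y} \<subseteq> B" "B \<inter> X = X - {Y}"
proof -
  have "card (X - B) = 1"
    using card_Diff_subset_Int[of X B] assms(2) finX cardX by (simp add: Int_commute)
  then obtain Y where "X - B = {Y}" by (rule card_1_singletonE)
  then show ?thesis using that[of Y] by blast
qed

lemma X_block:
  assumes "Y \<in> X"
  shows "Y \<subseteq> {1..n}" "Y \<noteq> {}" "\<And>Z. Z \<in> X \<Longrightarrow> Z \<noteq> Y \<Longrightarrow> Z \<inter> Y = {}"
proof -
  obtain A where A: "A \<in> F" using F_ne by blast
  then have A': "A \<in> Parts n k" "X \<subseteq> A" using F_sub X_sub by blast+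
  show "Y \<subseteq> {1..n}" "Y \<noteq> {}" using PartsD(4,5)[OF A'(1)] A'(2) assms by blast+
  show "Z \<inter> Y = {}" if "Z \<in> X" "Z \<noteq> Y" for Z
    using PartsD(6)[OF A'(1)] A'(2) assms that by blast
qed

text \<open>The points of a missing block Y must be covered by B, and other blocks of X are disjoint
  from Y.\<close>

lemma meeting_block:
  assumes "B \<in> G0" "Y \<in> X" "Y \<notin> B"
  obtains D where "D \<in> B" "D \<notin> X" "D \<inter> Y \<noteq> {}"
proof -
  have B: "B \<in> Parts n l" using assms(1) G_sub by blast
  obtain y where y: "y \<in> Y" using X_block(2)[OF assms(2)] by blast
  then have "y \<in> \<Union> B" using PartsD(4)[OF B] X_block(1)[OF assms(2)] by blast
  then obtain D where D: "D \<in> B" "y \<in> D" by blast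
  then have "D \<inter> Y \<noteq> {}" using y by blast
  moreover have "D \<notin> X" using X_block(3)[OF assms(2), of D] D assms(3) \<open>D \<inter> Y \<noteq> {}\<close> by blast
  ultimately show ?thesis using that D by blast
qed

lemma card_B_minus_X:
  assumes "B \<in> G0" "card (B \<inter> X) + 1 = t"
  shows "card (B - X) = L + 1" "finite (B - X)"
proof -
  have B: "card B = l" "finite B" using assms(1) G_sub PartsD(2,3) by blast+
  then show "finite (B - X)" by simp
  have "card (B - X) = card B - card (B \<inter> X)" using B card_Diff_subset_Int[of B X] by simp
  then show "card (B - X) = L + 1" using B(1) assms(2) l_ge by linarith
qed

text \<open>B has L + 1 blocks outside X, and the one meeting the missing Y is not in CC.\<close>

lemma CC_bounded:
  assumes "CC \<noteq> {}" "B \<in> G0"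
  shows "finite CC" "card CC \<le> L" "CC \<subseteq> B - X"
proof -
  have one: "card (B \<inter> X) + 1 = t" using CC_G0(2) assms by blast
  obtain Y where Y: "Y \<in> X" "Y \<notin> B" using missing_block[OF assms(2) one] by metis
  obtain D where D: "D \<in> B" "D \<notin> X" "D \<inter> Y \<noteq> {}" using meeting_block[OF assms(2) Y] by metis
  show sub: "CC \<subseteq> B - X" using CC_G0(1)[OF _ assms(2)] CC_D(1) by blast
  show "finite CC" using finite_subset[OF sub] card_B_minus_X(2)[OF assms(2) one] by blast
  have "D \<notin> CC" using CC_D(2)[OF _ Y(1)] D(3) by blast
  then have "CC \<subseteq> B - X - {D}" using sub by blast
  then have "card CC \<le> card (B - X - {D})"
    using card_B_minus_X(2)[OF assms(2) one] by (intro card_mono) auto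
  also have "\<dots> = L" using D card_B_minus_X[OF assms(2) one] by simp
  finally show "card CC \<le> L" .
qed

text \<open>Either X with C is no t-cover of G and one more branching is possible, or C meets a
  block of X and no partition contains both.\<close>

lemma FX_not_CC:
  assumes "C \<notin> X" "C \<notin> CC" "3 \<le> K"
  shows "card (FX (insert C X)) \<le> (L + 1) * a (t + 2)"
proof (cases "\<forall>Y\<in>X. C \<inter> Y = {}")
  case True
  then obtain B where B: "B \<in> G" "card (B \<inter> insert C X) < t" using assms(1,2) unfolding CC_def by force
  have c: "card (insert C X) = t + 1" "finite (insert C X)" using finX cardX assms(1) by auto
  have "t + 1 + 1 < k" using assms(3) by simp
  from branch_bound[OF B c(2,1) this] show ?thesis by simp
next
  case False
  then obtain Y where Y: "Y \<in> X" "C \<inter> Y \<noteq> {}" by blast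
  have no: False if "A \<in> FX (insert C X)" for A
  proof -
    from that have "A \<in> F" and s: "insert C X \<subseteq> A" by simp_all
    then have "A \<in> Parts n k" using F_sub by blast
    from PartsD(6)[OF this, of C Y] show False using s Y assms(1) by blast
  qed
  have "FX (insert C X) = {}" using no by (meson equals0I)
  then show ?thesis by (simp only: card.empty)
qed

lemma hit_B_minus_X:
  assumes "A \<in> F" "B \<in> G0"
  shows "A \<inter> (B - X) \<noteq> {}"
proof
  assume "A \<inter> (B - X) = {}"
  then have "A \<inter> B \<subseteq> B \<inter> X" by blast
  then have "card (A \<inter> B) \<le> card (B \<inter> X)" using finX by (intro card_mono) auto
  then show False using G0_card[OF assms(2)] crossD[OF assms(1)] assms(2) by fastforce
qed

text \<open>Branching over the L + 1 blocks of a member of G0 outside X; all of CC is among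
  them.\<close>

lemma card_F_le_CC:
  assumes "CC \<noteq> {}" "3 \<le> K"
  shows "card F \<le> card CC * \<alpha> + (L + 1 - card CC) * ((L + 1) * a (t + 2))"
proof -
  obtain B where B: "B \<in> G0" using G0_ne by blast
  have one: "card (B \<inter> X) + 1 = t" using CC_G0(2) assms(1) B by blast
  let ?W = "B - X" and ?m = "\<lambda>C. if C \<in> CC then \<alpha> else (L + 1) * a (t + 2)"
  have "card (FX X) \<le> (\<Sum>C\<in>?W. ?m C)"
  proof (rule card_FX_branch)
    show "finite ?W" by (rule card_B_minus_X[OF B one])
    show "A \<inter> ?W \<noteq> {}" if "A \<in> FX X" for A using hit_B_minus_X[OF _ B] that by simp
    show "card (FX (insert C X)) \<le> ?m C" if "C \<in> ?W" for C
      using FX_le[of "insert C X" "t + 1"] FX_not_CC[of C] that finX cardX k_ge assms(2) by auto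
  qed
  also have "\<dots> = card (?W \<inter> CC) * \<alpha> + card (?W - CC) * ((L + 1) * a (t + 2))"
    using card_B_minus_X(2)[OF B one]
    by (simp add: sum.If_cases Collect_mem_eq Diff_eq)
  also have "?W \<inter> CC = CC" using CC_bounded(3)[OF assms(1) B] by blast
  also have "card (?W - CC) = L + 1 - card CC"
    using CC_bounded[OF assms(1) B] card_B_minus_X[OF B one] by (simp add: card_Diff_subset)
  finally show ?thesis using F_eq_FX by simp
qed

lemma card_G_le_G0:
  assumes "finite S" "\<And>Z. Z \<in> S \<Longrightarrow> card Z = t + 1" "\<And>B. B \<in> G0 \<Longrightarrow> \<exists>Z\<in>S. Z \<subseteq> B"
  shows "card G \<le> \<beta> + card S * \<beta>1"
proof -
  let ?U = "\<Union>Z\<in>S. {B \<in> G. Z \<subseteq> B}"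
  have "G \<subseteq> {B \<in> G. X \<subseteq> B} \<union> ?U" using assms(3) by blast
  then have "card G \<le> card ({B \<in> G. X \<subseteq> B} \<union> ?U)" using assms(1) by (intro card_mono) auto
  also have "\<dots> \<le> card {B \<in> G. X \<subseteq> B} + card ?U" by (rule card_Un_le)
  also have "card ?U \<le> (\<Sum>Z\<in>S. card {B \<in> G. Z \<subseteq> B})" using assms(1) by (rule card_UN_le)
  also have "\<dots> \<le> (\<Sum>Z\<in>S. \<beta>1)" using assms(2) l_ge by (intro sum_mono GX_le) auto
  also have "card {B \<in> G. X \<subseteq> B} \<le> \<beta>" using cardX l_ge by (intro GX_le) auto
  finally show ?thesis by simp
qed

lemma R_\<alpha>2: "R * a (t + 2) \<le> \<alpha>" using a_ratio[of "t + 1"] k_ge by simp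

text \<open>Here u / R and v / R are the sizes relative to \<open>\<alpha>\<close> and
  \<open>\<beta>\<close>; scaling by R keeps the comparison with the benchmarks in the natural
  numbers.\<close>

lemma scaled:
  assumes "card F \<le> f" "card G \<le> g" "R * f \<le> u * \<alpha>" "R * g \<le> v * \<beta>"
  shows "R * R * (card F * card G) \<le> u * v * (\<alpha> * \<beta>)"
proof -
  have "R * R * (card F * card G) = (R * card F) * (R * card G)" by (simp only: mult_ac)
  also have "\<dots> \<le> (R * f) * (R * g)" by (rule mult_le_mono[OF mult_le_mono2[OF assms(1)] mult_le_mono2[OF assms(2)]])
  also have "\<dots> \<le> (u * \<alpha>) * (v * \<beta>)" by (rule mult_le_mono[OF assms(3,4)])
  finally show ?thesis by (simp only: mult_ac)
qed

lemma CD_scaled: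
  assumes "R * R * (card F * card G) \<le> w * (\<alpha> * \<beta>)"
  shows "T * (R * R) \<le> w + t * R"
proof -
  have "T * (R * R) * (\<alpha> * \<beta>) = R * R * (T * (\<alpha> * \<beta>))" by (simp only: mult_ac)
  also have "\<dots> \<le> R * R * (card F * card G + t * (\<alpha> * \<beta>1))" by (rule mult_le_mono2[OF CD_lower])
  also have "\<dots> = R * R * (card F * card G) + t * R * (\<alpha> * (R * \<beta>1))" by (simp only: distrib_left mult_ac)
  also have "\<dots> \<le> w * (\<alpha> * \<beta>) + t * R * (\<alpha> * \<beta>)" by (rule add_mono[OF assms mult_le_mono2[OF mult_le_mono2[OF R_\<beta>1]]])
  also have "\<dots> = (w + t * R) * (\<alpha> * \<beta>)" by (simp only: add_mult_distrib)
  finally show ?thesis unfolding mult_le_cancel2 using mult_pos_pos[OF \<alpha>_pos \<beta>_pos] by blast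
qed

text \<open>The multiplier c clears a denominator: it is 2 when a branch is halved and 1
  otherwise.\<close>

lemma AB_scaled:
  assumes "c * (R * R * (card F * card G)) \<le> w * (\<alpha> * \<beta>)" "3 \<le> K"
  shows "c * (L * (R * R)) \<le> w + c * (L * L * R)"
proof -
  have "c * (L * (R * R)) * (\<alpha> * \<beta>) = c * (R * R * (L * (\<alpha> * \<beta>)))" by (simp only: mult_ac)
  also have "\<dots> \<le> c * (R * R * (card F * card G + L * L * (a (t + 2) * \<beta>)))"
    by (rule mult_le_mono2[OF mult_le_mono2[OF AB_lower[OF assms(2)]]])
  also have "\<dots> = c * (R * R * (card F * card G)) + c * (L * L * R) * ((R * a (t + 2)) * \<beta>)" by (simp only: distrib_left mult_ac)
  also have "\<dots> \<le> w * (\<alpha> * \<beta>) + c * (L * L * R) * (\<alpha> * \<beta>)"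
    by (rule add_mono[OF assms(1) mult_le_mono2[OF mult_le_mono1[OF R_\<alpha>2]]])
  also have "\<dots> = (w + c * (L * L * R)) * (\<alpha> * \<beta>)" by (simp only: add_mult_distrib)
  finally show ?thesis unfolding mult_le_cancel2 using mult_pos_pos[OF \<alpha>_pos \<beta>_pos] by blast
qed

lemma R_big: "4 * t * Q\<^sup>2 < R" "T * T * Q\<^sup>2 < R"
proof -
  have R: "R = T * T * Q\<^sup>2 + 1" by (simp only: R_def q_def power2_eq_square mult_ac)
  then show "T * T * Q\<^sup>2 < R" by simp
  have "4 * t \<le> T * T"
  proof -
    obtain s where "t = Suc s" using t1 by (cases t) auto
    then show ?thesis unfolding T_def by (simp only: \<open>t = Suc s\<close>) (simp add: algebra_simps)
  qed
  then have le: "4 * t * Q\<^sup>2 \<le> T * T * Q\<^sup>2" by (rule mult_right_mono) simp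
  then show "4 * t * Q\<^sup>2 < R" using R by linarith
qed

lemma case_CC_empty:
  assumes "CC = {}" "3 \<le> K" "card G \<le> T * \<beta>"
  shows False
proof -
  obtain B where B: "B \<in> G" "B \<in> G0" using G0_ne by blast
  have "card (FX X) \<le> (L + 1) * ((L + 1) * a (t + 2))"
    by (rule branch_step[OF B(1) G0_card[OF B(2)] finX]) (rule FX_not_CC, simp_all only: assms empty_iff not_False_eq_True)
  also have "\<dots> \<le> Q * (Q * a (t + 2))" by (rule mult_le_mono[OF LQ mult_le_mono1[OF LQ]])
  finally have F: "card F \<le> Q * (Q * a (t + 2))" using F_eq_FX by simp
  have "R * (card F * card G) \<le> R * ((Q * (Q * a (t + 2))) * (T * \<beta>))"
    by (rule mult_le_mono2[OF mult_le_mono[OF F assms(3)]])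
  also have "\<dots> = Q * Q * T * ((R * a (t + 2)) * \<beta>)" by (simp only: mult_ac)
  also have "\<dots> \<le> Q * Q * T * (\<alpha> * \<beta>)" by (rule mult_le_mono2[OF mult_le_mono1[OF R_\<alpha>2]])
  also have "\<dots> \<le> T * q\<^sup>2 * (\<alpha> * \<beta>)"
  proof -
    have "Q * Q * T \<le> T * q\<^sup>2"
    proof -
      have "Q \<le> q" using T_ge by (simp add: q_def)
      then have "T * (Q * Q) \<le> T * (q * q)" by (intro mult_le_mono2 mult_le_mono)
      then show ?thesis by (simp add: power2_eq_square mult_ac)
    qed
    then show ?thesis by (rule mult_le_mono1)
  qed
  finally show False by (rule contra_high)
qed

text \<open>The non-singleton uses one more point, and with K - 1 >= 2 free blocks that point is
  worth a factor 2. For K = 2 nothing would be gained.\<close>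

lemma halve:
  assumes "card Z = t + 1" "B \<in> Z" "card B \<noteq> 1" "3 \<le> K"
  shows "2 * card (FX Z) \<le> \<alpha>"
proof -
  have "FX Z \<subseteq> famC n k Z" using F_sub by (auto simp: famC_def)
  then have "card (FX Z) \<le> card (famC n k Z)" by (intro card_mono) auto
  also have "\<dots> \<le> Stirling (n - (t + 1) - 1) (k - (t + 1))"
    using assms k_ge by (intro card_famC_nonsingle_le) auto
  finally have "2 * card (FX Z) \<le> 2 ^ 1 * Stirling (n - (t + 1) - 1) (k - (t + 1))" by simp
  also have "\<dots> \<le> Stirling (n - (t + 1) - 1 + 1) (k - (t + 1))"
    using assms(4) by (intro two_power_Stirling_le) auto
  also have "n - (t + 1) - 1 + 1 = n - (t + 1)" using n_gt by (simp add: T_def)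
  finally show ?thesis .
qed

text \<open>A member of G0 contains C, all of X but one block, and, since it meets A outside X, a
  further block of A, which is not C. These t + 1 blocks can be chosen in at most t * Q
  ways.\<close>

lemma card_G_le_avoid:
  assumes "C \<in> CC" "A \<in> F" "C \<notin> A"
  shows "card G \<le> \<beta> + t * Q * \<beta>1"
proof -
  have PA: "A \<in> Parts n k" using assms(2) F_sub by blast
  define g where "g p = insert C (insert (snd p) (X - {fst p}))" for p :: "block \<times> block"
  define S where "S = g ` (X \<times> (A - X))"
  have fin: "finite (X \<times> (A - X))" using finX PartsD(3)[OF PA] by simp
  have "card G \<le> \<beta> + card S * \<beta>1"
  proof (rule card_G_le_G0)
    show "finite S" using fin by (simp add: S_def)
    show "card Z = t + 1" if Z: "Z \<in> S" for Z
    proof -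
      obtain p where p: "p \<in> X \<times> (A - X)" "Z = g p" using Z unfolding S_def by (rule imageE)
      have YE: "fst p \<in> X" "snd p \<in> A" "snd p \<notin> X" using p(1) by auto
      have "C \<notin> X" using CC_D(1) assms(1) by blast
      moreover have "C \<noteq> snd p" using assms(3) YE by blast
      ultimately have "card (g p) = Suc (Suc (card (X - {fst p})))"
        using finX YE(3) unfolding g_def by simp
      then show ?thesis using p(2) YE(1) finX cardX t1 by (simp add: card_Diff_singleton)
    qed
    show "\<exists>Z\<in>S. Z \<subseteq> B" if B: "B \<in> G0" for B
    proof -
      have C: "C \<in> B" "card (B \<inter> X) + 1 = t" using CC_G0[OF assms(1) B] by simp_all
      obtain Y where Y: "Y \<in> X" "X - {Y} \<subseteq> B" using missing_block[OF B C(2)] by metis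
      obtain E where E: "E \<in> A" "E \<in> B" "E \<notin> X" using hit_B_minus_X[OF assms(2) B] by blast
      have "g (Y, E) \<in> S" unfolding S_def using Y E by (intro imageI) simp
      moreover have "g (Y, E) \<subseteq> B" using Y(2) E(2) C(1) by (simp add: g_def)
      ultimately show ?thesis by (rule bexI[rotated])
    qed
  qed
  also have "card S \<le> t * Q"
  proof -
    have "card S \<le> card (X \<times> (A - X))" unfolding S_def using fin by (rule card_image_le)
    also have "\<dots> = t * K"
      using cardX finX X_sub[OF assms(2)] PartsD(2)[OF PA] by (simp add: card_cartesian_product card_Diff_subset)
    also have "\<dots> \<le> t * Q" using KQ by (intro mult_le_mono2) simp
    finally show ?thesis .
  qed
  finally show ?thesis by (simp only: mult_le_mono1 add_left_mono)
qed

text \<open>The leading coefficient is 1 against T = t + 1, and all other terms together are at most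
  4 * t * Q^2 * R < R^2.\<close>

lemma single_numeric:
  "(R + Q * Q) * (R + t * Q) + t * R < T * (R * R)"
proof -
  have Q1: "1 * Q \<le> Q * Q" "1 * 1 \<le> Q * Q" using Q_ge by (intro mult_le_mono; simp)+
  have "Q * Q + t * Q + t \<le> 3 * (t * (Q * Q))"
  proof -
    have "1 * (Q * Q) \<le> t * (Q * Q)" using t1 by (rule mult_le_mono1)
    moreover have "t * Q \<le> t * (Q * Q)" using Q1 by (intro mult_le_mono2) simp
    moreover have "t * 1 \<le> t * (Q * Q)" using Q1 by (intro mult_le_mono2) simp
    ultimately show ?thesis by linarith
  qed
  then have 1: "R * (Q * Q + t * Q + t) \<le> R * (3 * (t * (Q * Q)))" by (rule mult_le_mono2)
  have "Q \<le> q" using T_ge by (simp add: q_def)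
  then have "Q \<le> R" using q_le_R by linarith
  then have 2: "Q * (t * (Q * Q)) \<le> R * (t * (Q * Q))" by (rule mult_le_mono1)
  have "4 * (t * (Q * Q)) < R" using R_big(1) by (simp only: power2_eq_square mult.assoc)
  moreover have "0 < R" using R_gt by linarith
  ultimately have "R * (4 * (t * (Q * Q))) < R * R" by (rule mult_strict_left_mono)
  moreover have "1 * (R * R) \<le> t * (R * R)" using t1 by (rule mult_le_mono1)
  ultimately have 3: "R * (4 * (t * (Q * Q))) < t * (R * R)" by linarith
  have "(R + Q * Q) * (R + t * Q) + t * R = R * R + R * (Q * Q + t * Q + t) + Q * (t * (Q * Q))"
    by (simp add: algebra_simps)
  moreover have "T * (R * R) = t * (R * R) + R * R" by (simp add: T_def)
  moreover have "R * (4 * (t * (Q * Q))) = R * (3 * (t * (Q * Q))) + R * (t * (Q * Q))"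
    by (simp add: algebra_simps)
  ultimately show ?thesis using 1 2 3 by linarith
qed

lemma CD_double:
  assumes "2 * (card F * card G) \<le> T * (\<alpha> * \<beta>)"
  shows "T * (\<alpha> * \<beta>) \<le> 2 * (t * (\<alpha> * \<beta>1))"
proof -
  have "u \<le> 2 * v" if "2 * p \<le> u" "u \<le> p + v" for u v p :: nat using that by linarith
  from this[OF assms CD_lower] show ?thesis .
qed

text \<open>If a member of F avoids C, the product drops to about \<open>\<alpha> * \<beta>\<close>.
  Otherwise all members of F contain the t + 1 blocks of X and C, and a non-singleton among these
  halves F.\<close>

lemma case_CC_single:
  assumes "CC = {C}" "3 \<le> K" "card G \<le> T * \<beta>"
  shows isCD
proof (cases "\<forall>A\<in>F. C \<in> A")
  case False
  then obtain A where A: "A \<in> F" "C \<notin> A" by blast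
  have G: "card G \<le> \<beta> + t * Q * \<beta>1" by (rule card_G_le_avoid[OF _ A]) (simp add: assms(1))
  have "card F \<le> card CC * \<alpha> + (L + 1 - card CC) * ((L + 1) * a (t + 2))"
    by (rule card_F_le_CC[OF _ assms(2)]) (simp add: assms(1))
  moreover have "card CC = 1" by (simp add: assms(1))
  ultimately have "card F \<le> \<alpha> + L * ((L + 1) * a (t + 2))" by (simp only: mult_1 add_diff_cancel_right')
  also have "\<dots> \<le> \<alpha> + Q * (Q * a (t + 2))"
    by (rule add_left_mono[OF mult_le_mono[OF _ mult_le_mono1[OF LQ]]]) (use LQ in linarith)
  finally have F: "card F \<le> \<alpha> + Q * (Q * a (t + 2))" .
  have "R * R * (card F * card G) \<le> (R + Q * Q) * (R + t * Q) * (\<alpha> * \<beta>)"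
  proof (rule scaled[OF F G])
    have "R * (\<alpha> + Q * (Q * a (t + 2))) = R * \<alpha> + Q * Q * (R * a (t + 2))" by (simp only: distrib_left mult_ac)
    also have "\<dots> \<le> R * \<alpha> + Q * Q * \<alpha>" by (rule add_left_mono[OF mult_le_mono2[OF R_\<alpha>2]])
    finally show "R * (\<alpha> + Q * (Q * a (t + 2))) \<le> (R + Q * Q) * \<alpha>" by (simp only: add_mult_distrib)
    have "R * (\<beta> + t * Q * \<beta>1) = R * \<beta> + t * Q * (R * \<beta>1)" by (simp only: distrib_left mult_ac)
    also have "\<dots> \<le> R * \<beta> + t * Q * \<beta>" by (rule add_left_mono[OF mult_le_mono2[OF R_\<beta>1]])
    finally show "R * (\<beta> + t * Q * \<beta>1) \<le> (R + t * Q) * \<beta>" by (simp only: add_mult_distrib)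
  qed
  then have "T * (R * R) \<le> (R + Q * Q) * (R + t * Q) + t * R" by (rule CD_scaled)
  then show ?thesis using single_numeric by simp
next
  case True
  let ?T0 = "insert C X"
  have T0: "finite ?T0" "card ?T0 = t + 1" using CC_D(1)[of C] assms(1) finX cardX by auto
  have TF: "?T0 \<subseteq> A" if "A \<in> F" for A using that True X_sub by blast
  show ?thesis
  proof (cases "\<forall>Z\<in>?T0. card Z = 1")
    case True
    show ?thesis
      using CC_D(3)[of C] assms(1) True by (intro CD_if_contained[OF T0 TF]) auto
  next
    case False
    then obtain Z where Z: "Z \<in> ?T0" "card Z \<noteq> 1" by blast
    have "FX ?T0 = F" using TF by blast
    then have "2 * card F \<le> \<alpha>" using halve[OF T0(2) Z assms(2)] by simp
    then have "2 * card F * card G \<le> \<alpha> * (T * \<beta>)" using assms(3) by (rule mult_le_mono)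
    also have "\<dots> = T * (\<alpha> * \<beta>)" by (simp only: mult_ac)
    finally have "T * (\<alpha> * \<beta>) \<le> 2 * (t * (\<alpha> * \<beta>1))"
      unfolding mult.assoc by (rule CD_double)
    then have "\<alpha> * (T * \<beta>) \<le> \<alpha> * (2 * t * \<beta>1)" by (simp only: mult_ac)
    then have 1: "T * \<beta> \<le> 2 * t * \<beta>1" unfolding mult_le_cancel1 using \<alpha>_pos by blast
    have "2 * t * \<beta>1 < T * R * \<beta>1"
    proof (rule mult_strict_right_mono[OF _ \<beta>1_pos])
      have "t * 2 < T * 2" by (simp add: T_def)
      also have "\<dots> \<le> T * R" using R_gt by (intro mult_le_mono2) simp
      finally show "2 * t < T * R" by simp
    qed
    also have "\<dots> \<le> T * \<beta>" unfolding mult.assoc by (rule mult_le_mono2[OF R_\<beta>1])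
    finally show ?thesis using 1 by (simp only: not_less)
  qed
qed

text \<open>A member of G missing Y from X contains C1, C2 and X - {Y}, so only t sets of t + 1
  blocks occur.\<close>

lemma card_G_le_two:
  assumes "C1 \<in> CC" "C2 \<in> CC" "C1 \<noteq> C2"
  shows "card G \<le> \<beta> + t * \<beta>1"
proof -
  define g where "g Y = insert C1 (insert C2 (X - {Y}))" for Y
  have "card G \<le> \<beta> + card (g ` X) * \<beta>1"
  proof (rule card_G_le_G0)
    show "finite (g ` X)" using finX by simp
    show "card Z = t + 1" if Z: "Z \<in> g ` X" for Z
    proof -
      obtain Y where Y: "Y \<in> X" "Z = g Y" using Z by (rule imageE)
      have "C1 \<notin> X" "C2 \<notin> X" using CC_D(1) assms by simp_all
      then have "card (g Y) = Suc (Suc (card (X - {Y})))"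
        using finX assms(3) unfolding g_def by simp
      then show ?thesis using Y finX cardX t1 by (simp add: card_Diff_singleton)
    qed
    show "\<exists>Z\<in>g ` X. Z \<subseteq> B" if B: "B \<in> G0" for B
    proof -
      have C: "C1 \<in> B" "C2 \<in> B" "card (B \<inter> X) + 1 = t"
        using CC_G0[OF assms(1) B] CC_G0[OF assms(2) B] by simp_all
      obtain Y where Y: "Y \<in> X" "X - {Y} \<subseteq> B" using missing_block[OF B C(3)] by metis
      have "g Y \<subseteq> B" using Y(2) C by (simp add: g_def)
      then show ?thesis using Y(1) by (rule bexI[OF _ imageI])
    qed
  qed
  also have "card (g ` X) \<le> t" using card_image_le[OF finX, of g] cardX by simp
  finally show ?thesis by (simp only: mult_le_mono1 add_left_mono)
qed

lemma R_\<beta>_\<beta>1: "R * (\<beta> + t * \<beta>1) \<le> (R + t) * \<beta>"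
proof -
  have "R * (\<beta> + t * \<beta>1) = R * \<beta> + t * (R * \<beta>1)" by (simp only: distrib_left mult_ac)
  also have "\<dots> \<le> R * \<beta> + t * \<beta>" by (rule add_left_mono[OF mult_le_mono2[OF R_\<beta>1]])
  finally show ?thesis by (simp only: add_mult_distrib)
qed

lemma tQQ: "Q * t \<le> t * (Q * Q)" "Q * Q \<le> t * (Q * Q)" "L * L \<le> t * (Q * Q)" "4 * (t * (Q * Q)) < R"
proof -
  show "Q * t \<le> t * (Q * Q)" using Q_ge by simp
  show 1: "Q * Q \<le> t * (Q * Q)" using t1 by simp
  have "L \<le> Q" using LQ by linarith
  then have "L * L \<le> Q * Q" by (intro mult_le_mono)
  then show "L * L \<le> t * (Q * Q)" using 1 by (rule le_trans)
  show "4 * (t * (Q * Q)) < R" using R_big(1) by (simp only: power2_eq_square mult.assoc)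
qed

lemma medium_numeric:
  assumes "e \<le> Q * t"
  shows "R * e + R * (Q * Q) + t * (Q * Q) + R * (L * L) < R * R"
proof -
  have R: "0 < R" using R_gt by linarith
  have "e + Q * Q + L * L \<le> 3 * (t * (Q * Q))" using assms tQQ by linarith
  then have 1: "R * (e + Q * Q + L * L) \<le> R * (3 * (t * (Q * Q)))" by (rule mult_le_mono2)
  have 2: "1 * (t * (Q * Q)) \<le> R * (t * (Q * Q))" using R by (intro mult_le_mono1) linarith
  have 3: "R * (4 * (t * (Q * Q))) < R * R" using tQQ(4) R by (rule mult_strict_left_mono)
  have "R * (4 * (t * (Q * Q))) = R * (3 * (t * (Q * Q))) + R * (t * (Q * Q))" by (simp add: algebra_simps)
  then show ?thesis using 1 2 3 unfolding distrib_left by linarith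
qed

text \<open>F has size at most about (L - 1) * \<open>\<alpha>\<close> and G about
  \<open>\<beta>\<close>, which is short of (A, B) by a full \<open>\<alpha> * \<beta>\<close>; the
  lower-order terms do not make up for it.\<close>

lemma case_CC_medium:
  assumes "2 \<le> card CC" "card CC < L" "3 \<le> K"
  shows False
proof -
  have ne: "CC \<noteq> {}" using assms(1) by auto
  obtain C1 C2 where C: "C1 \<in> CC" "C2 \<in> CC" "C1 \<noteq> C2"
    using two_elements[OF assms(1)] by metis
  define c where "c = card CC"
  have "(L + 1 - c) * ((L + 1) * a (t + 2)) \<le> Q * (Q * a (t + 2))"
    by (rule mult_le_mono[OF _ mult_le_mono1[OF LQ]]) (use LQ in linarith)
  moreover have "c * \<alpha> \<le> (L - 1) * \<alpha>" using assms(2) unfolding c_def by (intro mult_le_mono1) linarith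
  ultimately have F: "card F \<le> (L - 1) * \<alpha> + Q * (Q * a (t + 2))"
    using card_F_le_CC[OF ne assms(3)] unfolding c_def[symmetric] by (meson add_mono le_trans)
  define w where "w = ((L - 1) * R + Q * Q) * (R + t)"
  have "R * R * (card F * card G) \<le> w * (\<alpha> * \<beta>)"
    unfolding w_def
  proof (rule scaled[OF F card_G_le_two[OF C] _ R_\<beta>_\<beta>1])
    have "R * ((L - 1) * \<alpha> + Q * (Q * a (t + 2))) = (L - 1) * R * \<alpha> + Q * Q * (R * a (t + 2))"
      by (simp only: distrib_left mult_ac)
    also have "\<dots> \<le> (L - 1) * R * \<alpha> + Q * Q * \<alpha>" by (rule add_left_mono[OF mult_le_mono2[OF R_\<alpha>2]])
    finally show "R * ((L - 1) * \<alpha> + Q * (Q * a (t + 2))) \<le> ((L - 1) * R + Q * Q) * \<alpha>"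
      by (simp only: add_mult_distrib)
  qed
  then have "1 * (R * R * (card F * card G)) \<le> w * (\<alpha> * \<beta>)" by (simp only: mult_1)
  then have AB: "1 * (L * (R * R)) \<le> w + 1 * (L * L * R)" using assms(3) by (rule AB_scaled)
  obtain m where m: "L = Suc m" using KL_ge(2) by (cases L) auto
  have "w = m * (R * R) + R * (m * t) + R * (Q * Q) + t * (Q * Q)"
    unfolding w_def m by (simp add: algebra_simps)
  moreover have "L * (R * R) = m * (R * R) + R * R" unfolding m by simp
  moreover have "R * (m * t) + R * (Q * Q) + t * (Q * Q) + R * (L * L) < R * R"
  proof (rule medium_numeric)
    have "m \<le> Q" using LQ m by linarith
    then show "m * t \<le> Q * t" by (rule mult_le_mono1)
  qed
  moreover have "L * L * R = R * (L * L)" by (rule mult.commute)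
  ultimately show False using AB unfolding mult_1 by linarith
qed

text \<open>X and CC form M. A member of G missing Y contains the other l - 1 blocks of M, so its
  last block is forced, and every member of F has a block in CC.\<close>

lemma case_CC_full:
  assumes "card CC = L" "3 \<le> K"
  shows isAB
proof -
  have ne: "CC \<noteq> {}" using assms(1) KL_ge by auto
  obtain B0 where B0: "B0 \<in> G0" using G0_ne by blast
  have finCC: "finite CC" and CCB0: "CC \<subseteq> B0 - X" using CC_bounded[OF ne B0] by simp_all
  obtain C1 C2 where C: "C1 \<in> CC" "C2 \<in> CC" "C1 \<noteq> C2"
    using two_elements[of CC] assms(1) KL_ge(2) by metis
  let ?M = "X \<union> CC"
  have disj: "X \<inter> CC = {}" using CC_D(1) by blast
  have cM: "card ?M = l" using finX finCC disj cardX assms(1) l_ge by (simp add: card_Un_disjoint)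
  have F_hit: "A \<inter> CC \<noteq> {}" if A: "A \<in> F" for A
  proof
    assume none: "A \<inter> CC = {}"
    \<comment> \<open>Outside X the blocks of B0 are CC and the block D meeting Y. Since A contains
      Y it cannot contain D, so it shares a block of CC with B0.\<close>
    have one: "card (B0 \<inter> X) + 1 = t" using CC_G0(2) C(1) B0 by blast
    obtain Y where Y: "Y \<in> X" "Y \<notin> B0" using missing_block[OF B0 one] by metis
    obtain D where D: "D \<in> B0" "D \<notin> X" "D \<inter> Y \<noteq> {}" using meeting_block[OF B0 Y] by metis
    have DC: "D \<notin> CC" using CC_D(2)[OF _ Y(1)] D(3) by blast
    have "card (B0 - X - {D}) = card CC"
      using card_B_minus_X[OF B0 one] D assms(1) by simp
    moreover have "CC \<subseteq> B0 - X - {D}" using CCB0 DC by blast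
    ultimately have eq: "CC = B0 - X - {D}"
      using card_B_minus_X(2)[OF B0 one] by (intro card_subset_eq) auto
    obtain E where E: "E \<in> A" "E \<in> B0" "E \<notin> X" using hit_B_minus_X[OF A B0] by blast
    then have "E = D" using none eq by blast
    have "A \<in> Parts n k" using A F_sub by blast
    moreover have "Y \<in> A" using X_sub[OF A] Y(1) by blast
    moreover have "D \<noteq> Y" using D(1) Y(2) by blast
    ultimately show False using PartsD(6)[of A n k D Y] E(1) D(3) \<open>E = D\<close> by simp
  qed
  have G_le: "card G \<le> \<beta> + t * \<beta>1" by (rule card_G_le_two[OF C])
  show ?thesis
  proof (cases "\<forall>Z\<in>?M. card Z = 1")
    case False
    then obtain Z where Z: "Z \<in> ?M" "card Z \<noteq> 1" by blast
    \<comment> \<open>A non-singleton of X lies in every branch, one of CC only in its own. Halving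
      a single branch is enough: it leaves L - 1/2 against L.\<close>
    obtain C' where C': "C' \<in> CC" "Z \<in> insert C' X" using Z(1) C(1) by blast
    define h where "h = card (FX (insert C' X))"
    have cin: "card (insert C X) = t + 1" if "C \<in> CC" for C using CC_D(1)[OF that] finX cardX by simp
    have h: "2 * h \<le> \<alpha>" unfolding h_def by (rule halve[OF cin[OF C'(1)] C'(2) Z(2) assms(2)])
    have "card (FX X) \<le> (\<Sum>C\<in>CC. if C = C' then h else \<alpha>)"
    proof (rule card_FX_branch[OF finCC])
      show "A \<inter> CC \<noteq> {}" if "A \<in> FX X" for A using F_hit that by simp
      show "card (FX (insert C X)) \<le> (if C = C' then h else \<alpha>)" if "C \<in> CC" for C
      proof (cases "C = C'")
        case True then show ?thesis by (simp add: h_def)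
      next
        case False
        have "card (FX (insert C X)) \<le> \<alpha>" by (rule FX_le[OF cin[OF that]]) (use k_ge in linarith)
        then show ?thesis using False by simp
      qed
    qed
    also have "\<dots> = h + (\<Sum>C\<in>CC - {C'}. \<alpha>)"
      by (subst sum.remove[OF finCC C'(1)]) (simp cong: sum.cong_simp)
    also have "\<dots> = h + (L - 1) * \<alpha>" using C'(1) assms(1) by simp
    finally have "card F \<le> h + (L - 1) * \<alpha>" using F_eq_FX by (simp only:)
    then have "2 * card F \<le> 2 * h + 2 * ((L - 1) * \<alpha>)" by (simp only: mult_le_mono2 flip: distrib_left)
    also have "\<dots> \<le> \<alpha> + 2 * ((L - 1) * \<alpha>)" using h by (rule add_right_mono)
    finally have F2: "2 * card F \<le> \<alpha> + 2 * ((L - 1) * \<alpha>)" .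
    obtain m where m: "L = Suc m" using KL_ge(2) by (cases L) auto
    have F2': "2 * card F \<le> (2 * m + 1) * \<alpha>" using F2 unfolding m by (simp add: algebra_simps)
    have "2 * (R * R * (card F * card G)) = R * (2 * card F) * (R * card G)" by (simp only: mult_ac)
    also have "\<dots> \<le> R * ((2 * m + 1) * \<alpha>) * (R * (\<beta> + t * \<beta>1))"
      by (rule mult_le_mono[OF mult_le_mono2[OF F2'] mult_le_mono2[OF G_le]])
    also have "\<dots> \<le> R * ((2 * m + 1) * \<alpha>) * ((R + t) * \<beta>)" by (rule mult_le_mono2[OF R_\<beta>_\<beta>1])
    also have "\<dots> = (R * (2 * m + 1) * (R + t)) * (\<alpha> * \<beta>)" by (simp only: mult_ac)
    finally have "2 * (L * (R * R)) \<le> R * (2 * m + 1) * (R + t) + 2 * (L * L * R)"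
      using assms(2) by (rule AB_scaled)
    then have "R * (2 * (L * R)) \<le> R * ((2 * m + 1) * (R + t) + 2 * (L * L))" by (simp only: distrib_left mult_ac)
    then have "2 * (L * R) \<le> (2 * m + 1) * (R + t) + 2 * (L * L)" using R_gt unfolding mult_le_cancel1 by linarith
    then have "R \<le> (2 * m + 1) * t + 2 * (L * L)" unfolding m by (simp add: algebra_simps)
    also have "\<dots> \<le> 2 * (Q * t) + 2 * (L * L)"
    proof -
      have "2 * m + 1 \<le> 2 * Q" using LQ m by linarith
      then have "(2 * m + 1) * t \<le> 2 * Q * t" by (rule mult_le_mono1)
      then show ?thesis by simp
    qed
    also have "\<dots> < R" using tQQ by linarith
    finally show ?thesis by simp
  next
    case True
    define I J where "I = \<Union> X" and "J = \<Union> ?M"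
    have XI: "X = sing I" unfolding I_def by (rule all_card_1_eq_sing) (use True in blast)
    have MJ: "?M = sing J" unfolding J_def by (rule all_card_1_eq_sing) (use True in blast)
    have IJ: "I \<subseteq> J" by (auto simp: I_def J_def)
    have PB0: "B0 \<in> Parts n l" using B0 G_sub by blast
    have "\<Union> CC \<subseteq> {1..n}" using CCB0 PartsD(4)[OF PB0] by blast
    moreover have "\<Union> X \<subseteq> {1..n}" using X_block(1) by blast
    ultimately have Jn: "J \<subseteq> {1..n}" by (auto simp: J_def)
    have cJ: "card J = l" and cI: "card I = t" using cM cardX MJ XI by (metis card_sing)+
    have MX: "?M - X = CC" using disj by blast
    have "F \<subseteq> famA n k X ?M" using F_sub X_sub F_hit unfolding famA_def MX by blast
    moreover have "G \<subseteq> famB n l X ?M"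
    proof
      fix B assume B: "B \<in> G"
      have PB: "B \<in> Parts n l" using B G_sub by blast
      show "B \<in> famB n l X ?M"
      proof (cases "X \<subseteq> B")
        case True
        then show ?thesis using PB by (simp add: famB_def)
      next
        case False
        then have BG0: "B \<in> G0" using B by simp
        have one: "card (B \<inter> X) + 1 = t" using CC_G0(2)[OF C(1) BG0] .
        obtain Y where Y: "Y \<in> X" "Y \<notin> B" "X - {Y} \<subseteq> B" using missing_block[OF BG0 one] by metis
        have CB: "CC \<subseteq> B" using CC_G0(1)[OF _ BG0] by blast
        have sub: "?M - {Y} \<subseteq> B" using Y CB by blast
        have "card (B - (?M - {Y})) = card B - card (?M - {Y})"
          using sub finX finCC by (intro card_Diff_subset) auto
        also have "\<dots> = 1" using PartsD(2)[OF PB] cM Y(1) finX finCC l_ge by simp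
        finally obtain D where D: "B - (?M - {Y}) = {D}" by (rule card_1_singletonE)
        have BD: "B = (?M - {Y}) \<union> {D}" using D sub by blast
        have Dn: "D \<in> B" "D \<notin> ?M - {Y}" using D by blast+
        have Dd: "D \<inter> E = {}" if "E \<in> ?M - {Y}" for E
          using PartsD(6)[OF PB Dn(1), of E] sub that Dn(2) by blast
        have UB: "\<Union> (?M - {Y}) \<union> D = {1..n}" 
        proof -
          have "\<Union> B = \<Union> (?M - {Y}) \<union> D" using arg_cong[OF BD, of Union] by (simp only: Union_Un_distrib ccpo_Sup_singleton)
          then show ?thesis using PartsD(4)[OF PB] by simp
        qed
        have YE: "Y \<inter> E = {}" if "E \<in> ?M - {Y}" for E
        proof (cases "E \<in> X")
          case True then show ?thesis using X_block(3)[OF Y(1), of E] that by blast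
        next
          case False
          then have "E \<in> CC" using that by blast
          then show ?thesis using CC_D(2)[OF _ Y(1)] by blast
        qed
        have UM: "\<Union> ?M = Y \<union> \<Union> (?M - {Y})" using Y(1) by blast
        have dd: "D \<inter> \<Union> (?M - {Y}) = {}" "Y \<inter> \<Union> (?M - {Y}) = {}" using Dd YE by blast+
        \<comment> \<open>Replacing Y by D does not affect the other blocks of M, which both avoid;
          so D is the complement of those blocks, namely Y with all points outside M.\<close>
        have cmp: "D' = Y' \<union> (N - (Y' \<union> V))"
          if "V \<union> D' = N" "D' \<inter> V = {}" "Y' \<inter> V = {}" "Y' \<subseteq> N" for V D' N Y' :: "nat set"
          using that by blast
        have "D = Y \<union> ({1..n} - \<Union> ?M)"
          unfolding UM by (rule cmp[OF UB dd X_block(1)[OF Y(1)]])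
        then have "B = (?M - {Y}) \<union> {Y \<union> ({1..n} - \<Union> ?M)}" using BD by (simp only:)
        then show ?thesis using Y(1) unfolding famB_def by blast
      qed
    qed
    moreover have "famA n k X ?M \<subseteq> Parts n k" unfolding famA_def by blast
    ultimately have "F = famA n k X ?M \<and> G = famB n l X ?M"
      by (rule eq_if_sub_valid[OF _ _ _ AB_valid[OF IJ Jn cJ cI, folded MJ, folded XI]])
    then have "F = famA n k (sing I) (sing J) \<and> G = famB n l (sing I) (sing J)"
      by (simp only: XI[symmetric] MJ[symmetric])
    then show ?thesis using IJ Jn cJ cI unfolding isAB_def by blast
  qed
qed

theorem star_large:
  assumes "3 \<le> K"
  shows "isCD \<or> isAB"
proof -
  interpret sw: crossfam n kk t l k G F by (rule swapped)
  obtain D y where D: "finite D" "card D = t + y" "\<And>B. B \<in> G \<Longrightarrow> t \<le> card (B \<inter> D)"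
    "y \<le> K" "noncover (t + y) G" using sw.min_cover by metis
  have G: "card G \<le> (t + y choose t) * \<beta>"
    by (rule sw.cover_bound[OF D(1-3)]) (use GX_le l_ge in auto)
  consider "y = 0" | "y = 1" | "2 \<le> y" by linarith
  then show ?thesis
  proof cases
    case 1
    have "D \<subseteq> B" if "B \<in> G" for B
    proof -
      have "card (B \<inter> D) = card D" using D(3)[OF that] D(1,2) 1 card_mono[of D "B \<inter> D"] by simp
      then have "B \<inter> D = D" using D(1) by (intro card_subset_eq) auto
      then show ?thesis by blast
    qed
    then show ?thesis using no_star_G[OF D(1)] D(2) 1 by simp
  next
    case 2
    then have GT: "card G \<le> T * \<beta>" using G by (simp add: T_def)
    obtain B where B: "B \<in> G0" using G0_ne by blast
    show ?thesis
    proof (cases "CC = {}")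
      case True
      then show ?thesis using case_CC_empty assms GT by blast
    next
      case False
      note bd = CC_bounded[OF False B]
      have "card CC \<noteq> 0" using False bd(1) by simp
      then consider "card CC = 1" | "2 \<le> card CC" "card CC < L" | "card CC = L" using bd(2) by linarith
      then show ?thesis
      proof cases
        case 1
        then obtain C where "CC = {C}" by (rule card_1_singletonE)
        then show ?thesis using case_CC_single assms GT by blast
      qed (use case_CC_medium case_CC_full assms in blast)+
    qed
  next
    case 3
    \<comment> \<open>X itself covers F with excess 0, so the binomial is 1; together with the
      binomial in the bound for G this gives \<open>weight y\<close>, which for y >= 2 leaves a
      factor R.\<close>
    have "card F \<le> (t + 0 choose t) * ((L + 1) ^ min y (K - 1) * a (t + min y (K - 1)))"
      using X_sub cardX finX D(5) by (intro card_F_le[of X 0 y]) (auto simp: Int_absorb1)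
    then have F: "card F \<le> (L + 1) ^ min y (K - 1) * a (t + min y (K - 1))" by simp
    have "R * (card F * card G) \<le> R * (((L + 1) ^ min y (K - 1) * a (t + min y (K - 1))) * ((t + y choose t) * \<beta>))"
      by (rule mult_le_mono2[OF mult_le_mono[OF F G]])
    also have "\<dots> = R * weight y * \<beta>" unfolding weight_def by (simp only: mult_ac)
    also have "\<dots> \<le> T * q\<^sup>2 * \<alpha> * \<beta>"
      using 3 D(4) assms by (intro mult_le_mono1 weight_large(1)) auto
    also have "\<dots> = T * q\<^sup>2 * (\<alpha> * \<beta>)" by (simp only: mult.assoc)
    finally show ?thesis using contra_high by blast
  qed
qed

end


section \<open>The case of two free blocks\<close>

context star
begin

context
  assumes K2: "K = 2"
begin

abbreviation "V \<equiv> {1..n} - \<Union> X"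

lemma k_eq: "k = t + 2" using K2 k_ge by simp

lemma \<alpha>_eq: "\<alpha> = 1"
proof -
  have "n - (t + 1) = Suc (n - t - 2)" using n_gt by (simp add: T_def)
  moreover have "k - (t + 1) = Suc 0" by (simp add: k_eq)
  ultimately show ?thesis by (simp only: Stirling_1 One_nat_def)
qed

lemma CD_small: "T * \<beta> \<le> card F * card G + t * \<beta>1"
  using CD_lower unfolding \<alpha>_eq mult_1 .

lemma card_A_minus_X: "A \<in> F \<Longrightarrow> card (A - X) = 2"
  using F_sub X_sub PartsD(2)[of A n k] finX cardX by (auto simp: card_Diff_subset k_eq)

lemma Union_A_minus_X:
  assumes "A \<in> F"
  shows "\<Union> (A - X) = V"
proof -
  have A: "A \<in> Parts n k" "X \<subseteq> A" using assms F_sub X_sub by blast+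
  have "\<Union> A = \<Union> (A - X) \<union> \<Union> X" using A(2) by blast
  moreover have "\<Union> (A - X) \<inter> \<Union> X = {}" using PartsD(6)[OF A(1)] A(2) by blast
  ultimately show ?thesis using PartsD(4)[OF A(1)] by blast
qed

text \<open>The two blocks of A outside X partition V, so one determines the other.\<close>

lemma A_determined:
  assumes "A \<in> F" "C \<in> A - X"
  shows "A = X \<union> {C, V - C}"
proof -
  have A: "A \<in> Parts n k" "X \<subseteq> A" using assms F_sub X_sub by blast+
  have "card (A - X - {C}) = 1" using card_A_minus_X[OF assms(1)] assms(2) by simp
  then obtain D where D: "A - X - {C} = {D}" by (rule card_1_singletonE)
  then have AX: "A - X = {C, D}" "C \<noteq> D" "D \<in> A" using assms(2) by blast+
  have "C \<inter> D = {}" using PartsD(6)[OF A(1)] AX assms(2) by blast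
  moreover have "C \<union> D = V" using Union_A_minus_X[OF assms(1)] unfolding AX by simp
  ultimately have "D = V - C" by blast
  then have "A - X = {C, V - C}" using AX(1) by (simp only:)
  moreover have "A = X \<union> (A - X)" using A(2) by blast
  ultimately show ?thesis by metis
qed

lemma card_Int_A:
  assumes "A \<in> F"
  shows "card (A \<inter> B) = card (B \<inter> X) + card ((A - X) \<inter> B)"
proof -
  have "A \<inter> B = (B \<inter> X) \<union> ((A - X) \<inter> B)" using X_sub[OF assms] by blast
  moreover have "finite A" using assms F_sub PartsD(3) by blast
  ultimately show ?thesis using finX by (metis (no_types, lifting) Diff_disjoint card_Un_disjoint finite_Diff finite_Int inf.commute inf_assoc inf_bot_right)
qed

text \<open>With two blocks of X missing, B would contain both free blocks of every member of F. The
  free blocks of A1 and A2 cover the same points; two of them that meet coincide as blocks of B, and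
  then A1 = A2.\<close>

lemma two_members_one_missing:
  assumes A: "A1 \<in> F" "A2 \<in> F" "A1 \<noteq> A2" and B: "B \<in> G0"
  shows "card (B \<inter> X) + 1 = t"
proof (rule ccontr)
  assume "card (B \<inter> X) + 1 \<noteq> t"
  then have lt: "card (B \<inter> X) + 1 < t" using G0_card[OF B] by linarith
  have sub: "A - X \<subseteq> B" if "A \<in> F" for A
  proof -
    have fin: "finite (A - X)" using that F_sub PartsD(3) by blast
    have "t \<le> card (B \<inter> X) + card ((A - X) \<inter> B)" using crossD[OF that] B card_Int_A[OF that] by simp
    then have "card (A - X) \<le> card ((A - X) \<inter> B)" using lt card_A_minus_X[OF that] by linarith
    then have "(A - X) \<inter> B = A - X" using fin by (intro card_seteq) auto
    then show ?thesis by blast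
  qed
  have PB: "B \<in> Parts n l" using B G_sub by blast
  have "A1 - X \<noteq> {}" using card_A_minus_X[OF A(1)] by (metis card.empty zero_neq_numeral)
  then obtain C where C: "C \<in> A1 - X" by blast
  have PA1: "A1 \<in> Parts n k" using A(1) F_sub by blast
  have "C \<noteq> {}" using PartsD(5)[OF PA1] C by auto
  then obtain x where x: "x \<in> C" by blast
  then have "x \<in> \<Union> (A2 - X)" using C Union_A_minus_X[OF A(1)] Union_A_minus_X[OF A(2)] by blast
  then obtain C' where C': "C' \<in> A2 - X" "x \<in> C'" by blast
  have "C \<in> B" "C' \<in> B" using sub[OF A(1)] sub[OF A(2)] C C'(1) by blast+
  then have "C = C'" using PartsD(6)[OF PB, of C C'] x C'(2) by blast
  then show False using A_determined[OF A(1) C] A_determined[OF A(2) C'(1)] A(3) by simp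
qed

text \<open>Mapping a member to a block shared with B outside X is injective, as a free block
  determines the member, and its values avoid the block meeting the missing Y.\<close>

lemma two_members_card_F:
  assumes A: "A1 \<in> F" "A2 \<in> F" "A1 \<noteq> A2"
  shows "card F \<le> L"
proof -
  obtain B where B: "B \<in> G0" using G0_ne by blast
  have one: "card (B \<inter> X) + 1 = t" by (rule two_members_one_missing[OF A B])
  obtain Y where Y: "Y \<in> X" "Y \<notin> B" using missing_block[OF B one] by metis
  obtain D where D: "D \<in> B" "D \<notin> X" "D \<inter> Y \<noteq> {}" using meeting_block[OF B Y] by metis
  define h where "h A = (SOME C. C \<in> A \<inter> (B - X))" for A
  have h: "h A \<in> A \<inter> (B - X)" if "A \<in> F" for A
    unfolding h_def by (rule someI_ex) (use hit_B_minus_X[OF that B] in blast)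
  have "inj_on h F"
  proof (rule inj_onI)
    fix A A' assume AA: "A \<in> F" "A' \<in> F" "h A = h A'"
    have "h A \<in> A - X" "h A \<in> A' - X" using h[OF AA(1)] h[OF AA(2)] AA(3) by auto
    then show "A = A'" using A_determined[OF AA(1)] A_determined[OF AA(2)] by metis
  qed
  then have "card F = card (h ` F)" by (simp add: card_image)
  also have "\<dots> \<le> card (B - X - {D})"
  proof (rule card_mono)
    show "finite (B - X - {D})" using card_B_minus_X(2)[OF B one] by simp
    show "h ` F \<subseteq> B - X - {D}"
    proof (rule image_subsetI)
      fix A assume A: "A \<in> F"
      have PA: "A \<in> Parts n k" using A F_sub by blast
      have "D \<notin> A"
        using PartsD(6)[OF PA, of D Y] D(3) X_sub[OF A] Y D(1) by blast
      then show "h A \<in> B - X - {D}" using h[OF A] by auto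
    qed
  qed
  also have "\<dots> = L" using D card_B_minus_X[OF B one] by simp
  finally show ?thesis .
qed

text \<open>A member of G0 contains X minus one block and a free block of each of A1 and A2; these
  differ, and there are 2 * 2 * t choices.\<close>

lemma two_members_card_G:
  assumes A: "A1 \<in> F" "A2 \<in> F" "A1 \<noteq> A2"
  shows "card G \<le> \<beta> + 4 * t * \<beta>1"
proof -
  define g where "g p = insert (fst (snd p)) (insert (snd (snd p)) (X - {fst p}))" for p :: "block \<times> block \<times> block"
  define S where "S = g ` (X \<times> (A1 - X) \<times> (A2 - X))"
  have ne: "C1 \<noteq> C2" if "C1 \<in> A1 - X" "C2 \<in> A2 - X" for C1 C2
    using A_determined[OF A(1) that(1)] A_determined[OF A(2) that(2)] A(3) by metis
  have "finite A1" "finite A2" using A F_sub PartsD(3) by blast+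
  then have fin: "finite (X \<times> (A1 - X) \<times> (A2 - X))" using finX by simp
  have "card G \<le> \<beta> + card S * \<beta>1"
  proof (rule card_G_le_G0)
    show "finite S" using fin by (simp add: S_def)
    show "card Z = t + 1" if Z: "Z \<in> S" for Z
    proof -
      obtain p where p: "p \<in> X \<times> (A1 - X) \<times> (A2 - X)" "Z = g p" using Z unfolding S_def by (rule imageE)
      obtain Y C1 C2 where pe: "p = (Y, C1, C2)" by (cases p)
      have YE: "Y \<in> X" "C1 \<in> A1 - X" "C2 \<in> A2 - X" using p(1) pe by auto
      have "C1 \<notin> X" "C2 \<notin> X" "C1 \<noteq> C2" using YE ne by blast+
      then have "card (g p) = Suc (Suc (card (X - {Y})))"
        using finX unfolding g_def pe by simp
      then show ?thesis using p(2) YE(1) finX cardX t1 by (simp add: card_Diff_singleton)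
    qed
    show "\<exists>Z\<in>S. Z \<subseteq> B" if B: "B \<in> G0" for B
    proof -
      have one: "card (B \<inter> X) + 1 = t" by (rule two_members_one_missing[OF A B])
      obtain Y where Y: "Y \<in> X" "X - {Y} \<subseteq> B" using missing_block[OF B one] by metis
      obtain E1 where E1: "E1 \<in> A1" "E1 \<in> B" "E1 \<notin> X" using hit_B_minus_X[OF A(1) B] by blast
      obtain E2 where E2: "E2 \<in> A2" "E2 \<in> B" "E2 \<notin> X" using hit_B_minus_X[OF A(2) B] by blast
      have "g (Y, E1, E2) \<in> S" unfolding S_def using Y E1 E2 by (intro imageI) simp
      moreover have "g (Y, E1, E2) \<subseteq> B" using Y(2) E1(2) E2(2) by (simp add: g_def)
      ultimately show ?thesis by (rule bexI[rotated])
    qed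
  qed
  also have "card S \<le> 4 * t"
  proof -
    have "card S \<le> card (X \<times> (A1 - X) \<times> (A2 - X))" unfolding S_def using fin by (rule card_image_le)
    also have "\<dots> = 4 * t"
      using cardX card_A_minus_X[OF A(1)] card_A_minus_X[OF A(2)] by (simp add: card_cartesian_product)
    finally show ?thesis .
  qed
  finally show ?thesis by (simp only: mult_le_mono1 add_left_mono)
qed

text \<open>With j = L - 1 >= 2 the ratio of \<open>\<beta>\<close> to \<open>\<beta>1\<close> is at
  most L * (1 + 1/j)^m <= L * (3/2)^m, which falls short of L * 2^m by q^2.\<close>

lemma \<beta>_le:
  assumes "3 \<le> L"
  shows "q\<^sup>2 * \<beta> \<le> L * 2 ^ (n - t - 1) * \<beta>1"
proof -
  define j m where "j = L - 1" and "m = n - t - 1"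
  have e: "n - t = Suc m" "n - (t + 1) = m" "l - t = Suc j" "l - (t + 1) = j" "2 \<le> j" "j \<le> m"
    using assms n_gt l_le by (auto simp: j_def m_def T_def)
  have b: "\<beta> = Stirling (Suc m) (Suc j)" "\<beta>1 = Stirling m j" by (simp_all only: e)
  have "\<beta> \<le> Suc j * (Stirling m (Suc j) + Stirling m j)" unfolding b by simp
  then have "\<beta> * j ^ m \<le> Suc j * (Stirling m (Suc j) + Stirling m j) * j ^ m" by (rule mult_le_mono1)
  also have "\<dots> = Suc j * ((Stirling m (Suc j) + Stirling m j) * j ^ m)" by (simp only: mult.assoc)
  also have "\<dots> \<le> Suc j * (Suc j ^ m * \<beta>1)"
    unfolding b using e by (intro mult_le_mono2 Stirling_ratio_le) auto
  finally have "\<beta> * j ^ m * 2 ^ m \<le> Suc j * (Suc j ^ m * \<beta>1) * 2 ^ m" by (rule mult_le_mono1)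
  also have "\<dots> = Suc j * ((Suc j * 2) ^ m * \<beta>1)" by (simp only: power_mult_distrib mult_ac)
  also have "\<dots> \<le> Suc j * ((j * 3) ^ m * \<beta>1)"
    using e(5) by (intro mult_le_mono2 mult_le_mono1 power_mono) auto
  finally have "(\<beta> * 2 ^ m) * j ^ m \<le> (Suc j * 3 ^ m * \<beta>1) * j ^ m" by (simp only: power_mult_distrib mult_ac)
  then have "\<beta> * 2 ^ m \<le> Suc j * 3 ^ m * \<beta>1"
    unfolding mult_le_cancel2 using e(5) by (metis gr0I not_numeral_le_zero zero_less_power)
  then have "q\<^sup>2 * (\<beta> * 2 ^ m) \<le> q\<^sup>2 * (Suc j * 3 ^ m * \<beta>1)" by (rule mult_le_mono2)
  also have "\<dots> = (q\<^sup>2 * 3 ^ m) * (Suc j * \<beta>1)" by (simp only: mult_ac)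
  also have "\<dots> \<le> 4 ^ m * (Suc j * \<beta>1)"
    unfolding m_def using LQ assms by (intro mult_le_mono1 q2_three_halves_le) linarith
  also have "(4::nat) ^ m = 2 ^ m * 2 ^ m" by (simp flip: power_mult_distrib)
  finally have "(q\<^sup>2 * \<beta>) * 2 ^ m \<le> (L * 2 ^ m * \<beta>1) * 2 ^ m" unfolding e(3) by (simp only: mult_ac)
  then show ?thesis unfolding mult_le_cancel2 m_def by (metis zero_less_numeral zero_less_power)
qed

text \<open>The product is at most L * (\<open>\<beta>\<close> + 4 * t * \<open>\<beta>1\<close>).
  For L <= t it loses to (C, D), of order T * \<open>\<beta>\<close>. For larger L it is compared
  with the mirrored pair (D, C), of order T * \<open>\<beta>1\<close> * 2^(n - t - 1).\<close>

lemma two_members_False: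
  assumes A: "A1 \<in> F" "A2 \<in> F" "A1 \<noteq> A2"
  shows False
proof -
  interpret sw: crossfam n kk t l k G F by (rule swapped)
  have P: "card F * card G \<le> L * (\<beta> + 4 * t * \<beta>1)"
    by (rule mult_le_mono[OF two_members_card_F[OF A] two_members_card_G[OF A]])
  show False
  proof (cases "L \<le> t")
    case True
    then have "L * (\<beta> + 4 * t * \<beta>1) \<le> t * (\<beta> + 4 * t * \<beta>1)" by (rule mult_le_mono1)
    moreover have arith: "R \<le> t * (4 * t) + t"
      if "(t + 1) * x \<le> p + t * y" "p \<le> t * (x + 4 * t * y)" "R * y \<le> x" "0 < y" for x y p
    proof -
      have "(t + 1) * x \<le> t * (x + 4 * t * y) + t * y" using that(1,2) by linarith
      then have "x \<le> (t * (4 * t) + t) * y" by (simp add: algebra_simps)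
      then have "R * y \<le> (t * (4 * t) + t) * y" using that(3) by linarith
      then show ?thesis using that(4) by simp
    qed
    ultimately have "R \<le> t * (4 * t) + t"
      using arith[OF CD_small[unfolded T_def] _ R_\<beta>1 \<beta>1_pos] P by (meson le_trans)
    moreover have "t * (4 * t) + t < R"
    proof -
      have "(t * (4 * t) + t) \<le> T * T * 9" by (simp add: T_def algebra_simps)
      also have "\<dots> \<le> T * T * Q\<^sup>2"
        using power_mono[OF Q_ge, of 2] by (intro mult_le_mono2) simp
      also note R_big(2)
      finally show ?thesis .
    qed
    ultimately show False by simp
  next
    case False
    \<comment> \<open>L = 2 > t leaves only t = 1 and k = l = 3. There L = T and
      \<open>a t = \<beta>\<close>, so the leading terms would tie with both benchmarks.\<close>
    have "L \<noteq> 2"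
    proof
      assume "L = 2"
      then have "t = 1" "k = 3" "l = 3" using False t1 k_eq l_ge by auto
      then show False using not33 by simp
    qed
    then have L3: "3 \<le> L" using KL_ge(2) by linarith
    define m M where "m = n - t - 1" and "M = (2::nat) ^ m"
    have e: "n - t = Suc m" "k - t = Suc (Suc 0)" using n_gt by (auto simp: m_def T_def k_eq)
    have at: "a t = M - 1" by (simp only: e Stirling_2 M_def)
    have M: "q ^ 6 \<le> M"
    proof -
      have "(2::nat) ^ (n - t - 2) \<le> M" unfolding M_def m_def by (intro power_increasing) auto
      then show ?thesis using q_power_6_le by linarith
    qed
    have S: "T * (\<beta>1 * a t) \<le> card F * card G + t * \<beta>1"
      using sw.CD_lower unfolding \<alpha>_eq by (simp only: mult.commute mult_1_right)
    have bL: "q\<^sup>2 * \<beta> \<le> L * M * \<beta>1" using \<beta>_le[OF L3] by (simp only: M_def m_def)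
    have Lq: "L * L \<le> q\<^sup>2"
    proof -
      have "Q \<le> q" using T_ge by (simp add: q_def)
      then have "L \<le> q" using LQ by linarith
      then show ?thesis by (simp add: power2_eq_square mult_le_mono)
    qed
    \<comment> \<open>Multiplying by q^2 allows \<open>\<beta>\<close> to be traded for
      \<open>\<beta>1\<close> by \<open>bL\<close>; L^2 <= q^2 then removes L from the leading
      term.\<close>
    have arith: "T * (M - 1) \<le> M + 4 * t * L' + t"
      if "T * (y * (M - 1)) \<le> p + t * y" "p \<le> L' * (x + 4 * t * y)" "q\<^sup>2 * x \<le> L' * M * y"
        "L' * L' \<le> q\<^sup>2" "0 < y" for x y p L' :: nat
    proof -
      have "q\<^sup>2 * (T * (y * (M - 1))) \<le> q\<^sup>2 * (L' * (x + 4 * t * y) + t * y)"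
        using that(1,2) by (intro mult_le_mono2) linarith
      also have "\<dots> = L' * (q\<^sup>2 * x) + q\<^sup>2 * ((4 * t * L' + t) * y)" by (simp add: algebra_simps)
      also have "\<dots> \<le> L' * (L' * M * y) + q\<^sup>2 * ((4 * t * L' + t) * y)"
        using that(3) by (intro add_right_mono mult_le_mono2)
      also have "L' * (L' * M * y) = (L' * L') * (M * y)" by (simp only: mult_ac)
      also have "(L' * L') * (M * y) \<le> q\<^sup>2 * (M * y)" using that(4) by (rule mult_le_mono1)
      finally have "(q\<^sup>2 * y) * (T * (M - 1)) \<le> (q\<^sup>2 * y) * (M + 4 * t * L' + t)"
        by (simp add: algebra_simps)
      moreover have "0 < q\<^sup>2 * y" using that(5) q_ge by simp
      ultimately show ?thesis unfolding mult_le_cancel1 by blast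
    qed
    have "T * (M - 1) \<le> M + 4 * t * L + t"
      by (rule arith[OF S[unfolded at] P bL Lq \<beta>1_pos])
    moreover have "M = Suc (M - 1)" by (simp add: M_def)
    ultimately obtain M' where M': "M = Suc M'" "T * M' \<le> Suc M' + 4 * t * L + t" by metis
    define L' where "L' = L"
    have "t * M' \<le> 4 * t * L' + t + 1" using M'(2) unfolding L'_def[symmetric] by (simp add: T_def)
    also have "\<dots> \<le> t * (4 * L' + 2)" using t1 by (simp add: algebra_simps)
    finally have "M' \<le> 4 * L' + 2" unfolding mult_le_cancel1 using t1 by linarith
    moreover have "L' \<le> q"
    proof -
      have "Q \<le> q" using T_ge by (simp add: q_def)
      then show ?thesis using LQ unfolding L'_def by linarith
    qed
    ultimately have "M \<le> 4 * q + 3" using M'(1) by linarith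
    also have "\<dots> < 6 * q" using q_ge by linarith
    also have "\<dots> \<le> q * q" using q_ge by (rule mult_le_mono1)
    also have "\<dots> = q ^ 2" by (simp add: power2_eq_square)
    also have "\<dots> \<le> q ^ 6" using q_ge by (intro power_increasing) auto
    finally show False using M by simp
  qed
qed

section \<open>The star consists of a single partition\<close>

lemma one_member_singletons:
  assumes "F = {A}" "D \<in> A" "\<And>Z. Z \<in> A - {D} \<Longrightarrow> card Z = 1"
  shows isCD
proof -
  have PA: "A \<in> Parts n k" using assms(1) F_sub by blast
  let ?T0 = "A - {D}"
  have cT: "card ?T0 = t + 1" "finite ?T0" using PartsD(2,3)[OF PA] assms(2) k_eq by simp_all
  show ?thesis
  proof (rule CD_if_contained[OF cT(2,1) _ _ assms(3)])
    show "?T0 \<subseteq> A'" if "A' \<in> F" for A' using that assms(1) by blast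
    show "t \<le> card (B \<inter> ?T0)" if B: "B \<in> G" for B
    proof (cases "D \<in> B")
      case False
      then have "B \<inter> ?T0 = A \<inter> B" by blast
      then show ?thesis using crossD[of A B] assms(1) B by simp
    next
      case True
      have PB: "B \<in> Parts n l" using B G_sub by blast
      \<comment> \<open>If D is a block of B, then B splits the t + 1 points outside D into l - 1 >=
        t + 1 blocks, which must all be singletons.\<close>
      have U: "\<Union> (P - {D}) = {1..n} - D" if "P \<in> Parts n j" "D \<in> P" for P j
      proof -
        have "\<Union> P = \<Union> (P - {D}) \<union> D" using that(2) by blast
        moreover have "\<Union> (P - {D}) \<inter> D = {}" using PartsD(6)[OF that(1)] that(2) by blast
        moreover have diffU: "Y = N - E" if "W = Y \<union> E" "Y \<inter> E = {}" "W = N" for W Y E N :: "nat set"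
          using that by blast
        ultimately show ?thesis using diffU PartsD(4)[OF that(1)] by (simp only:)
      qed
      have UT: "\<Union> ?T0 = \<Union> (B - {D})" using U[OF PA assms(2)] U[OF PB True] by (simp only:)
      have "card (\<Union> ?T0) = t + 1"
        using card_Union_Parts[OF PA, of ?T0] assms(3) cT(1) by simp
      moreover have "card (B - {D}) = l - 1" using PartsD(2,3)[OF PB] True by simp
      ultimately have "card Z = 1" if "Z \<in> B - {D}" for Z
        using card_less_card_Union_Parts[OF PB, of "B - {D}" Z] that l_ge UT by (cases "card Z = 1") auto
      then have "B - {D} = sing (\<Union> (B - {D}))" by (rule all_card_1_eq_sing)
      moreover have "?T0 = sing (\<Union> ?T0)" by (rule all_card_1_eq_sing[OF assms(3)])
      ultimately have "?T0 = B - {D}" using UT by (simp only:)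
      then have "B \<inter> ?T0 = ?T0" by blast
      then show ?thesis using cT(1) by simp
    qed
  qed
qed

text \<open>With the largest block D prescribed, the t prescribed blocks contain e points beyond one
  per block, and each such point is worth a factor 2. As e is about a third of n - t or more, 2^e
  reaches q^2.\<close>

lemma card_G_containing_avoiding_pair:
  assumes A: "F = {A}" and C: "C1 \<in> A" "C2 \<in> A" "C1 \<noteq> C2" "D \<in> A" "D \<noteq> C1" "D \<noteq> C2"
    and max: "card C1 \<le> card D" "card C2 \<le> card D"
  shows "q\<^sup>2 * card {B \<in> G. A - {C1, C2} \<subseteq> B} \<le> \<beta>"
proof -
  have PA: "A \<in> Parts n k" using A F_sub by blast
  let ?H = "A - {C1, C2}"
  have cA: "card A = t + 2" "finite A" using PartsD(2,3)[OF PA] k_eq by simp_all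
  have cH: "card ?H = t" using cA C by (simp add: card_Diff_subset)
  have UA: "(\<Sum>Z\<in>A. card Z) = n" using card_Union_Parts[OF PA, of A] PartsD(4)[OF PA] by simp
  have sH: "n = card C1 + card C2 + (\<Sum>Z\<in>?H. card Z)"
  proof -
    have "A = insert C1 (insert C2 ?H)" using C by blast
    then have "(\<Sum>Z\<in>A. card Z) = (\<Sum>Z\<in>insert C1 (insert C2 ?H). card Z)" by (simp only:)
    also have "\<dots> = card C1 + card C2 + (\<Sum>Z\<in>?H. card Z)" using cA C by simp
    finally show ?thesis using UA by simp
  qed
  have sD: "card D + (t - 1) \<le> (\<Sum>Z\<in>?H. card Z)"
  proof -
    have "(\<Sum>Z\<in>?H. card Z) = card D + (\<Sum>Z\<in>?H - {D}. card Z)"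
      using cA C by (intro sum.remove) auto
    moreover have "(\<Sum>Z\<in>?H - {D}. 1) \<le> (\<Sum>Z\<in>?H - {D}. card Z)"
      using card_block_ge_1[OF PA] by (intro sum_mono) auto
    moreover have "(\<Sum>Z\<in>?H - {D}. 1) = t - 1" using cH C by simp
    ultimately show ?thesis by linarith
  qed
  define c where "c = card C1 + card C2"
  define e where "e = n - t - c"
  \<comment> \<open>The bound comes from e >= card D - 1 and c <= 2 * card D.\<close>
  have ce: "c + e = n - t" "n - 2 - t \<le> 3 * e"
    using sH sD max t1 unfolding c_def e_def by linarith+
  have "q ^ 6 \<le> 2 ^ (n - t - 2)" by (rule q_power_6_le)
  also have "\<dots> \<le> 2 ^ (3 * e)" using ce(2) by (intro power_increasing) auto
  finally have "(q\<^sup>2) ^ 3 \<le> (2 ^ e) ^ 3" by (simp flip: power_mult add: mult.commute)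
  then have qe: "q\<^sup>2 \<le> 2 ^ e" by (subst (asm) power_mono_iff) auto
  have "{B \<in> G. ?H \<subseteq> B} \<subseteq> famC n l ?H" using G_sub by (auto simp: famC_def)
  then have "card {B \<in> G. ?H \<subseteq> B} \<le> card (famC n l ?H)" by (intro card_mono) auto
  also have "\<dots> \<le> Stirling (n - (\<Sum>Z\<in>?H. card Z)) (l - card ?H)"
  proof (rule card_famC_le_general)
    show "card ?H < l" using cH l_ge by simp
    show "(\<Sum>Z\<in>?H. card Z) \<le> card (\<Union> ?H)" using card_Union_Parts[OF PA, of ?H] by simp
  qed
  also have "n - (\<Sum>Z\<in>?H. card Z) = c" using sH unfolding c_def by simp
  finally have "card {B \<in> G. ?H \<subseteq> B} \<le> Stirling c (l - t)" unfolding cH .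
  then have "q\<^sup>2 * card {B \<in> G. ?H \<subseteq> B} \<le> 2 ^ e * Stirling c (l - t)"
    using qe by (intro mult_le_mono)
  also have "\<dots> \<le> Stirling (c + e) (l - t)" using KL_ge(2) by (intro two_power_Stirling_le)
  finally show ?thesis unfolding ce(1) .
qed

text \<open>Members of G are sorted by the two blocks of A outside a common t-subset. The pair D, C0
  contributes at most \<open>\<beta>\<close>; each of the t other pairs with D keeps the
  non-singleton C0 prescribed and contributes at most half of \<open>\<beta>\<close>; each pair
  avoiding D contributes at most \<open>\<beta>\<close> / q^2. The total stays below (C, D).\<close>

lemma one_member_nonsingletons:
  assumes A: "F = {A}" and D: "D \<in> A" "\<And>Z. Z \<in> A \<Longrightarrow> card Z \<le> card D"
    and C0: "C0 \<in> A - {D}" "card C0 \<noteq> 1"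
  shows False
proof -
  have PA: "A \<in> Parts n k" using A F_sub by blast
  have cA: "card A = t + 2" "finite A" using PartsD(2,3)[OF PA] k_eq by simp_all
  define g where "g H = {B \<in> G. H \<subseteq> B}" for H
  define S where "S = A - {D, C0}"
  define S2 where "S2 = {p \<in> (A - {D}) \<times> (A - {D}). fst p \<noteq> snd p}"
  have "D \<noteq> C0" using C0(1) by blast
  then have cS: "card S = t" "finite S" using cA D(1) C0(1) unfolding S_def by (simp_all add: card_Diff_subset)
  have fS2: "finite S2" using cA unfolding S2_def by simp
  have cS2: "card S2 \<le> T * T"
  proof -
    have "card S2 \<le> card ((A - {D}) \<times> (A - {D}))" unfolding S2_def using cA by (intro card_mono) auto
    also have "\<dots> = T * T" using cA D(1) by (simp add: card_cartesian_product T_def)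
    finally show ?thesis .
  qed
  have finG: "finite (g H)" for H unfolding g_def by simp
  have "G \<subseteq> g (A - {D, C0}) \<union> (\<Union>C\<in>S. g (A - {D, C})) \<union> (\<Union>p\<in>S2. g (A - {fst p, snd p}))"
  proof
    fix B assume B: "B \<in> G"
    have "t \<le> card (A \<inter> B)" using crossD[of A B] A B by simp
    then obtain H where H: "H \<subseteq> A \<inter> B" "card H = t" by (meson obtain_subset_with_card_n)
    have "finite H" using H(1) cA(2) by (meson finite_subset le_inf_iff)
    then have "card (A - H) = 2" using H cA by (subst card_Diff_subset) auto
    then obtain C1 C2 where C: "A - H = {C1, C2}" "C1 \<noteq> C2" unfolding card_2_iff by blast
    have HA: "H = A - {C1, C2}" using C(1) H(1) by blast
    have CA: "C1 \<in> A" "C2 \<in> A" using C(1) by blast+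
    have BH: "B \<in> g H" using B H(1) unfolding g_def by blast
    consider "C1 = D" | "C2 = D" | "C1 \<noteq> D" "C2 \<noteq> D" by blast
    then show "B \<in> g (A - {D, C0}) \<union> (\<Union>C\<in>S. g (A - {D, C})) \<union> (\<Union>p\<in>S2. g (A - {fst p, snd p}))"
    proof cases
      case 1
      then have "B \<in> g (A - {D, C2})" using BH HA by simp
      moreover have "C2 = C0 \<or> C2 \<in> S" using CA C(2) 1 unfolding S_def by blast
      ultimately show ?thesis by blast
    next
      case 2
      then have "B \<in> g (A - {D, C1})" using BH HA by (simp add: insert_commute)
      moreover have "C1 = C0 \<or> C1 \<in> S" using CA C(2) 2 unfolding S_def by blast
      ultimately show ?thesis by blast
    next
      case 3
      then have "(C1, C2) \<in> S2" using CA C(2) unfolding S2_def by simp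
      moreover have "B \<in> g (A - {fst (C1, C2), snd (C1, C2)})" using BH HA by simp
      ultimately show ?thesis by blast
    qed
  qed
  then have "card G \<le> card (g (A - {D, C0}) \<union> (\<Union>C\<in>S. g (A - {D, C})) \<union> (\<Union>p\<in>S2. g (A - {fst p, snd p})))"
    using finG cS fS2 by (intro card_mono) auto
  also have "\<dots> \<le> card (g (A - {D, C0})) + card (\<Union>C\<in>S. g (A - {D, C})) + card (\<Union>p\<in>S2. g (A - {fst p, snd p}))"
    by (meson add_mono card_Un_le le_trans order_refl)
  also have "\<dots> \<le> card (g (A - {D, C0})) + (\<Sum>C\<in>S. card (g (A - {D, C}))) + (\<Sum>p\<in>S2. card (g (A - {fst p, snd p})))"
    by (intro add_mono card_UN_le cS fS2 order_refl)
  finally have G: "card G \<le> card (g (A - {D, C0})) + (\<Sum>C\<in>S. card (g (A - {D, C}))) + (\<Sum>p\<in>S2. card (g (A - {fst p, snd p})))" .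
  have g0: "card (g (A - {D, C0})) \<le> \<beta>"
    unfolding g_def using cS(1) l_ge unfolding S_def by (intro GX_le) auto
  have g1: "2 * card (g (A - {D, C})) \<le> \<beta>" if C: "C \<in> S" for C
  proof -
    let ?H = "A - {D, C}"
    have "D \<noteq> C" using C unfolding S_def by blast
    then have cH: "card ?H = t" using cA D(1) C unfolding S_def by (simp add: card_Diff_subset)
    have C0H: "C0 \<in> ?H" using C0(1) C unfolding S_def by blast
    have "g ?H \<subseteq> famC n l ?H" unfolding g_def using G_sub by (auto simp: famC_def)
    then have "card (g ?H) \<le> card (famC n l ?H)" by (intro card_mono) auto
    also have "\<dots> \<le> Stirling (n - t - 1) (l - t)"
      by (rule card_famC_nonsingle_le[OF cH _ C0H C0(2)]) (use l_ge in linarith)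
    finally have "2 * card (g ?H) \<le> 2 ^ 1 * Stirling (n - t - 1) (l - t)" by simp
    also have "\<dots> \<le> Stirling (n - t - 1 + 1) (l - t)" using KL_ge(2) by (rule two_power_Stirling_le)
    also have "n - t - 1 + 1 = n - t" using n_gt by (simp add: T_def)
    finally show ?thesis .
  qed
  have g2: "q\<^sup>2 * card (g (A - {fst p, snd p})) \<le> \<beta>" if p: "p \<in> S2" for p
  proof -
    have "fst p \<in> A" "snd p \<in> A" "fst p \<noteq> snd p" "D \<noteq> fst p" "D \<noteq> snd p"
      using p unfolding S2_def by auto
    then show ?thesis
      unfolding g_def using D by (intro card_G_containing_avoiding_pair[OF A, of _ _ D]) simp_all
  qed
  have s1: "2 * (\<Sum>C\<in>S. card (g (A - {D, C}))) \<le> t * \<beta>"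
  proof -
    have "2 * (\<Sum>C\<in>S. card (g (A - {D, C}))) \<le> (\<Sum>C\<in>S. \<beta>)"
      unfolding sum_distrib_left by (intro sum_mono g1)
    then show ?thesis using cS(1) by simp
  qed
  have s2: "q\<^sup>2 * (\<Sum>p\<in>S2. card (g (A - {fst p, snd p}))) \<le> T * T * \<beta>"
  proof -
    have "q\<^sup>2 * (\<Sum>p\<in>S2. card (g (A - {fst p, snd p}))) \<le> (\<Sum>p\<in>S2. \<beta>)"
      unfolding sum_distrib_left by (intro sum_mono g2)
    also have "\<dots> = card S2 * \<beta>" by simp
    also have "\<dots> \<le> T * T * \<beta>" using cS2 by (rule mult_le_mono1)
    finally show ?thesis .
  qed
  have cd: "T * \<beta> \<le> card G + t * \<beta>1" using CD_small A by simp
  have Rb: "q\<^sup>2 * \<beta>1 \<le> \<beta>"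
  proof -
    have "q\<^sup>2 * \<beta>1 \<le> R * \<beta>1" unfolding R_def by (intro mult_le_mono1) simp
    then show ?thesis using R_\<beta>1 by (rule le_trans)
  qed
  have arith: "t * q\<^sup>2 \<le> 2 * (T * T) + 2 * t"
    if "T * x \<le> s + t * y" "s \<le> u + v + w" "u \<le> x" "2 * v \<le> t * x" "q\<^sup>2 * w \<le> T * T * x"
      "q\<^sup>2 * y \<le> x" "0 < x" for x y s u v w :: nat
  proof -
    have "2 * q\<^sup>2 * (T * x) \<le> 2 * q\<^sup>2 * (x + v + w + t * y)"
      using that(1-3) by (intro mult_le_mono2) linarith
    also have "\<dots> = 2 * q\<^sup>2 * x + q\<^sup>2 * (2 * v) + 2 * (q\<^sup>2 * w) + 2 * t * (q\<^sup>2 * y)" by (simp add: algebra_simps)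
    also have "\<dots> \<le> 2 * q\<^sup>2 * x + q\<^sup>2 * (t * x) + 2 * (T * T * x) + 2 * t * x"
      using that(4-6) by (intro add_mono mult_le_mono2 order_refl)
    finally have "(t * q\<^sup>2) * x \<le> (2 * (T * T) + 2 * t) * x"
      unfolding T_def by (simp add: algebra_simps)
    then show ?thesis unfolding mult_le_cancel2 using that(7) by blast
  qed
  have "t * q\<^sup>2 \<le> 2 * (T * T) + 2 * t" by (rule arith[OF cd G g0 s1 s2 Rb \<beta>_pos])
  moreover have "T * T * 9 \<le> q\<^sup>2"
  proof -
    have "T * T * 9 \<le> T * T * Q\<^sup>2" using power_mono[OF Q_ge, of 2] by (intro mult_le_mono2) simp
    also have "\<dots> = q\<^sup>2" by (simp only: q_def power2_eq_square mult_ac)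
    finally show ?thesis .
  qed
  then have "t * (T * T * 9) \<le> t * q\<^sup>2" by (rule mult_le_mono2)
  moreover have "1 * (T * T * 9) \<le> t * (T * T * 9)" using t1 by (rule mult_le_mono1)
  moreover have "t < T * T" by (simp add: T_def)
  ultimately show False using T_ge by linarith
qed

lemma star_two: isCD
proof -
  obtain A where A: "A \<in> F" using F_ne by blast
  then have FA: "F = {A}" using two_members_False by blast
  have PA: "A \<in> Parts n k" using A F_sub by blast
  have "finite A" "A \<noteq> {}" using PartsD(2,3)[OF PA] k_eq by auto
  then have fin: "finite (card ` A)" "card ` A \<noteq> {}" by simp_all
  obtain D where D: "D \<in> A" "card D = Max (card ` A)" using Max_in[OF fin] by auto
  have mx: "card Z \<le> card D" if "Z \<in> A" for Z using that fin D(2) by simp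
  show ?thesis
  proof (cases "\<forall>Z\<in>A - {D}. card Z = 1")
    case True
    then show ?thesis using one_member_singletons[OF FA D(1)] by blast
  next
    case False
    then obtain C0 where "C0 \<in> A - {D}" "card C0 \<noteq> 1" by blast
    then show ?thesis using one_member_nonsingletons[OF FA D(1) mx] by blast
  qed
qed

end

theorem star_cases: "isCD \<or> isAB"
proof (cases "3 \<le> K")
  case False
  then show ?thesis using star_two KL_ge(1) by simp
qed (rule star_large)

end


section \<open>Isomorphism with the standard families\<close>

context crossfam
begin

lemma star_if_cover:
  assumes "finite C" "card C = t" "\<And>A. A \<in> F \<Longrightarrow> t \<le> card (A \<inter> C)"
  shows "isCD \<or> isAB"
proof -
  interpret star n kk t k l F G C
  proof
    show "C \<subseteq> A" if "A \<in> F" for A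
      using assms(3)[OF that] card_inter_less[OF assms(1,2), of A] by linarith
  qed (rule assms)+
  show ?thesis by (rule star_cases)
qed

theorem extremal_cases:
  "isCD \<or> isAB \<or> crossfam.isCD n t l k G F \<or> crossfam.isAB n t l k G F"
proof -
  interpret sw: crossfam n kk t l k G F by (rule swapped)
  obtain C x where C: "finite C" "card C = t + x" "\<And>A. A \<in> F \<Longrightarrow> t \<le> card (A \<inter> C)" "x \<le> L" "noncover (t + x) F"
    using min_cover by metis
  obtain D y where D: "finite D" "card D = t + y" "\<And>B. B \<in> G \<Longrightarrow> t \<le> card (B \<inter> D)" "y \<le> K" "noncover (t + y) G"
    using sw.min_cover by metis
  consider "x = 0" | "y = 0" | "1 \<le> x" "1 \<le> y" by linarith
  then show ?thesis
  proof cases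
    case 1
    then show ?thesis using star_if_cover[OF C(1) _ C(3)] C(2) by auto
  next
    case 2
    then show ?thesis using sw.star_if_cover[OF D(1) _ D(3)] D(2) by auto
  next
    case 3
    then show ?thesis using both_covers_large[OF C(1-3,5) D(1-3,5) _ C(4) _ D(4)] by blast
  qed
qed

end

section \<open>The action of a permutation of the ground set\<close>

definition perm_part :: "(nat \<Rightarrow> nat) \<Rightarrow> part \<Rightarrow> part" where
  "perm_part \<sigma> P = (\<lambda>B. \<sigma> ` B) ` P"

lemma perm_fam_eq: "perm_fam \<sigma> H = perm_part \<sigma> ` H"
  by (simp add: perm_fam_def perm_part_def)

lemma perm_part_sing: "perm_part \<sigma> (sing I) = sing (\<sigma> ` I)"
  by (auto simp: perm_part_def)

lemma singl_eq: "singl s = sing {1..s}"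
  by (simp add: singl_def)

context
  fixes \<sigma> :: "nat \<Rightarrow> nat" and n :: nat
  assumes bij: "bij_betw \<sigma> {1..n} {1..n}"
begin

abbreviation "Sub \<equiv> Pow {1..n}"

lemma inj_blocks: "inj_on (\<lambda>B. \<sigma> ` B) Sub"
  using bij by (intro inj_on_image_Pow) (rule bij_betw_imp_inj_on)

lemma Parts_Sub: "P \<in> Parts n k \<Longrightarrow> P \<subseteq> Sub"
  using PartsD(4)[of P n k] by blast

lemma perm_part_Int: "P \<subseteq> Sub \<Longrightarrow> P' \<subseteq> Sub \<Longrightarrow> perm_part \<sigma> (P \<inter> P') = perm_part \<sigma> P \<inter> perm_part \<sigma> P'"
  unfolding perm_part_def by (rule inj_on_image_Int[OF inj_blocks])

lemma perm_part_Diff: "P \<subseteq> Sub \<Longrightarrow> P' \<subseteq> Sub \<Longrightarrow> perm_part \<sigma> (P - P') = perm_part \<sigma> P - perm_part \<sigma> P'"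
  unfolding perm_part_def by (rule inj_on_image_set_diff[OF inj_blocks]) auto

lemma perm_part_subset: "P \<subseteq> Sub \<Longrightarrow> P' \<subseteq> Sub \<Longrightarrow> perm_part \<sigma> P \<subseteq> perm_part \<sigma> P' \<longleftrightarrow> P \<subseteq> P'"
proof
  assume s: "P \<subseteq> Sub" "P' \<subseteq> Sub" and sub: "perm_part \<sigma> P \<subseteq> perm_part \<sigma> P'"
  show "P \<subseteq> P'"
  proof
    fix B assume B: "B \<in> P"
    then have "\<sigma> ` B \<in> (\<lambda>B. \<sigma> ` B) ` P'" using sub unfolding perm_part_def by blast
    then show "B \<in> P'" using inj_on_image_mem_iff[OF inj_blocks _ s(2)] B s(1) by blast
  qed
qed (auto simp: perm_part_def)

lemma card_perm_part: "P \<subseteq> Sub \<Longrightarrow> card (perm_part \<sigma> P) = card P"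
  unfolding perm_part_def by (rule card_image) (rule inj_on_subset[OF inj_blocks])

lemma perm_part_in_Parts:
  assumes "P \<in> Parts n k"
  shows "perm_part \<sigma> P \<in> Parts n k"
proof -
  have "partition_on (\<sigma> ` {1..n}) ((`) \<sigma> ` P - {{}})"
    using PartsD(1)[OF assms] bij by (intro partition_on_inj_image) (auto simp: bij_betw_def)
  moreover have "(`) \<sigma> ` P - {{}} = perm_part \<sigma> P" using PartsD(5)[OF assms] by (auto simp: perm_part_def)
  moreover have "\<sigma> ` {1..n} = {1..n}" using bij by (simp add: bij_betw_def)
  ultimately show ?thesis
    using card_perm_part[OF Parts_Sub[OF assms]] PartsD(2)[OF assms] by (simp add: Parts_def)
qed

lemma perm_part_Parts: "perm_part \<sigma> ` Parts n k = Parts n k"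
proof (rule endo_inj_surj)
  show "inj_on (perm_part \<sigma>) (Parts n k)"
  proof (rule inj_onI)
    fix P P' assume P: "P \<in> Parts n k" "P' \<in> Parts n k" "perm_part \<sigma> P = perm_part \<sigma> P'"
    then show "P = P'"
      using perm_part_subset[OF Parts_Sub[OF P(1)] Parts_Sub[OF P(2)]]
        perm_part_subset[OF Parts_Sub[OF P(2)] Parts_Sub[OF P(1)]] by simp
  qed
qed (use perm_part_in_Parts in auto)

text \<open>The action permutes \<open>Parts n k\<close>, so only the defining condition has to be
  transported.\<close>

lemma perm_fam_Collect:
  assumes "\<And>P. P \<in> Parts n k \<Longrightarrow> \<Psi> (perm_part \<sigma> P) \<longleftrightarrow> \<Phi> P"
  shows "perm_fam \<sigma> {P \<in> Parts n k. \<Phi> P} = {P \<in> Parts n k. \<Psi> P}"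
  unfolding perm_fam_eq
proof (intro equalityI subsetI)
  fix P assume P: "P \<in> {P \<in> Parts n k. \<Psi> P}"
  then obtain P' where "P' \<in> Parts n k" "P = perm_part \<sigma> P'" using perm_part_Parts by blast
  then show "P \<in> perm_part \<sigma> ` {P \<in> Parts n k. \<Phi> P}" using assms P by blast
qed (use assms perm_part_in_Parts in auto)

context
  fixes X M :: part
  assumes X: "X \<subseteq> Sub" and M: "M \<subseteq> Sub"
begin

lemma perm_famC: "perm_fam \<sigma> (famC n k X) = famC n k (perm_part \<sigma> X)"
  unfolding famC_def by (rule perm_fam_Collect) (rule perm_part_subset[OF X Parts_Sub])

lemma perm_famD: "perm_fam \<sigma> (famD n t l X) = famD n t l (perm_part \<sigma> X)"
  unfolding famD_def
proof (rule perm_fam_Collect)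
  fix P assume "P \<in> Parts n l"
  then have P: "P \<subseteq> Sub" by (rule Parts_Sub)
  then have "card (perm_part \<sigma> X \<inter> perm_part \<sigma> P) = card (X \<inter> P)"
    using card_perm_part[of "X \<inter> P"] X by (simp add: perm_part_Int le_infI1)
  then show "(t \<le> card (perm_part \<sigma> X \<inter> perm_part \<sigma> P)) = (t \<le> card (X \<inter> P))" by simp
qed

lemma perm_famA: "perm_fam \<sigma> (famA n k X M) = famA n k (perm_part \<sigma> X) (perm_part \<sigma> M)"
  unfolding famA_def
proof (rule perm_fam_Collect)
  fix P assume "P \<in> Parts n k"
  then have P: "P \<subseteq> Sub" by (rule Parts_Sub)
  have MX: "M - X \<subseteq> Sub" using M by blast
  have "perm_part \<sigma> (P \<inter> (M - X)) = perm_part \<sigma> P \<inter> (perm_part \<sigma> M - perm_part \<sigma> X)"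
    unfolding perm_part_Int[OF P MX] perm_part_Diff[OF M X] ..
  moreover have "perm_part \<sigma> Z = {} \<longleftrightarrow> Z = {}" for Z by (simp add: perm_part_def)
  ultimately show "(perm_part \<sigma> X \<subseteq> perm_part \<sigma> P \<and> perm_part \<sigma> P \<inter> (perm_part \<sigma> M - perm_part \<sigma> X) \<noteq> {})
      = (X \<subseteq> P \<and> P \<inter> (M - X) \<noteq> {})"
    using perm_part_subset[OF X P] by metis
qed

text \<open>The extra members are given explicitly rather than by a condition on partitions, so
  their images are computed directly.\<close>

lemma perm_famB: "perm_fam \<sigma> (famB n l X M) = famB n l (perm_part \<sigma> X) (perm_part \<sigma> M)"
proof -
  let ?e = "\<lambda>M B. (M - {B}) \<union> {B \<union> ({1..n} - \<Union> M)}"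
  have UM: "\<Union> (perm_part \<sigma> M) = \<sigma> ` \<Union> M" by (auto simp: perm_part_def)
  have e: "perm_part \<sigma> (?e M B) = ?e (perm_part \<sigma> M) (\<sigma> ` B)" if "B \<in> X" for B
  proof -
    have B: "{B} \<subseteq> Sub" using that X by blast
    have "\<sigma> ` ({1..n} - \<Union> M) = \<sigma> ` {1..n} - \<sigma> ` \<Union> M"
      using M bij by (intro inj_on_image_set_diff[of _ "{1..n}"]) (auto simp: bij_betw_def)
    also have "\<sigma> ` {1..n} = {1..n}" using bij by (simp add: bij_betw_def)
    finally have "\<sigma> ` (B \<union> ({1..n} - \<Union> M)) = \<sigma> ` B \<union> ({1..n} - \<Union> (perm_part \<sigma> M))"
      unfolding UM image_Un by (simp only:)
    moreover have "perm_part \<sigma> (M - {B}) = perm_part \<sigma> M - {\<sigma> ` B}"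
      unfolding perm_part_Diff[OF M B] by (simp add: perm_part_def)
    ultimately show ?thesis
      unfolding perm_part_def image_Un[of "(`) \<sigma>"] by (simp only: image_insert image_empty)
  qed
  have "famB n l X M = famC n l X \<union> ?e M ` X" by (auto simp: famB_def famC_def)
  then have "perm_fam \<sigma> (famB n l X M) = famC n l (perm_part \<sigma> X) \<union> (\<lambda>B. perm_part \<sigma> (?e M B)) ` X"
    using perm_famC by (simp only: perm_fam_eq image_Un image_image)
  also have "(\<lambda>B. perm_part \<sigma> (?e M B)) ` X = (\<lambda>B. ?e (perm_part \<sigma> M) (\<sigma> ` B)) ` X"
    by (rule image_cong) (simp_all only: e)
  also have "\<dots> = ?e (perm_part \<sigma> M) ` perm_part \<sigma> X"
    unfolding perm_part_def image_image ..
  also have "famC n l (perm_part \<sigma> X) \<union> \<dots> = famB n l (perm_part \<sigma> X) (perm_part \<sigma> M)"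
    by (auto simp: famB_def famC_def)
  finally show ?thesis .
qed

end

end

text \<open>Bijections of I, J - I and the remaining points onto consecutive intervals are glued
  together.\<close>

lemma ex_perm:
  assumes "I \<subseteq> J" "J \<subseteq> {1..n}"
  obtains \<sigma> where "bij_betw \<sigma> {1..n} {1..n}" "\<sigma> ` I = {1..card I}" "\<sigma> ` J = {1..card J}"
proof -
  have fJ: "finite J" "finite I" using assms by (meson finite_atLeastAtMost finite_subset)+
  have cIJ: "card I \<le> card J" using assms fJ by (intro card_mono)
  have cJn: "card J \<le> n" using card_mono[OF _ assms(2)] by simp
  obtain f where f: "bij_betw f I {1..card I}"
    using finite_same_card_bij[OF fJ(2), of "{1..card I}"] by auto
  obtain g where g: "bij_betw g (J - I) {card I + 1..card J}"
    using finite_same_card_bij[of "J - I" "{card I + 1..card J}"] fJ assms by (auto simp: card_Diff_subset)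
  obtain h where h: "bij_betw h ({1..n} - J) {card J + 1..n}"
    using finite_same_card_bij[of "{1..n} - J" "{card J + 1..n}"] fJ assms by (auto simp: card_Diff_subset)
  define \<sigma> where "\<sigma> x = (if x \<in> I then f x else if x \<in> J then g x else h x)" for x
  have bI: "bij_betw \<sigma> I {1..card I}"
    using f by (subst bij_betw_cong[of _ _ f]) (auto simp: \<sigma>_def)
  have bJI: "bij_betw \<sigma> (J - I) {card I + 1..card J}"
    using g by (subst bij_betw_cong[of _ _ g]) (auto simp: \<sigma>_def)
  have bnJ: "bij_betw \<sigma> ({1..n} - J) {card J + 1..n}"
    using h assms(1) by (subst bij_betw_cong[of _ _ h]) (auto simp: \<sigma>_def)
  have "bij_betw \<sigma> (I \<union> (J - I)) ({1..card I} \<union> {card I + 1..card J})"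
    by (rule bij_betw_combine[OF bI bJI]) auto
  moreover have "I \<union> (J - I) = J" "{1..card I} \<union> {card I + 1..card J} = {1..card J}" using assms(1) cIJ by auto
  ultimately have bJ: "bij_betw \<sigma> J {1..card J}" by (simp only:)
  have "bij_betw \<sigma> (J \<union> ({1..n} - J)) ({1..card J} \<union> {card J + 1..n})"
    by (rule bij_betw_combine[OF bJ bnJ]) auto
  moreover have "J \<union> ({1..n} - J) = {1..n}" "{1..card J} \<union> {card J + 1..n} = {1..n}" using assms(2) cJn by auto
  ultimately have "bij_betw \<sigma> {1..n} {1..n}" by (simp only:)
  then show ?thesis using that[of \<sigma>] bI bJ by (simp add: bij_betw_def)
qed

lemma iso_CD:
  assumes "I \<subseteq> {1..n}" "card I = t + 1"
  shows "\<exists>\<sigma>. bij_betw \<sigma> {1..n} {1..n} \<and> perm_fam \<sigma> (famC n k (sing I)) = C_std n k t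
    \<and> perm_fam \<sigma> (famD n t l (sing I)) = D_std n l t"
proof -
  obtain \<sigma> where s: "bij_betw \<sigma> {1..n} {1..n}" "\<sigma> ` I = {1..card I}"
    using ex_perm[OF order_refl assms(1)] by metis
  have "sing I \<subseteq> Pow {1..n}" using assms(1) by auto
  then show ?thesis
    using perm_famC[OF s(1)] perm_famD[OF s(1)] s assms(2)
    by (intro exI[of _ \<sigma>]) (simp add: perm_part_sing C_std_def D_std_def singl_eq)
qed

lemma iso_AB:
  assumes "I \<subseteq> J" "J \<subseteq> {1..n}" "card I = t" "card J = l"
  shows "\<exists>\<sigma>. bij_betw \<sigma> {1..n} {1..n} \<and> perm_fam \<sigma> (famA n k (sing I) (sing J)) = A_std n k l t
    \<and> perm_fam \<sigma> (famB n l (sing I) (sing J)) = B_std n l t"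
proof -
  obtain \<sigma> where s: "bij_betw \<sigma> {1..n} {1..n}" "\<sigma> ` I = {1..card I}" "\<sigma> ` J = {1..card J}"
    using ex_perm[OF assms(1,2)] by metis
  have "sing I \<subseteq> Pow {1..n}" "sing J \<subseteq> Pow {1..n}" using assms(1,2) by auto
  then show ?thesis
    using perm_famA[OF s(1)] perm_famB[OF s(1)] s assms(3,4)
    by (intro exI[of _ \<sigma>]) (simp add: perm_part_sing A_std_def B_std_def singl_eq)
qed

theorem theorem1p4:
  fixes n k1 k2 t :: nat and F1 F2 :: "nat set set set"
  assumes "t \<ge> 1" and "k1 \<ge> k2" and "k2 \<ge> t + 2" and "(k1, k2) \<noteq> (3, 3)"
    and "real n \<ge> 2 * Lfun k1 t"
    and "F1 \<subseteq> Parts n k1" and "F2 \<subseteq> Parts n k2"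
    and "cross_t_int t F1 F2" and "nontrivial t F1 F2"
    and max: "\<And>G1 G2. G1 \<subseteq> Parts n k1 \<Longrightarrow> G2 \<subseteq> Parts n k2 \<Longrightarrow>
               cross_t_int t G1 G2 \<Longrightarrow> nontrivial t G1 G2 \<Longrightarrow>
               card G1 * card G2 \<le> card F1 * card F2"
  shows "iso_pair n (F1, F2) (A_std n k1 k2 t, B_std n k2 t) \<or>
         iso_pair n (F1, F2) (B_std n k1 t, A_std n k2 k1 t) \<or>
         iso_pair n (F1, F2) (C_std n k1 t, D_std n k2 t) \<or>
         iso_pair n (F1, F2) (D_std n k1 t, C_std n k2 t)"
proof -
  interpret crossfam n k1 t k1 k2 F1 F2
  proof unfold_locales
    show "1 \<le> t" "t + 2 \<le> k1" "2 * Lfun k1 t \<le> real n" "k1 = max k1 k2" "t + 2 \<le> k2"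
      using assms(1-3,5) by simp_all
    show "card G1 * card G2 \<le> card F1 * card F2"
      if "G1 \<subseteq> Parts n k1" "G2 \<subseteq> Parts n k2" "cross_t_int t G1 G2" "nontrivial t G1 G2" for G1 G2
      using that by (rule max)
  qed (rule assms(4,6-9))+
  \<comment> \<open>The exchanged copy accounts for the alternatives (B, A) and (D, C).\<close>
  interpret sw: crossfam n k1 t k2 k1 F2 F1 by (rule swapped)
  from extremal_cases show ?thesis
  proof (elim disjE)
    assume isCD
    then obtain I where I: "I \<subseteq> {1..n}" "card I = t + 1"
      and eq: "F1 = famC n k1 (sing I)" "F2 = famD n t k2 (sing I)" unfolding isCD_def by blast
    from iso_CD[OF I, of k1 k2] show ?thesis unfolding eq iso_pair_def by simp
  next
    assume isAB
    then obtain I J where IJ: "I \<subseteq> J" "J \<subseteq> {1..n}" "card I = t" "card J = k2"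
      and eq: "F1 = famA n k1 (sing I) (sing J)" "F2 = famB n k2 (sing I) (sing J)" unfolding isAB_def by blast
    from iso_AB[OF IJ, of k1] show ?thesis unfolding eq iso_pair_def by simp
  next
    assume sw.isCD
    then obtain I where I: "I \<subseteq> {1..n}" "card I = t + 1"
      and eq: "F2 = famC n k2 (sing I)" "F1 = famD n t k1 (sing I)" unfolding sw.isCD_def by blast
    from iso_CD[OF I, of k2 k1] show ?thesis unfolding eq iso_pair_def by (simp add: conj_commute)
  next
    assume sw.isAB
    then obtain I J where IJ: "I \<subseteq> J" "J \<subseteq> {1..n}" "card I = t" "card J = k1"
      and eq: "F2 = famA n k2 (sing I) (sing J)" "F1 = famB n k1 (sing I) (sing J)" unfolding sw.isAB_def by blast
    from iso_AB[OF IJ, of k2] show ?thesis unfolding eq iso_pair_def by (simp add: conj_commute)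
  qed
qed

end
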